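(* Let $p$ be an odd prime and let $\eta$ be trivial or $\left(\frac{\cdot}{p}\right)$. Let $n>1$. There exist exactly two irreducible constituents $\sigma(n),\sigma'(n)$ of $I(n)$ that do not occur in $I(n-1)$. Each contains, up to scalar multiple, a unique nonzero vector of $(\overline{K_n},\overline\eta)$-type and no nonzero vector of $(\overline{K_{n-1}},\overline\eta)$-type. At level $1$, the two irreducible constituents of $I(1)$ have dimensions summing to $p+1$, while for $n\ge2$ one has $\dim\sigma(n)+\dim\sigma'(n)=p^{n-2}(p^2-1)$.
   Context: $K=\mathrm{SL}_2(\mathbb Z_p)$, $K_n=K_0(p^n)=\{\begin{pmatrix}a&b\\c&d\end{pmatrix}\in K:c\in p^n\mathbb Z_p\}$. $\widetilde G$ is the metaplectic double cover of $\mathrm{SL}_2(\mathbb Q_p)$ and $\overline S$ the full inverse image of a subgroup $S$; since $p$ is odd the cover splits over $K$ and one identifies $\overline K=K\times\{\pm1\}$, $\overline{K_n}=K_n\times\{\pm1\}$. $\eta$ (trivial or the Legendre symbol mod $p$) defines the character $\begin{pmatrix}a&b\\c&d\end{pmatrix}\mapsto\eta(d)$ of $K_n$ ($n\geq 1$) and the genuine character $\eta((A,\epsilon))=\epsilon\eta(A)$ of $\overline{K_n}$. $I(n)=\mathrm{Ind}_{\overline{K_n}}^{\overline K}\overline\eta$ is the space of locally constant $\phi:\overline K\to\mathbb C$ with $\phi(k_0k)=\overline\eta(k_0)\phi(k)$ for $k_0\in\overline{K_n}$, $k\in\overline K$, with $\overline K$ acting by right translation. A vector $v$ of a representation $\rho$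 of $\overline K$ is of $(\overline{K_m},\overline\eta)$-type if $\rho(k_0)v=\overline\eta(k_0)v$ for all $k_0\in\overline{K_m}$. *)

theory Defs
  imports
    Complex_Main
    "HOL-Library.Function_Algebras"
    "HOL-Algebra.Ideal"
    "HOL-Number_Theory.Number_Theory"
begin

section \<open>The ring of p-adic integers and SL2 over it\<close>

text \<open>
  The ring \<open>\<int>\<^sub>p\<close> is the inverse limit of the rings \<open>\<int>/p\<^sup>n\<close>: an element is a coherent sequence whose
  \<open>n\<close>-th entry is its residue modulo \<open>p\<^sup>n\<close>, represented in \<open>{0..<p\<^sup>n}\<close>.
\<close>

type_synonym padic = "nat \<Rightarrow> int"

definition Zp :: "nat \<Rightarrow> padic ring" where
  "Zp p = \<lparr>
     carrier = {x. \<forall>n. x n \<in> {0..<int p ^ n} \<and> x (Suc n) mod int p ^ n = x n},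
     mult = (\<lambda>x y n. (x n * y n) mod int p ^ n),
     one = (\<lambda>n. 1 mod int p ^ n),
     zero = (\<lambda>n. 0),
     add = (\<lambda>x y n. (x n + y n) mod int p ^ n)\<rparr>"

definition pow_ideal :: "nat \<Rightarrow> nat \<Rightarrow> padic set" where
  "pow_ideal p n = PIdl\<^bsub>Zp p\<^esub> ([(p ^ n)] \<cdot>\<^bsub>Zp p\<^esub> \<one>\<^bsub>Zp p\<^esub>)"

text \<open>The tuple \<open>(a, b, c, d)\<close> is the matrix with rows \<open>(a, b)\<close> and \<open>(c, d)\<close>.\<close>

type_synonym mat2 = "padic \<times> padic \<times> padic \<times> padic"

definition mat2_mult :: "nat \<Rightarrow> mat2 \<Rightarrow> mat2 \<Rightarrow> mat2" where
  "mat2_mult p = (\<lambda>(a, b, c, d) (a', b', c', d').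
     (a \<otimes>\<^bsub>Zp p\<^esub> a' \<oplus>\<^bsub>Zp p\<^esub> b \<otimes>\<^bsub>Zp p\<^esub> c',
      a \<otimes>\<^bsub>Zp p\<^esub> b' \<oplus>\<^bsub>Zp p\<^esub> b \<otimes>\<^bsub>Zp p\<^esub> d',
      c \<otimes>\<^bsub>Zp p\<^esub> a' \<oplus>\<^bsub>Zp p\<^esub> d \<otimes>\<^bsub>Zp p\<^esub> c',
      c \<otimes>\<^bsub>Zp p\<^esub> b' \<oplus>\<^bsub>Zp p\<^esub> d \<otimes>\<^bsub>Zp p\<^esub> d'))"

definition SL2 :: "nat \<Rightarrow> mat2 monoid" where
  "SL2 p = \<lparr>
     carrier = {(a, b, c, d).
       a \<in> carrier (Zp p) \<and> b \<in> carrier (Zp p) \<and> c \<in> carrier (Zp p) \<and> d \<in> carrier (Zp p) \<and>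
       a \<otimes>\<^bsub>Zp p\<^esub> d \<ominus>\<^bsub>Zp p\<^esub> b \<otimes>\<^bsub>Zp p\<^esub> c = \<one>\<^bsub>Zp p\<^esub>},
     mult = mat2_mult p,
     one = (\<one>\<^bsub>Zp p\<^esub>, \<zero>\<^bsub>Zp p\<^esub>, \<zero>\<^bsub>Zp p\<^esub>, \<one>\<^bsub>Zp p\<^esub>)\<rparr>"

definition K0 :: "nat \<Rightarrow> nat \<Rightarrow> mat2 set" where
  "K0 p n = {(a, b, c, d) \<in> carrier (SL2 p). c \<in> pow_ideal p n}"

section \<open>The inverse images in the double cover, and the genuine character\<close>

definition sign_group :: "int monoid" where
  "sign_group = \<lparr>carrier = {1, -1}, mult = (*), one = 1\<rparr>"

text \<open>
  For odd \<open>p\<close> the metaplectic double cover of \<open>SL\<^sub>2(\<rat>\<^sub>p)\<close> splits over \<open>SL\<^sub>2(\<int>\<^sub>p)\<close>; the inverse image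
  of \<open>SL\<^sub>2(\<int>\<^sub>p)\<close> is identified, through this splitting, with the direct product with \<open>{1, -1}\<close>.
\<close>

type_synonym cov = "mat2 \<times> int"

definition Kbar :: "nat \<Rightarrow> cov monoid" where
  "Kbar p = SL2 p \<times>\<times> sign_group"

definition K0bar :: "nat \<Rightarrow> nat \<Rightarrow> cov set" where
  "K0bar p n = K0 p n \<times> carrier sign_group"

text \<open>Here \<open>d 1\<close> is the residue of \<open>d\<close> modulo \<open>p\<close>.\<close>

definition legendre_char :: "nat \<Rightarrow> padic \<Rightarrow> complex" where
  "legendre_char p d = of_int (Legendre (d 1) (int p))"

definition eta_bar :: "(padic \<Rightarrow> complex) \<Rightarrow> cov \<Rightarrow> complex" where
  "eta_bar eta = (\<lambda>((a, b, c, d), e). of_int e * eta d)"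

section \<open>Representations on spaces of complex functions\<close>

definition fscale :: "complex \<Rightarrow> ('a \<Rightarrow> complex) \<Rightarrow> 'a \<Rightarrow> complex" where
  "fscale c f = (\<lambda>x. c * f x)"

interpretation fun_space: vector_space "fscale :: complex \<Rightarrow> ('a \<Rightarrow> complex) \<Rightarrow> 'a \<Rightarrow> complex"
  by unfold_locales (auto simp: fscale_def fun_eq_iff algebra_simps)

text \<open>
  In the following, \<open>\<rho> g\<close> is the operator by which \<open>g\<close> acts, and a representation is given by the space
  on which these operators act.
\<close>

definition subrep ::
  "('g, 'm) monoid_scheme \<Rightarrow> ('g \<Rightarrow> ('a \<Rightarrow> complex) \<Rightarrow> ('a \<Rightarrow> complex)) \<Rightarrow>
   ('a \<Rightarrow> complex) set \<Rightarrow> ('a \<Rightarrow> complex) set \<Rightarrow> bool" where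
  "subrep G \<rho> V W \<longleftrightarrow>
     W \<subseteq> V \<and> fun_space.subspace W \<and> (\<forall>g\<in>carrier G. \<forall>w\<in>W. \<rho> g w \<in> W)"

definition irreducible_rep ::
  "('g, 'm) monoid_scheme \<Rightarrow> ('g \<Rightarrow> ('a \<Rightarrow> complex) \<Rightarrow> ('a \<Rightarrow> complex)) \<Rightarrow>
   ('a \<Rightarrow> complex) set \<Rightarrow> bool" where
  "irreducible_rep G \<rho> W \<longleftrightarrow>
     subrep G \<rho> W W \<and> W \<noteq> {0} \<and> (\<forall>U. subrep G \<rho> W U \<longrightarrow> U = {0} \<or> U = W)"

definition rep_iso ::
  "('g, 'm) monoid_scheme \<Rightarrow> ('g \<Rightarrow> ('a \<Rightarrow> complex) \<Rightarrow> ('a \<Rightarrow> complex)) \<Rightarrow>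
   ('a \<Rightarrow> complex) set \<Rightarrow> ('a \<Rightarrow> complex) set \<Rightarrow> bool" where
  "rep_iso G \<rho> V W \<longleftrightarrow>
     (\<exists>T. bij_betw T V W \<and>
          (\<forall>u\<in>V. \<forall>v\<in>V. T (u + v) = T u + T v) \<and>
          (\<forall>c. \<forall>v\<in>V. T (fscale c v) = fscale c (T v)) \<and>
          (\<forall>g\<in>carrier G. \<forall>v\<in>V. T (\<rho> g v) = \<rho> g (T v)))"

text \<open>
  The representations considered below are finite-dimensional representations of a compact group,
  hence semisimple, so irreducible constituents are irreducible subrepresentations. They are taken
  as subspaces, not up to isomorphism, so that the set of constituents also records multiplicities:
  an irreducible representation occurring with multiplicity at least 2 gives infinitely many.
\<close>

definition constituents ::
  "('g, 'm) monoid_scheme \<Rightarrow> ('g \<Rightarrow> ('a \<Rightarrow> complex) \<Rightarrow> ('a \<Rightarrow> complex)) \<Rightarrow>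
   ('a \<Rightarrow> complex) set \<Rightarrow> ('a \<Rightarrow> complex) set set" where
  "constituents G \<rho> V = {W. subrep G \<rho> V W \<and> irreducible_rep G \<rho> W}"

definition occurs_in ::
  "('g, 'm) monoid_scheme \<Rightarrow> ('g \<Rightarrow> ('a \<Rightarrow> complex) \<Rightarrow> ('a \<Rightarrow> complex)) \<Rightarrow>
   ('a \<Rightarrow> complex) set \<Rightarrow> ('a \<Rightarrow> complex) set \<Rightarrow> bool" where
  "occurs_in G \<rho> W V \<longleftrightarrow> (\<exists>U. subrep G \<rho> V U \<and> rep_iso G \<rho> W U)"

definition of_type ::
  "('g \<Rightarrow> ('a \<Rightarrow> complex) \<Rightarrow> ('a \<Rightarrow> complex)) \<Rightarrow> 'g set \<Rightarrow> ('g \<Rightarrow> complex) \<Rightarrow>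
   ('a \<Rightarrow> complex) \<Rightarrow> bool" where
  "of_type \<rho> H \<chi> v \<longleftrightarrow> (\<forall>h\<in>H. \<rho> h v = fscale (\<chi> h) v)"

section \<open>The induced representations\<close>

definition cov_cong :: "nat \<Rightarrow> nat \<Rightarrow> cov \<Rightarrow> cov \<Rightarrow> bool" where
  "cov_cong p m = (\<lambda>((a, b, c, d), e) ((a', b', c', d'), e').
     a \<ominus>\<^bsub>Zp p\<^esub> a' \<in> pow_ideal p m \<and> b \<ominus>\<^bsub>Zp p\<^esub> b' \<in> pow_ideal p m \<and>
     c \<ominus>\<^bsub>Zp p\<^esub> c' \<in> pow_ideal p m \<and> d \<ominus>\<^bsub>Zp p\<^esub> d' \<in> pow_ideal p m \<and> e = e')"

text \<open>The sets \<open>{k'. cov_cong p m k k'}\<close> are a basis of neighbourhoods of \<open>k\<close> for the p-adic topology.\<close>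

definition locally_constant :: "nat \<Rightarrow> (cov \<Rightarrow> complex) \<Rightarrow> bool" where
  "locally_constant p \<phi> \<longleftrightarrow>
     (\<forall>k\<in>carrier (Kbar p). \<exists>m. \<forall>k'\<in>carrier (Kbar p). cov_cong p m k k' \<longrightarrow> \<phi> k' = \<phi> k)"

text \<open>Functions on the group are represented by total functions that vanish off its carrier.\<close>

definition Ind :: "nat \<Rightarrow> (padic \<Rightarrow> complex) \<Rightarrow> nat \<Rightarrow> (cov \<Rightarrow> complex) set" where
  "Ind p eta n = {\<phi>.
     (\<forall>k. k \<notin> carrier (Kbar p) \<longrightarrow> \<phi> k = 0) \<and>
     locally_constant p \<phi> \<and>
     (\<forall>k0\<in>K0bar p n. \<forall>k\<in>carrier (Kbar p). \<phi> (k0 \<otimes>\<^bsub>Kbar p\<^esub> k) = eta_bar eta k0 * \<phi> k)}"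

definition rtrans :: "nat \<Rightarrow> cov \<Rightarrow> (cov \<Rightarrow> complex) \<Rightarrow> cov \<Rightarrow> complex" where
  "rtrans p g \<phi> = (\<lambda>k. if k \<in> carrier (Kbar p) then \<phi> (k \<otimes>\<^bsub>Kbar p\<^esub> g) else 0)"

end

theory Submission
  imports Defs
begin

text \<open>
  A function in \<open>I(n)\<close> is determined by its values on bottom rows modulo \<open>p\<^sup>n\<close>. Averaging over
  \<open>K\<^sub>n\<close> shows that every nonzero subrepresentation of \<open>I(n)\<close> contains a vector of \<open>K\<^sub>n\<close>-type that does
  not vanish at the identity, so a subrepresentation in which such vectors are determined by their value
  at the identity is governed by a single vector: it has only scalar intertwiners into \<open>I(n)\<close>.

  For \<open>n \<ge> 2\<close> let \<open>J\<close> be the complement of \<open>I(n - 1)\<close> in \<open>I(n)\<close>: the functions whose sum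
  vanishes over each fibre, of \<open>p\<close> elements, of the map from \<open>K\<^sub>n\<close>-cosets to \<open>K\<^sub>n\<^sub>-\<^sub>1\<close>-cosets.
  Convolution along the fibres with the Legendre symbol commutes with the group and squares to
  \<open>(-1|p) p\<close> on \<open>J\<close>, so \<open>J\<close> is the sum of two eigenspaces.
  A vector of \<open>K\<^sub>n\<close>-type in \<open>J\<close> is supported on the fibre of the identity, where it depends only on the
  quadratic class of the fibre coordinate, and on an eigenspace the fibre sum and the eigenvalue equation
  leave one free parameter. At level one the same argument applies to the standard intertwining operator
  \<open>M\<close>, which satisfies \<open>M\<^sup>2 = (\<Sum> \<eta>) M + p \<eta>(-1)\<close>.
\<close>

section \<open>Intertwiners and induced representations\<close>

text \<open>The choice of the Legendre symbol is forced. The fibre over the identity is a copy of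
  Z/p, and moving an element of \<open>K0bar p n\<close> across it multiplies the coordinate by the
  square of a unit. A kernel on the fibre therefore preserves I(n) once it is constant on square
  classes. Such kernels are spanned by the point mass at 0, which is the identity operator, the
  constant 1, which acts as zero on \<open>J\<close>, and the Legendre symbol; only the last can
  split \<open>J\<close>.

  Constituents are counted as subspaces. Two irreducible summands that were isomorphic would produce
  infinitely many further constituents, so the eigenspaces must be shown non-isomorphic. That, and
  their absence from I(n-1), both come from the scalarity of intertwiners into I(n), a hand-made
  Frobenius reciprocity that needs neither Haar measure nor complete reducibility.

  At level n the eigenvalues do not depend on the character. At level one they do: \<open>p\<close>
  and -1 for the trivial character, the two square roots of (-1|p) p for the Legendre
  symbol.\<close>

lemma dim_direct_sum:
  fixes S T :: "('a \<Rightarrow> complex) set"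
  assumes S: "fun_space.subspace S" and T: "fun_space.subspace T" and ST: "S \<inter> T = {0}"
    and F: "finite F" "{x + y |x y. x \<in> S \<and> y \<in> T} \<subseteq> fun_space.span F"
  shows "fun_space.dim {x + y |x y. x \<in> S \<and> y \<in> T} = fun_space.dim S + fun_space.dim T"
proof -
  let ?U = "{x + y |x y. x \<in> S \<and> y \<in> T}"
  have "x \<in> ?U" if "x \<in> S" for x
    using that fun_space.subspace_0[OF T] by (intro CollectI exI[of _ x] exI[of _ 0]) simp
  hence SU: "S \<subseteq> ?U" by blast
  have "x \<in> ?U" if "x \<in> T" for x
    using that fun_space.subspace_0[OF S] by (intro CollectI exI[of _ 0] exI[of _ x]) simp
  hence TU: "T \<subseteq> ?U" by blast
  obtain A where A: "A \<subseteq> S" "fun_space.independent A" "S \<subseteq> fun_space.span A"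
    "card A = fun_space.dim S"
    using fun_space.basis_exists by blast
  obtain B where B: "B \<subseteq> T" "fun_space.independent B" "T \<subseteq> fun_space.span B"
    "card B = fun_space.dim T"
    using fun_space.basis_exists by blast
  \<comment> \<open>An independent set could a priori be infinite, and then its cardinality would
    say nothing; the finite spanning set \<open>F\<close> bounds both bases.\<close>
  have fA: "finite A" using fun_space.independent_span_bound[OF F(1) A(2)] A(1) SU F(2) by blast
  have fB: "finite B" using fun_space.independent_span_bound[OF F(1) B(2)] B(1) TU F(2) by blast
  have disj: "A \<inter> B = {}"
  proof (rule equals0I)
    fix x assume x: "x \<in> A \<inter> B"
    hence "x \<in> S \<inter> T" using Int_mono[OF A(1) B(1)] by (rule subsetD[rotated])
    hence "x = 0" unfolding ST by simp
    hence "0 \<in> A" using x by simp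
    thus False using A(2) fun_space.dependent_zero[of A] by simp
  qed
  have ind: "fun_space.independent (A \<union> B)"
  proof (rule fun_space.independent_if_scalars_zero)
    show "finite (A \<union> B)" using fA fB by simp
    fix f x assume z: "(\<Sum>x\<in>A \<union> B. fscale (f x) x) = 0" and x: "x \<in> A \<union> B"
    let ?s = "\<Sum>x\<in>A. fscale (f x) x" and ?t = "\<Sum>x\<in>B. fscale (f x) x"
    have st: "?s + ?t = 0" using z sum.union_disjoint[OF fA fB disj, of "\<lambda>x. fscale (f x) x"] by simp
    have sS: "?s \<in> S" using A(1) by (intro fun_space.subspace_sum[OF S] fun_space.subspace_scale[OF S]) auto
    have tT: "?t \<in> T" using B(1) by (intro fun_space.subspace_sum[OF T] fun_space.subspace_scale[OF T]) auto
    have "?s = - ?t" using st by (simp add: eq_neg_iff_add_eq_0)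
    hence "?s \<in> T" using fun_space.subspace_neg[OF T tT] by simp
    hence "?s \<in> S \<inter> T" using sS by simp
    hence s0: "?s = 0" unfolding ST by simp
    hence t0: "?t = 0" using st by simp
    show "f x = 0"
      using x fun_space.independentD[OF A(2) fA subset_refl s0]
        fun_space.independentD[OF B(2) fB subset_refl t0] by blast
  qed
  have "card (A \<union> B) = fun_space.dim ?U"
  proof (rule fun_space.basis_card_eq_dim[OF _ _ ind])
    show "A \<union> B \<subseteq> ?U" using A(1) B(1) SU TU by blast
    have "S \<subseteq> fun_space.span (A \<union> B)" "T \<subseteq> fun_space.span (A \<union> B)"
      using A(3) B(3) fun_space.span_mono[of A "A \<union> B"] fun_space.span_mono[of B "A \<union> B"] by blast+
    thus "?U \<subseteq> fun_space.span (A \<union> B)" by (auto intro!: fun_space.span_add)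
  qed
  thus ?thesis using card_Un_disjoint[OF fA fB disj] A(4) B(4) by simp
qed

text \<open>No codomain is recorded and \<open>T\<close> is constrained on \<open>V\<close> only.
  The same predicate thus serves restrictions, inverses on an image and operators into a larger
  space; a bijective one is exactly a \<open>rep_iso\<close>.\<close>

definition intertwiner ::
  "('g, 'm) monoid_scheme \<Rightarrow> ('g \<Rightarrow> ('a \<Rightarrow> complex) \<Rightarrow> ('a \<Rightarrow> complex)) \<Rightarrow>
   ('a \<Rightarrow> complex) set \<Rightarrow> (('a \<Rightarrow> complex) \<Rightarrow> 'a \<Rightarrow> complex) \<Rightarrow> bool" where
  "intertwiner G \<rho> V T \<longleftrightarrow>
     (\<forall>u\<in>V. \<forall>v\<in>V. T (u + v) = T u + T v) \<and>
     (\<forall>c. \<forall>v\<in>V. T (fscale c v) = fscale c (T v)) \<and>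
     (\<forall>g\<in>carrier G. \<forall>v\<in>V. T (\<rho> g v) = \<rho> g (T v))"

lemma rep_iso_iff: "rep_iso G \<rho> V W \<longleftrightarrow> (\<exists>T. bij_betw T V W \<and> intertwiner G \<rho> V T)"
  by (simp add: rep_iso_def intertwiner_def)

lemma intertwinerD:
  assumes "intertwiner G \<rho> V T"
  shows "u \<in> V \<Longrightarrow> v \<in> V \<Longrightarrow> T (u + v) = T u + T v"
    and "v \<in> V \<Longrightarrow> T (fscale c v) = fscale c (T v)"
    and "g \<in> carrier G \<Longrightarrow> v \<in> V \<Longrightarrow> T (\<rho> g v) = \<rho> g (T v)"
  using assms by (auto simp: intertwiner_def)

lemma subrepD:
  assumes "subrep G \<rho> V W"
  shows "w \<in> W \<Longrightarrow> w \<in> V" "fun_space.subspace W" "g \<in> carrier G \<Longrightarrow> w \<in> W \<Longrightarrow> \<rho> g w \<in> W"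
    and "0 \<in> W" "u \<in> W \<Longrightarrow> w \<in> W \<Longrightarrow> u + w \<in> W" "u \<in> W \<Longrightarrow> w \<in> W \<Longrightarrow> u - w \<in> W"
    "w \<in> W \<Longrightarrow> fscale c w \<in> W"
  using assms
  by (auto simp: subrep_def fun_space.subspace_0 fun_space.subspace_add fun_space.subspace_diff
      fun_space.subspace_scale)

lemma subrep_trans: "subrep G \<rho> V W \<Longrightarrow> subrep G \<rho> W U \<Longrightarrow> subrep G \<rho> V U"
  by (auto simp: subrep_def)

lemma subrep_weaken: "subrep G \<rho> V U \<Longrightarrow> U \<subseteq> W \<Longrightarrow> subrep G \<rho> W U"
  by (auto simp: subrep_def)

lemma intertwiner_zero:
  assumes "subrep G \<rho> V W" "intertwiner G \<rho> W T"
  shows "T 0 = 0"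
  using intertwinerD(2)[OF assms(2) subrepD(4)[OF assms(1)], of 0]
  by (simp add: fscale_def fun_eq_iff zero_fun_def)

lemma intertwiner_diff:
  assumes "subrep G \<rho> V W" "intertwiner G \<rho> W T" "u \<in> W" "v \<in> W"
  shows "T (u - v) = T u - T v"
proof -
  have "T (u - v + v) = T (u - v) + T v"
    using assms by (intro intertwinerD(1)[OF assms(2)] subrepD(6)[OF assms(1)])
  thus ?thesis by simp
qed

text \<open>The operators \<open>\<rho> g\<close> are arbitrary functions here, so that they fix 0
  has to be supplied.\<close>

lemma subrep_kernel:
  assumes "subrep G \<rho> V W" "intertwiner G \<rho> W T" and \<rho>0: "\<And>g. g \<in> carrier G \<Longrightarrow> \<rho> g 0 = 0"
  shows "subrep G \<rho> W {w \<in> W. T w = 0}"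
  unfolding subrep_def fun_space.subspace_def
  using subrepD[OF assms(1)] intertwinerD[OF assms(2)] intertwiner_zero[OF assms(1,2)] \<rho>0
  by (auto simp: fun_space.scale_zero_right)

lemma subrep_image:
  assumes W: "subrep G \<rho> V W" and T: "intertwiner G \<rho> W T"
  shows "subrep G \<rho> (T ` W) (T ` W)"
proof -
  have "fun_space.subspace (T ` W)"
  proof (rule fun_space.subspaceI)
    show "0 \<in> T ` W" using intertwiner_zero[OF W T] subrepD(4)[OF W] by force
    show "x + y \<in> T ` W" if "x \<in> T ` W" "y \<in> T ` W" for x y
      using that subrepD(5)[OF W] intertwinerD(1)[OF T] by (metis (no_types, lifting) imageE imageI)
    show "fscale c x \<in> T ` W" if "x \<in> T ` W" for c x
      using that subrepD(7)[OF W] intertwinerD(2)[OF T] by (metis (no_types, lifting) imageE imageI)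
  qed
  moreover have "\<rho> g x \<in> T ` W" if "g \<in> carrier G" "x \<in> T ` W" for g x
      using that subrepD(3)[OF W] intertwinerD(3)[OF T] by (metis (no_types, lifting) imageE imageI)
  ultimately show ?thesis by (simp add: subrep_def)
qed

lemma intertwiner_subset: "intertwiner G \<rho> V T \<Longrightarrow> W \<subseteq> V \<Longrightarrow> intertwiner G \<rho> W T"
  unfolding intertwiner_def by blast

text \<open>The kernel is a subrepresentation of an irreducible space. The target is not assumed
  irreducible, because the lemma is applied to operators from \<open>W\<close> into a whole induced
  space.\<close>

lemma schur_injective:
  assumes W: "irreducible_rep G \<rho> W" and T: "intertwiner G \<rho> W T"
    and \<rho>0: "\<And>g. g \<in> carrier G \<Longrightarrow> \<rho> g 0 = 0"
  shows "(\<forall>w\<in>W. T w = 0) \<or> inj_on T W"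
proof -
  have WW: "subrep G \<rho> W W" using W by (simp add: irreducible_rep_def)
  have "{w \<in> W. T w = 0} = {0} \<or> {w \<in> W. T w = 0} = W"
    using W subrep_kernel[OF WW T \<rho>0] by (simp add: irreducible_rep_def)
  thus ?thesis
  proof
    assume k: "{w \<in> W. T w = 0} = {0}"
    have "inj_on T W"
    proof (rule inj_onI)
      fix x y assume xy: "x \<in> W" "y \<in> W" "T x = T y"
      hence "x - y \<in> {w \<in> W. T w = 0}"
        using intertwiner_diff[OF WW T] subrepD(6)[OF WW] by simp
      thus "x = y" using k by simp
    qed
    thus ?thesis ..
  qed blast
qed

section \<open>Induction from a subgroup with finitely many cosets\<close>

definition right_translation :: "('g, 'm) monoid_scheme \<Rightarrow> 'g \<Rightarrow> ('g \<Rightarrow> complex) \<Rightarrow> 'g \<Rightarrow> complex" where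
  "right_translation G g \<phi> = (\<lambda>k. if k \<in> carrier G then \<phi> (k \<otimes>\<^bsub>G\<^esub> g) else 0)"

lemma right_translation_linear:
  "right_translation G g (u + v) = right_translation G g u + right_translation G g v"
  "right_translation G g (fscale c v) = fscale c (right_translation G g v)"
  "right_translation G g 0 = 0"
  by (auto simp: right_translation_def fscale_def fun_eq_iff)

lemma right_translation_sum:
  "right_translation G g (\<Sum>x\<in>X. F x) = (\<Sum>x\<in>X. right_translation G g (F x))"
  by (induction X rule: infinite_finite_induct)
    (simp_all only: right_translation_linear sum.infinite sum.empty sum.insert simp_thms)

text \<open>Topology does not enter: finiteness of the set \<open>R\<close> of representatives of
  the cosets \<open>H r\<close> and of the image of \<open>\<chi>\<close> replaces compactness and
  keeps the orbits in the averaging argument finite.\<close>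

locale induced_rep = group G for G (structure) +
  fixes H :: "'a set" and \<chi> :: "'a \<Rightarrow> complex" and R :: "'a set"
  assumes H: "subgroup H G"
    and chi_mult: "\<And>h h'. h \<in> H \<Longrightarrow> h' \<in> H \<Longrightarrow> \<chi> (h \<otimes> h') = \<chi> h * \<chi> h'"
    and chi_nonzero: "\<And>h. h \<in> H \<Longrightarrow> \<chi> h \<noteq> 0"
    and finite_chi: "finite (\<chi> ` H)"
    and finite_R: "finite R"
    and R_carrier: "R \<subseteq> carrier G"
    and R_exists: "\<And>k. k \<in> carrier G \<Longrightarrow> \<exists>h\<in>H. \<exists>r\<in>R. k = h \<otimes> r"
    and R_unique: "\<And>h r r'. h \<in> H \<Longrightarrow> r \<in> R \<Longrightarrow> r' \<in> R \<Longrightarrow> r = h \<otimes> r' \<Longrightarrow> r = r'"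
begin

abbreviation \<rho> :: "'a \<Rightarrow> ('a \<Rightarrow> complex) \<Rightarrow> 'a \<Rightarrow> complex" where "\<rho> \<equiv> right_translation G"

definition I :: "('a \<Rightarrow> complex) set" where
  "I = {\<phi>. (\<forall>k. k \<notin> carrier G \<longrightarrow> \<phi> k = 0) \<and> (\<forall>h\<in>H. \<forall>k\<in>carrier G. \<phi> (h \<otimes> k) = \<chi> h * \<phi> k)}"

text \<open>The extension of \<open>\<chi>\<close> by zero is at once the standard cyclic vector of
  the induced space and a vector of type \<open>\<chi>\<close> under \<open>H\<close>.\<close>

definition \<delta> :: "'a \<Rightarrow> complex" where "\<delta> k = (if k \<in> H then \<chi> k else 0)"

lemma H_carrier: "h \<in> H \<Longrightarrow> h \<in> carrier G"
  using subgroup.mem_carrier[OF H] .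

lemmas H_closed = subgroup.m_closed[OF H] subgroup.m_inv_closed[OF H] subgroup.one_closed[OF H]

lemma chi_one: "\<chi> \<one> = 1"
  using chi_mult[of \<one> \<one>] chi_nonzero[of \<one>] H_closed(3) by auto

lemma I_outside: "f \<in> I \<Longrightarrow> k \<notin> carrier G \<Longrightarrow> f k = 0"
  by (simp add: I_def)

lemma I_left: "f \<in> I \<Longrightarrow> h \<in> H \<Longrightarrow> k \<in> carrier G \<Longrightarrow> f (h \<otimes> k) = \<chi> h * f k"
  by (simp add: I_def)

lemma I_eqI:
  assumes "f \<in> I" "g \<in> I" "\<And>r. r \<in> R \<Longrightarrow> f r = g r"
  shows "f = g"
proof
  fix k show "f k = g k"
  proof (cases "k \<in> carrier G")
    case True
    then obtain h r where "h \<in> H" "r \<in> R" "k = h \<otimes> r" using R_exists by blast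
    thus ?thesis using assms I_left R_carrier by (metis subsetD)
  qed (simp add: I_outside[OF assms(1)] I_outside[OF assms(2)])
qed

lemma subrep_I: "subrep G \<rho> I I"
  unfolding subrep_def fun_space.subspace_def
  by (auto simp: I_def right_translation_def fscale_def H_carrier m_assoc algebra_simps)

lemma \<rho>_\<rho>: "g \<in> carrier G \<Longrightarrow> g' \<in> carrier G \<Longrightarrow> \<rho> g (\<rho> g' f) = \<rho> (g \<otimes> g') f"
  by (auto simp: right_translation_def fun_eq_iff m_assoc)

lemma \<delta>_I: "\<delta> \<in> I"
proof -
  have "h \<otimes> k \<in> H \<longleftrightarrow> k \<in> H" if "h \<in> H" "k \<in> carrier G" for h k
    using that H_closed(1,2)
    by (metis H_carrier inv_solve_left m_closed)
  thus ?thesis using H_carrier chi_mult by (auto simp: I_def \<delta>_def)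
qed

lemma of_type_\<delta>: "of_type \<rho> H \<chi> \<delta>"
proof -
  have "k \<otimes> h \<in> H \<longleftrightarrow> k \<in> H" if "h \<in> H" "k \<in> carrier G" for h k
    using that H_closed(1,2) by (metis H_carrier inv_solve_right m_closed)
  thus ?thesis using H_carrier chi_mult
    by (auto simp: of_type_def \<delta>_def right_translation_def fscale_def fun_eq_iff)
qed

lemma \<delta>_one: "\<delta> \<one> = 1"
  using chi_one H_closed(3) by (simp add: \<delta>_def)

text \<open>If \<open>r\<close> times the inverse of \<open>r'\<close> lies in \<open>H\<close>,
  then \<open>r\<close> and \<open>r'\<close> represent the same coset. The translates of
  \<open>\<delta>\<close> are thus dual to evaluation on \<open>R\<close>; the expansion of
  \<open>f\<close>, generation by \<open>\<delta>\<close> and the dimension all follow from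
  this.\<close>

lemma \<delta>_translate:
  assumes "r \<in> R" "r' \<in> R"
  shows "\<rho> (inv r') \<delta> r = (if r = r' then 1 else 0)"
proof -
  have c: "r \<in> carrier G" "r' \<in> carrier G" using assms R_carrier by auto
  have "r \<otimes> inv r' \<in> H \<Longrightarrow> r = r'"
    using assms c R_unique[of "r \<otimes> inv r'" r r'] by (simp add: m_assoc)
  thus ?thesis using c chi_one H_closed(3) by (auto simp: right_translation_def \<delta>_def r_inv)
qed

lemma \<delta>_expansion:
  assumes "f \<in> I"
  shows "f = (\<Sum>r\<in>R. fscale (f r) (\<rho> (inv r) \<delta>))"
proof (rule I_eqI[OF assms])
  have sub: "fun_space.subspace I" using subrepD(2)[OF subrep_I] .
  show "(\<Sum>r\<in>R. fscale (f r) (\<rho> (inv r) \<delta>)) \<in> I"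
    using R_carrier subrepD(3)[OF subrep_I _ \<delta>_I]
    by (intro fun_space.subspace_sum[OF sub] fun_space.subspace_scale[OF sub]) auto
  fix s assume s: "s \<in> R"
  have "(\<Sum>r\<in>R. fscale (f r) (\<rho> (inv r) \<delta>)) s = (\<Sum>r\<in>R. f r * \<rho> (inv r) \<delta> s)"
    by (induction R rule: infinite_finite_induct) (auto simp: fscale_def)
  also have "\<dots> = (\<Sum>r\<in>R. if r = s then f r else 0)"
    by (intro sum.cong) (auto simp: \<delta>_translate s)
  finally show "f s = (\<Sum>r\<in>R. fscale (f r) (\<rho> (inv r) \<delta>)) s"
    using s finite_R by simp
qed

lemma \<delta>_generates:
  assumes "subrep G \<rho> I U" "\<delta> \<in> U"
  shows "U = I"
proof -
  have "f \<in> U" if "f \<in> I" for f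
    using \<delta>_expansion[OF that] R_carrier subrepD(3)[OF assms(1) _ assms(2)]
      fun_space.subspace_sum[OF subrepD(2)[OF assms(1)], of R "\<lambda>r. fscale (f r) (\<rho> (inv r) \<delta>)"]
      subrepD(7)[OF assms(1)] by (metis (no_types, lifting) inv_closed subsetD)
  thus ?thesis using subrepD(1)[OF assms(1)] by blast
qed

lemma I_finite_span: "I \<subseteq> fun_space.span ((\<lambda>r. \<rho> (inv r) \<delta>) ` R)"
proof
  fix f assume "f \<in> I"
  show "f \<in> fun_space.span ((\<lambda>r. \<rho> (inv r) \<delta>) ` R)"
    by (subst \<delta>_expansion[OF \<open>f \<in> I\<close>])
      (intro fun_space.span_sum fun_space.span_scale fun_space.span_base imageI)
qed

lemma dim_I: "fun_space.dim I = card R"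
proof -
  let ?b = "\<lambda>r. \<rho> (inv r) \<delta>"
  have inj: "inj_on ?b R"
    by (rule inj_onI) (metis \<delta>_translate zero_neq_one)
  have "fun_space.independent (?b ` R)"
  proof (rule fun_space.independent_if_scalars_zero)
    show "finite (?b ` R)" using finite_R by simp
    fix f x assume z: "(\<Sum>x\<in>?b ` R. fscale (f x) x) = 0" and "x \<in> ?b ` R"
    then obtain s where s: "s \<in> R" "x = ?b s" by blast
    have "(\<Sum>x\<in>?b ` R. fscale (f x) x) s = (\<Sum>r\<in>R. fscale (f (?b r)) (?b r)) s"
      by (simp add: sum.reindex[OF inj])
    also have "\<dots> = (\<Sum>r\<in>R. f (?b r) * ?b r s)"
      by (induction R rule: infinite_finite_induct) (auto simp: fscale_def)
    also have "\<dots> = (\<Sum>r\<in>R. if r = s then f (?b r) else 0)"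
      by (intro sum.cong) (auto simp: \<delta>_translate s)
    also have "\<dots> = f x" using s finite_R by simp
    finally show "f x = 0" using z by simp
  qed
  moreover have "?b ` R \<subseteq> I" using R_carrier subrepD(3)[OF subrep_I _ \<delta>_I] by auto
  ultimately have "card (?b ` R) = fun_space.dim I"
    using I_finite_span by (intro fun_space.basis_card_eq_dim)
  thus ?thesis using card_image[OF inj] by simp
qed

text \<open>
  Instead of integrating over \<open>H\<close>, average over the orbit of \<open>f\<close> under the operators
  \<open>\<chi>(h)\<inverse> \<rho>(h)\<close>, which is a finite set of functions.
\<close>

lemma average:
  assumes W: "subrep G \<rho> I W" and f: "f \<in> W"
  obtains v where "v \<in> W" "of_type \<rho> H \<chi> v" "v \<one> = f \<one>"
    and "\<And>T. intertwiner G \<rho> W T \<Longrightarrow> T ` W \<subseteq> I \<Longrightarrow> T v \<one> = T f \<one>"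
proof -
  define P where "P h u = fscale (inverse (\<chi> h)) (\<rho> h u)" for h u
  define X where "X = (\<lambda>h. P h f) ` H"
  have PW: "P h u \<in> W" if "h \<in> H" "u \<in> W" for h u
    unfolding P_def using that H_carrier by (intro subrepD(7)[OF W] subrepD(3)[OF W])
  have P_val: "P h u \<one> = u \<one>" if h: "h \<in> H" and u: "u \<in> I" for h u
    using I_left[OF u h, of \<one>] h chi_nonzero H_carrier
    by (simp add: P_def fscale_def right_translation_def)
  have T_P: "T (P h u) = P h (T u)" if "intertwiner G \<rho> W T" "h \<in> H" "u \<in> W" for T h u
    using that H_carrier subrepD(3)[OF W] by (simp add: P_def intertwinerD[OF that(1)])
  have PP: "P h (P h' u) = P (h \<otimes> h') u" if "h \<in> H" "h' \<in> H" for h h' u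
    using that H_carrier chi_mult
    by (simp add: P_def right_translation_linear \<rho>_\<rho>[symmetric] fun_space.scale_scale mult.commute)
  have XW: "X \<subseteq> W" using PW f by (auto simp: X_def)
  have XI: "X \<subseteq> I" using XW subrepD(1)[OF W] by blast
  \<comment> \<open>A member of \<open>I\<close> is determined by its values on \<open>R\<close>.
    The value of \<open>P h f\<close> at \<open>s\<close> is the inverse of \<open>\<chi> h\<close>
    times \<open>\<chi> h'\<close> times \<open>f r\<close>, where
    \<open>s \<otimes> h = h' \<otimes> r\<close>, so only finitely many functions arise.\<close>
  have fin: "finite X"
  proof -
    define Z where "Z = (\<lambda>(x, y, r). inverse x * y * f r) ` (\<chi> ` H \<times> \<chi> ` H \<times> R)"
    have "finite Z" unfolding Z_def using finite_chi finite_R by simp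
    hence "finite (R \<rightarrow>\<^sub>E Z)" using finite_R by (simp add: finite_PiE)
    moreover have "(\<lambda>u. restrict u R) ` X \<subseteq> R \<rightarrow>\<^sub>E Z"
    proof -
      have "P h f s \<in> Z" if h: "h \<in> H" and s: "s \<in> R" for h s
      proof -
        have sc: "s \<in> carrier G" using s R_carrier by blast
        obtain h' r where hr: "h' \<in> H" "r \<in> R" "s \<otimes> h = h' \<otimes> r"
          using R_exists[of "s \<otimes> h"] sc H_carrier[OF h] by auto
        have "P h f s = inverse (\<chi> h) * \<chi> h' * f r"
          using sc hr I_left[OF subrepD(1)[OF W f], of h' r] R_carrier
          by (auto simp: P_def fscale_def right_translation_def)
        thus ?thesis using h hr unfolding Z_def by force
      qed
      thus ?thesis by (auto simp: X_def)
    qed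
    ultimately have "finite ((\<lambda>u. restrict u R) ` X)" by (rule finite_subset[rotated])
    moreover have "inj_on (\<lambda>u. restrict u R) X"
      using XI I_eqI by (intro inj_onI) (metis restrict_apply' subsetD)
    ultimately show ?thesis by (rule finite_imageD)
  qed
  have fX: "f \<in> X"
  proof -
    have "P \<one> f = f"
      using I_outside[OF subrepD(1)[OF W f]] chi_one
      by (auto simp: P_def fscale_def right_translation_def fun_eq_iff)
    thus ?thesis using H_closed(3) unfolding X_def by (metis imageI)
  qed
  define N where "N = (of_nat (card X) :: complex)"
  have N0: "N \<noteq> 0" using fin fX by (auto simp: N_def)
  define v where "v = fscale (inverse N) (\<Sum>u\<in>X. u)"
  have sumW: "(\<Sum>u\<in>X. u) \<in> W" using XW by (intro fun_space.subspace_sum[OF subrepD(2)[OF W]]) auto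
  \<comment> \<open>\<open>T\<close> commutes with \<open>P h\<close>, and by \<open>P_val\<close>
    the operator \<open>P h\<close> preserves the value at the identity of a member of
    \<open>I\<close>; every element of the orbit therefore contributes the same amount.\<close>
  have avg: "T v \<one> = T f \<one>" if T: "intertwiner G \<rho> W T" and TI: "T ` W \<subseteq> I" for T
  proof -
    have "T (\<Sum>u\<in>Y. u) = (\<Sum>u\<in>Y. T u)" if "Y \<subseteq> X" for Y
    proof -
      have "finite Y" using that fin finite_subset by blast
      thus ?thesis using that
      proof (induction Y)
        case empty show ?case unfolding sum.empty by (rule intertwiner_zero[OF W T])
      next
        case (insert y Y)
        have "(\<Sum>u\<in>Y. u) \<in> W"
          using XW insert.prems by (intro fun_space.subspace_sum[OF subrepD(2)[OF W]]) auto
        moreover have "y \<in> W" using insert.prems XW by blast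
        ultimately have "T (y + (\<Sum>u\<in>Y. u)) = T y + T (\<Sum>u\<in>Y. u)"
          by (intro intertwinerD(1)[OF T])
        thus ?case using insert by (simp only: sum.insert insert_subset simp_thms)
      qed
    qed
    hence "T (\<Sum>u\<in>X. u) \<one> = (\<Sum>u\<in>X. T u) \<one>" by simp
    also have "\<dots> = (\<Sum>u\<in>X. T u \<one>)" by (induction X rule: infinite_finite_induct) auto
    also have "\<dots> = (\<Sum>u\<in>X. T f \<one>)"
    proof (rule sum.cong)
      fix u assume "u \<in> X"
      then obtain h where h: "h \<in> H" "u = P h f" by (auto simp: X_def)
      thus "T u \<one> = T f \<one>" using T_P[OF T _ f] P_val TI f by auto
    qed simp
    also have "\<dots> = N * T f \<one>" by (simp add: N_def)
    finally show ?thesis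
      using N0 intertwinerD(2)[OF T sumW] by (simp add: v_def fscale_def)
  qed
  have "of_type \<rho> H \<chi> v"
    unfolding of_type_def
  proof
    fix h assume h: "h \<in> H"
    \<comment> \<open>\<open>P h\<close> maps the orbit into itself and is undone by
      \<open>P (inv h)\<close>, so it permutes \<open>X\<close> and fixes its sum.\<close>
    have sub: "P h ` X \<subseteq> X"
    proof
      fix u assume "u \<in> P h ` X"
      then obtain h' where "h' \<in> H" "u = P h (P h' f)" by (auto simp: X_def)
      thus "u \<in> X" using h PP H_closed(1) by (auto simp: X_def)
    qed
    have inj: "inj_on (P h) X"
    proof (rule inj_onI)
      fix x y assume xy: "x \<in> X" "y \<in> X" "P h x = P h y"
      have "P (inv h) (P h u) = u" if "u \<in> X" for u
        using PP[OF H_closed(2)[OF h] h, of u] h H_carrier chi_one I_outside[of u] that XI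
        by (auto simp: P_def fscale_def right_translation_def fun_eq_iff subset_iff)
      thus "x = y" using xy by metis
    qed
    have "P h ` X = X" using sub inj fin by (simp add: endo_inj_surj)
    hence "(\<Sum>u\<in>X. u) = (\<Sum>u\<in>X. P h u)"
      using sum.reindex[OF inj, of "\<lambda>u. u"] by simp
    also have "\<dots> = fscale (inverse (\<chi> h)) (\<rho> h (\<Sum>u\<in>X. u))"
      unfolding P_def fun_space.scale_sum_right[symmetric] right_translation_sum ..
    finally have "fscale (\<chi> h) (\<Sum>u\<in>X. u) = \<rho> h (\<Sum>u\<in>X. u)"
      using chi_nonzero[OF h] by (simp add: fscale_def fun_eq_iff)
    thus "\<rho> h v = fscale (\<chi> h) v"
      unfolding v_def right_translation_linear by (metis fun_space.scale_left_commute)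
  qed
  moreover have "v \<in> W" unfolding v_def using sumW by (rule subrepD(7)[OF W])
  moreover have "intertwiner G \<rho> W (\<lambda>u. u)" by (simp add: intertwiner_def)
  ultimately show ?thesis using that[of v] avg subrepD(1)[OF W] by blast
qed

text \<open>A translation moves a point where \<open>f\<close> is nonzero to the identity, and
  averaging keeps the value there.\<close>

lemma type_vector_exists:
  assumes W: "subrep G \<rho> I W" and "W \<noteq> {0}"
  obtains v where "v \<in> W" "of_type \<rho> H \<chi> v" "v \<one> \<noteq> 0"
proof -
  obtain f where f: "f \<in> W" "f \<noteq> 0" using assms subrepD(4)[OF W] by blast
  then obtain k where k: "f k \<noteq> 0" by (auto simp: fun_eq_iff)
  hence kc: "k \<in> carrier G" using I_outside[OF subrepD(1)[OF W f(1)]] by blast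
  have "\<rho> k f \<in> W" "\<rho> k f \<one> \<noteq> 0" using subrepD(3)[OF W kc f(1)] k kc by (auto simp: right_translation_def)
  thus ?thesis using average[OF W] that by metis
qed

end

section \<open>Splitting by an operator with two eigenvalues\<close>

lemma intertwiner_inv_into:
  assumes W: "subrep G \<rho> V W" and T: "intertwiner G \<rho> W T" and inj: "inj_on T W"
  shows "intertwiner G \<rho> (T ` W) (inv_into W T)"
proof -
  have [simp]: "inv_into W T (T w) = w" if "w \<in> W" for w
    using inj that by (rule inv_into_f_f)
  have "inv_into W T (T u + T w) = u + w" if "u \<in> W" "w \<in> W" for u w
    using that subrepD(5)[OF W] intertwinerD(1)[OF T] by (metis inv_into_f_f[OF inj])
  moreover have "inv_into W T (fscale c (T w)) = fscale c w" if "w \<in> W" for c w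
    using that subrepD(7)[OF W] intertwinerD(2)[OF T] by (metis inv_into_f_f[OF inj])
  moreover have "inv_into W T (\<rho> g (T w)) = \<rho> g w" if "g \<in> carrier G" "w \<in> W" for g w
    using that subrepD(3)[OF W] intertwinerD(3)[OF T] by (metis inv_into_f_f[OF inj])
  ultimately show ?thesis by (simp add: intertwiner_def)
qed

lemma irreducible_repD:
  "irreducible_rep G \<rho> W \<Longrightarrow> subrep G \<rho> W U \<Longrightarrow> U \<noteq> {0} \<Longrightarrow> U = W"
  unfolding irreducible_rep_def by blast

lemma right_translation_diff:
  "right_translation G g (u - v) = right_translation G g u - right_translation G g v"
  by (auto simp: right_translation_def fun_eq_iff)

text \<open>Common frame for level one (\<open>V\<close> all of I(1), \<open>B\<close> the standard
  intertwining operator, \<open>d\<close> the function \<open>\<delta>\<close>) and level n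
  (\<open>V\<close> the complement \<open>J\<close>, \<open>B\<close> the Legendre convolution,
  \<open>d\<close> the projection of \<open>\<delta>\<close>). That \<open>B d\<close> vanishes at
  the identity ensures that \<open>B d - m d\<close> does not; \<open>eigen_type_zero\<close>
  encodes multiplicity one.\<close>

locale split_rep = induced_rep +
  fixes V :: "('a \<Rightarrow> complex) set" and B :: "('a \<Rightarrow> complex) \<Rightarrow> 'a \<Rightarrow> complex"
    and l m :: complex and d :: "'a \<Rightarrow> complex"
  assumes V: "subrep G \<rho> I V"
    and B: "intertwiner G \<rho> V B"
    and B_closed: "\<And>f. f \<in> V \<Longrightarrow> B f \<in> V"
    and B_quadratic: "\<And>f. f \<in> V \<Longrightarrow> B (B f) = fscale (l + m) (B f) - fscale (l * m) f"
    and l_neq_m: "l \<noteq> m" and l_nonzero: "l \<noteq> 0" and m_nonzero: "m \<noteq> 0"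
    and d_V: "d \<in> V" and of_type_d: "of_type \<rho> H \<chi> d" and d_one: "d \<one> \<noteq> 0"
    and B_d_one: "B d \<one> = 0"
    and d_generates: "\<And>U. subrep G \<rho> V U \<Longrightarrow> d \<in> U \<Longrightarrow> U = V"
    and eigen_type_zero: "\<And>f \<nu>. f \<in> V \<Longrightarrow> of_type \<rho> H \<chi> f \<Longrightarrow> \<nu> = l \<or> \<nu> = m \<Longrightarrow>
      B f = fscale \<nu> f \<Longrightarrow> f \<one> = 0 \<Longrightarrow> f = 0"
begin

definition E :: "complex \<Rightarrow> ('a \<Rightarrow> complex) set" where "E \<nu> = {f \<in> V. B f = fscale \<nu> f}"

text \<open>Since (B - l)(B - m) = 0 on \<open>V\<close>, the image of \<open>P m\<close> lies in
  \<open>E l\<close>, not in \<open>E m\<close>; divided by \<open>l - m\<close> it is the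
  projection onto \<open>E l\<close>.\<close>

definition P :: "complex \<Rightarrow> ('a \<Rightarrow> complex) \<Rightarrow> 'a \<Rightarrow> complex" where "P \<nu> f = B f - fscale \<nu> f"

text \<open>The hypotheses are symmetric in the two eigenvalues, so facts are proved for
  \<open>E l\<close> and transferred to \<open>E m\<close>.\<close>

lemma split_rep_swap: "split_rep G H \<chi> R V B m l d"
proof (intro split_rep.intro split_rep_axioms.intro)
  show "induced_rep G H \<chi> R" by unfold_locales
  show "B (B f) = fscale (m + l) (B f) - fscale (m * l) f" if "f \<in> V" for f
    using B_quadratic[OF that] by (simp only: add.commute mult.commute)
  show "f = 0" if "f \<in> V" "of_type \<rho> H \<chi> f" "\<nu> = m \<or> \<nu> = l" "B f = fscale \<nu> f" "f \<one> = 0" for f \<nu>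
    using that(3) by (intro eigen_type_zero[OF that(1,2) _ that(4,5)]) blast
qed (fact V B B_closed l_neq_m[symmetric] l_nonzero m_nonzero d_V of_type_d d_one B_d_one d_generates)+

lemma P_intertwiner: "intertwiner G \<rho> V (P \<nu>)"
  unfolding intertwiner_def
proof (intro conjI ballI allI)
  fix u v g c assume "u \<in> V" "v \<in> V"
  show "P \<nu> (u + v) = P \<nu> u + P \<nu> v"
    unfolding P_def intertwinerD(1)[OF B \<open>u \<in> V\<close> \<open>v \<in> V\<close>] by (simp add: fun_space.scale_right_distrib)
next
  fix v c assume "v \<in> V"
  show "P \<nu> (fscale c v) = fscale c (P \<nu> v)"
    unfolding P_def intertwinerD(2)[OF B \<open>v \<in> V\<close>]
    by (simp only: fun_space.scale_right_diff_distrib fun_space.scale_left_commute)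
next
  fix v g assume "v \<in> V" "g \<in> carrier G"
  thus "P \<nu> (\<rho> g v) = \<rho> g (P \<nu> v)"
    unfolding P_def by (simp only: intertwinerD(3)[OF B] right_translation_linear right_translation_diff)
qed

lemma \<rho>_zero: "\<rho> g 0 = 0"
  by (rule right_translation_linear)

lemma E_subrep: "subrep G \<rho> V (E \<nu>)"
  using subrep_kernel[OF V P_intertwiner \<rho>_zero, of \<nu>] by (simp add: P_def E_def)

lemma E_subrep_I: "subrep G \<rho> I (E \<nu>)"
  using V E_subrep by (rule subrep_trans)

lemma P_E: "f \<in> V \<Longrightarrow> P m f \<in> E l"
proof -
  assume f: "f \<in> V"
  have "B (P m f) = B (B f) - fscale m (B f)"
    unfolding P_def using f B_closed subrepD(7)[OF V]
    by (simp add: intertwiner_diff[OF V B] intertwinerD(2)[OF B])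
  also have "\<dots> = fscale l (P m f)"
    using f by (simp add: B_quadratic P_def fscale_def fun_eq_iff algebra_simps)
  finally show ?thesis
    using f B_closed subrepD(6,7)[OF V] by (simp add: E_def P_def)
qed

lemma P_on_E: "f \<in> E l \<Longrightarrow> P m f = fscale (l - m) f"
  by (simp add: E_def P_def fun_eq_iff fscale_def algebra_simps)

text \<open>Pulling \<open>U\<close> back along \<open>P m\<close> gives a subrepresentation of
  \<open>V\<close> that contains \<open>d\<close>, hence all of \<open>V\<close>. On
  \<open>E l\<close> the operator \<open>P m\<close> is the nonzero scalar \<open>l - m\<close>, so
  \<open>U\<close> contains \<open>E l\<close>.\<close>

lemma E_generated:
  assumes U: "subrep G \<rho> (E l) U" and "P m d \<in> U"
  shows "U = E l"
proof -
  have "subrep G \<rho> V {f \<in> V. P m f \<in> U}"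
  proof -
    have "fun_space.subspace {f \<in> V. P m f \<in> U}"
      using subrepD[OF V] subrepD[OF U] intertwinerD[OF P_intertwiner]
        intertwiner_zero[OF V P_intertwiner]
      by (auto simp: fun_space.subspace_def)
    thus ?thesis
      using subrepD(3)[OF V] subrepD(3)[OF U] intertwinerD(3)[OF P_intertwiner]
      by (auto simp: subrep_def)
  qed
  hence *: "{f \<in> V. P m f \<in> U} = V" using d_generates d_V assms by blast
  have "f \<in> U" if f: "f \<in> E l" for f
  proof -
    have "P m f \<in> U" using * f subrepD(1)[OF E_subrep] by blast
    hence "fscale (inverse (l - m)) (fscale (l - m) f) \<in> U"
      unfolding P_on_E[OF f] by (rule subrepD(7)[OF U])
    moreover have "fscale (inverse (l - m)) (fscale (l - m) f) = f"
      using l_neq_m by (simp add: fscale_def flip: mult.assoc)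
    ultimately show ?thesis by simp
  qed
  thus ?thesis by (intro equalityI subsetI) (simp_all add: subrepD(1)[OF U])
qed

lemma P_d_one: "P m d \<one> \<noteq> 0"
  using B_d_one d_one m_nonzero by (simp add: P_def fscale_def)

lemma of_type_P_d: "of_type \<rho> H \<chi> (P m d)"
  unfolding of_type_def
proof
  fix h assume h: "h \<in> H"
  have "\<rho> h (P m d) = P m (\<rho> h d)"
    using intertwinerD(3)[OF P_intertwiner] H_carrier[OF h] d_V by simp
  also have "\<dots> = fscale (\<chi> h) (P m d)"
    using of_type_d h d_V by (simp add: of_type_def intertwinerD(2)[OF P_intertwiner])
  finally show "\<rho> h (P m d) = fscale (\<chi> h) (P m d)" .
qed

text \<open>Subtracting the multiple that matches at the identity leaves a vector of the same type
  that vanishes there, and \<open>eigen_type_zero\<close> kills it.\<close>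

lemma E_type_unique:
  assumes v: "v \<in> E l" and t: "of_type \<rho> H \<chi> v"
  shows "v = fscale (v \<one> / P m d \<one>) (P m d)"
proof -
  let ?w = "v - fscale (v \<one> / P m d \<one>) (P m d)"
  have wE: "?w \<in> E l" using v P_E[OF d_V] subrepD(6,7)[OF E_subrep] by blast
  have "of_type \<rho> H \<chi> ?w"
    using t of_type_P_d by (simp add: of_type_def right_translation_diff right_translation_linear
        fun_space.scale_right_diff_distrib fun_space.scale_left_commute)
  moreover have "?w \<one> = 0" using P_d_one by (simp add: fscale_def)
  ultimately have "?w = 0" using wE eigen_type_zero[of ?w l] by (auto simp: E_def)
  thus ?thesis by simp
qed

lemma P_d_in_subrep:
  assumes U: "subrep G \<rho> (E l) U" and "U \<noteq> {0}"
  shows "P m d \<in> U"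
proof -
  obtain v where v: "v \<in> U" "of_type \<rho> H \<chi> v" "v \<one> \<noteq> 0"
    using type_vector_exists[OF subrep_trans[OF E_subrep_I U]] assms(2) by blast
  have "v = fscale (v \<one> / P m d \<one>) (P m d)" using v subrepD(1)[OF U] E_type_unique by blast
  hence "P m d = fscale (P m d \<one> / v \<one>) v"
    using v(3) P_d_one by (simp add: fscale_def fun_eq_iff field_simps)
  thus ?thesis using v(1) subrepD(7)[OF U] by metis
qed

lemma P_d_nonzero: "P m d \<noteq> 0"
  using P_d_one by auto

lemma E_irreducible: "irreducible_rep G \<rho> (E l)"
proof -
  have "E l \<noteq> {0}" using P_E[OF d_V] P_d_nonzero by auto
  moreover have "subrep G \<rho> (E l) (E l)" using E_subrep by (auto simp: subrep_def)
  ultimately show ?thesis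
    using E_generated P_d_in_subrep by (auto simp: irreducible_rep_def)
qed

text \<open>Averaging \<open>f\<close> preserves the values of \<open>f\<close> and of
  \<open>T f\<close> at the identity and produces a multiple of \<open>P m d\<close>. Hence these
  two values have a ratio independent of \<open>f\<close>, and translation by \<open>k\<close>
  carries the proportionality to every point.\<close>

lemma E_intertwiner_scalar:
  assumes T: "intertwiner G \<rho> (E l) T" and TI: "T ` E l \<subseteq> I"
  obtains c where "\<And>f. f \<in> E l \<Longrightarrow> T f = fscale c f"
proof -
  define c where "c = T (P m d) \<one> / P m d \<one>"
  have one: "T f \<one> = c * f \<one>" if f: "f \<in> E l" for f
  proof -
    obtain v where v: "v \<in> E l" "of_type \<rho> H \<chi> v" "v \<one> = f \<one>" "T v \<one> = T f \<one>"
      using average[OF E_subrep_I f] T TI by metis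
    have "T v = fscale (v \<one> / P m d \<one>) (T (P m d))"
      using E_type_unique[OF v(1,2)] intertwinerD(2)[OF T P_E[OF d_V]] by metis
    hence "T v \<one> = v \<one> / P m d \<one> * T (P m d) \<one>" by (simp add: fscale_def)
    thus ?thesis using v(3,4) by (simp add: c_def)
  qed
  have "T f = fscale c f" if f: "f \<in> E l" for f
  proof
    fix k show "T f k = fscale c f k"
    proof (cases "k \<in> carrier G")
      case True
      have "T (\<rho> k f) \<one> = c * \<rho> k f \<one>"
        by (rule one[OF subrepD(3)[OF E_subrep True f]])
      hence "\<rho> k (T f) \<one> = c * \<rho> k f \<one>" using intertwinerD(3)[OF T True f] by simp
      thus ?thesis using True by (simp add: right_translation_def fscale_def)
    next
      case False
      have "f \<in> I" by (rule subrepD(1)[OF E_subrep_I f])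
      moreover have "T f \<in> I" using TI f by (rule subsetD[OF _ imageI])
      ultimately show ?thesis using False by (simp add: I_outside fscale_def)
    qed
  qed
  thus ?thesis by (rule that)
qed

lemma E_disjoint: "E l \<inter> E m = {0}"
proof -
  have "f = 0" if "f \<in> E l" "f \<in> E m" for f
  proof -
    have "fscale l f = fscale m f" using that by (simp add: E_def)
    thus ?thesis using l_neq_m by (simp add: fscale_def fun_eq_iff)
  qed
  thus ?thesis using subrepD(4)[OF E_subrep] by blast
qed

text \<open>An isomorphism would be a scalar, so its image would lie in \<open>E l\<close>, which
  meets \<open>E m\<close> only in 0.\<close>

lemma E_not_iso: "\<not> rep_iso G \<rho> (E l) (E m)"
proof
  assume "rep_iso G \<rho> (E l) (E m)"
  then obtain T where T: "bij_betw T (E l) (E m)" "intertwiner G \<rho> (E l) T"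
    by (auto simp: rep_iso_iff)
  have im: "T ` E l = E m" using T(1) by (simp add: bij_betw_def)
  have "T ` E l \<subseteq> I" unfolding im using subrepD(1)[OF E_subrep_I] by blast
  then obtain c where c: "\<And>f. f \<in> E l \<Longrightarrow> T f = fscale c f"
    using E_intertwiner_scalar[OF T(2)] by blast
  have e: "P m d \<in> E l" using P_E[OF d_V] .
  have "T (P m d) \<in> E l" using c[OF e] subrepD(7)[OF E_subrep e] by simp
  moreover have "T (P m d) \<in> E m" using im e by blast
  ultimately have "T (P m d) \<in> E l \<inter> E m" by simp
  hence "T (P m d) = T 0" unfolding E_disjoint using intertwiner_zero[OF E_subrep T(2)] by simp
  hence "P m d = 0"
    using T(1) e subrepD(4)[OF E_subrep] by (auto simp: bij_betw_def dest: inj_onD)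
  thus False using P_d_nonzero by simp
qed

lemma E_irreducible_swap: "irreducible_rep G \<rho> (E m)"
  using split_rep.E_irreducible[OF split_rep_swap] .

text \<open>If \<open>P m\<close> vanishes on \<open>W\<close>, then \<open>W\<close> lies in
  \<open>E m\<close>. Otherwise it is injective with image all of \<open>E l\<close>; its inverse is
  an intertwiner from \<open>E l\<close> into \<open>I\<close>, hence a scalar, and so
  \<open>W\<close> itself lies in \<open>E l\<close>.\<close>

lemma irreducible_subrep_cases:
  assumes W: "subrep G \<rho> V W" and irr: "irreducible_rep G \<rho> W"
  shows "W = E l \<or> W = E m"
proof -
  have P: "intertwiner G \<rho> W (P m)"
    using intertwiner_subset[OF P_intertwiner] W by (simp add: subrep_def)
  have W0: "W \<noteq> {0}" using irr by (simp add: irreducible_rep_def)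
  consider "\<forall>w\<in>W. P m w = 0" | "inj_on (P m) W" using schur_injective[OF irr P \<rho>_zero] by blast
  thus ?thesis
  proof cases
    case 1
    hence "W \<subseteq> E m" using subrepD(1)[OF W] by (auto simp: P_def E_def)
    hence "subrep G \<rho> (E m) W" using subrep_weaken[OF W] by blast
    hence "W = E m" using E_irreducible_swap W0 by (intro irreducible_repD)
    thus ?thesis ..
  next
    case 2
    have sub: "P m ` W \<subseteq> E l" by (intro image_subsetI P_E subrepD(1)[OF W])
    have "P m ` W \<noteq> {0}"
    proof
      assume *: "P m ` W = {0}"
      obtain w where w: "w \<in> W" "w \<noteq> 0" using W0 subrepD(4)[OF W] by blast
      have "P m w = P m 0"
        using imageI[OF w(1), of "P m"] imageI[OF subrepD(4)[OF W], of "P m"] unfolding * by simp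
      thus False using 2 w subrepD(4)[OF W] by (auto dest: inj_onD)
    qed
    hence im: "P m ` W = E l"
      using subrep_weaken[OF subrep_image[OF W P] sub] E_irreducible by (intro irreducible_repD)
    let ?T = "inv_into W (P m)"
    have T: "intertwiner G \<rho> (E l) ?T" using intertwiner_inv_into[OF W P 2] im by simp
    have TW: "?T ` E l = W" using inv_into_image_cancel[OF 2 subset_refl] im by simp
    hence "?T ` E l \<subseteq> I" using subrep_trans[OF V W] by (simp add: subrep_def)
    then obtain c where c: "\<And>f. f \<in> E l \<Longrightarrow> ?T f = fscale c f"
      using E_intertwiner_scalar[OF T] by blast
    have "W \<subseteq> E l"
    proof
      fix w assume "w \<in> W"
      then obtain f where "f \<in> E l" "w = ?T f" using TW by blast
      thus "w \<in> E l" using c subrepD(7)[OF E_subrep] by simp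
    qed
    hence "subrep G \<rho> (E l) W" using subrep_weaken[OF W] by blast
    hence "W = E l" using E_irreducible W0 by (intro irreducible_repD)
    thus ?thesis ..
  qed
qed

lemma constituents_V: "constituents G \<rho> V = {E l, E m}"
proof (intro equalityI subsetI)
  fix W assume "W \<in> constituents G \<rho> V"
  thus "W \<in> {E l, E m}" using irreducible_subrep_cases by (simp add: constituents_def)
next
  fix W assume "W \<in> {E l, E m}"
  thus "W \<in> constituents G \<rho> V"
    using E_irreducible E_irreducible_swap E_subrep by (auto simp: constituents_def)
qed

lemma dim_V: "fun_space.dim V = fun_space.dim (E l) + fun_space.dim (E m)"
proof -
  have VE: "V = {x + y |x y. x \<in> E l \<and> y \<in> E m}"
  proof (intro equalityI subsetI)
    fix f assume f: "f \<in> V"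
    \<comment> \<open>The decomposition comes from \<open>P m f - P l f = (l - m) f\<close>.\<close>
    let ?x = "fscale (inverse (l - m)) (P m f)" and ?y = "fscale (inverse (m - l)) (P l f)"
    have "?x \<in> E l" by (rule subrepD(7)[OF E_subrep P_E[OF f]])
    moreover have "?y \<in> E m"
      by (rule subrepD(7)[OF E_subrep split_rep.P_E[OF split_rep_swap f]])
    moreover have "f = ?x + ?y"
    proof -
      have "inverse (m - l) = - inverse (l - m)" by (simp flip: inverse_minus_eq)
      hence "?x + ?y = fscale (inverse (l - m)) (fscale (l - m) f)"
        by (simp add: P_def fscale_def fun_eq_iff algebra_simps)
      moreover have "\<dots> = f" using l_neq_m by (simp add: fscale_def flip: mult.assoc)
      ultimately show ?thesis by simp
    qed
    ultimately show "f \<in> {x + y |x y. x \<in> E l \<and> y \<in> E m}" by blast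
  next
    fix f assume "f \<in> {x + y |x y. x \<in> E l \<and> y \<in> E m}"
    thus "f \<in> V" by (auto intro: subrepD(5)[OF V] subrepD(1)[OF E_subrep])
  qed
  have "V \<subseteq> fun_space.span ((\<lambda>r. \<rho> (inv r) \<delta>) ` R)"
    using I_finite_span V by (auto simp: subrep_def)
  hence "fun_space.dim {x + y |x y. x \<in> E l \<and> y \<in> E m} = fun_space.dim (E l) + fun_space.dim (E m)"
    using finite_R by (intro dim_direct_sum[OF subrepD(2)[OF E_subrep] subrepD(2)[OF E_subrep] E_disjoint,
      where F = "(\<lambda>r. \<rho> (inv r) \<delta>) ` R"]) (simp_all flip: VE)
  thus ?thesis using VE by simp
qed

end

section \<open>The p-adic integers and the group\<close>

locale odd_prime =
  fixes p :: nat
  assumes p_prime: "prime p" and p_odd: "odd p"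
begin

abbreviation q :: int where "q \<equiv> int p"

lemma q_prime: "prime q"
  using p_prime by simp

lemma q_gt_2: "q > 2"
  using prime_ge_2_nat[OF p_prime] p_odd by (cases "p = 2") auto

lemma q_pow_pos: "q ^ n > 0"
  using q_gt_2 by simp

section \<open>Arithmetic of p-adic integers through their residues\<close>

lemma Zp_iff:
  "x \<in> carrier (Zp p) \<longleftrightarrow> (\<forall>n. 0 \<le> x n \<and> x n < q ^ n \<and> x (Suc n) mod q ^ n = x n)"
  by (auto simp: Zp_def)

lemma Zp_simps:
  "x \<otimes>\<^bsub>Zp p\<^esub> y = (\<lambda>n. (x n * y n) mod q ^ n)" "x \<oplus>\<^bsub>Zp p\<^esub> y = (\<lambda>n. (x n + y n) mod q ^ n)"
  "\<one>\<^bsub>Zp p\<^esub> = (\<lambda>n. 1 mod q ^ n)" "\<zero>\<^bsub>Zp p\<^esub> = (\<lambda>n. 0)"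
  by (simp_all add: Zp_def)

lemma Zp_mod_self: "x \<in> carrier (Zp p) \<Longrightarrow> x n mod q ^ n = x n"
  by (simp add: Zp_iff)

lemma Zp_mod:
  assumes "x \<in> carrier (Zp p)" "m \<le> n"
  shows "x n mod q ^ m = x m"
  using assms(2)
proof (induction n rule: dec_induct)
  case base show ?case using assms by (simp add: Zp_iff)
next
  case (step n)
  have "x (Suc n) mod q ^ m = x (Suc n) mod q ^ n mod q ^ m"
    using step.hyps by (simp add: mod_mod_cancel le_imp_power_dvd)
  also have "\<dots> = x m" using assms(1) step.IH by (simp add: Zp_iff)
  finally show ?case .
qed

lemma Zp_cong: "x \<in> carrier (Zp p) \<Longrightarrow> [x (Suc n) = x n] (mod q ^ n)"
  by (metis Zp_mod Zp_mod_self cong_def le_SucI order_refl)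

lemma Zp_memI:
  assumes "\<And>n. [F (Suc n) = F n] (mod q ^ n)"
  shows "(\<lambda>n. F n mod q ^ n) \<in> carrier (Zp p)"
proof -
  have "F (Suc n) mod (q * q ^ n) mod q ^ n = F n mod q ^ n" for n
    using assms[of n] by (simp add: mod_mod_cancel cong_def)
  thus ?thesis using q_pow_pos by (auto simp: Zp_iff)
qed

lemma Zp_uminus_mem: "x \<in> carrier (Zp p) \<Longrightarrow> (\<lambda>n. (- x n) mod q ^ n) \<in> carrier (Zp p)"
  using Zp_cong by (intro Zp_memI) (simp add: cong_minus_minus_iff)

lemma Zp_cring: "cring (Zp p)"
proof (intro cringI abelian_groupI comm_monoidI)
  fix x y assume xy: "x \<in> carrier (Zp p)" "y \<in> carrier (Zp p)"
  show "x \<oplus>\<^bsub>Zp p\<^esub> y \<in> carrier (Zp p)" "x \<otimes>\<^bsub>Zp p\<^esub> y \<in> carrier (Zp p)"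
    unfolding Zp_simps using xy Zp_cong by (auto intro!: Zp_memI cong_add cong_mult)
  show "x \<oplus>\<^bsub>Zp p\<^esub> y = y \<oplus>\<^bsub>Zp p\<^esub> x" "x \<otimes>\<^bsub>Zp p\<^esub> y = y \<otimes>\<^bsub>Zp p\<^esub> x"
    by (simp_all add: Zp_simps add.commute mult.commute)
next
  show "\<zero>\<^bsub>Zp p\<^esub> \<in> carrier (Zp p)" "\<one>\<^bsub>Zp p\<^esub> \<in> carrier (Zp p)"
    using Zp_memI[of "\<lambda>_. 0"] Zp_memI[of "\<lambda>_. 1"] by (simp_all add: Zp_simps)
next
  fix x assume x: "x \<in> carrier (Zp p)"
  show "\<zero>\<^bsub>Zp p\<^esub> \<oplus>\<^bsub>Zp p\<^esub> x = x" "\<one>\<^bsub>Zp p\<^esub> \<otimes>\<^bsub>Zp p\<^esub> x = x"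
    using Zp_mod_self[OF x] by (simp_all add: Zp_simps mod_mult_left_eq)
  have "(\<lambda>n. (- x n) mod q ^ n) \<oplus>\<^bsub>Zp p\<^esub> x = \<zero>\<^bsub>Zp p\<^esub>"
    by (simp add: Zp_simps mod_add_left_eq)
  thus "\<exists>y\<in>carrier (Zp p). y \<oplus>\<^bsub>Zp p\<^esub> x = \<zero>\<^bsub>Zp p\<^esub>" using Zp_uminus_mem[OF x] by blast
next
  fix x y z assume "x \<in> carrier (Zp p)" "y \<in> carrier (Zp p)" "z \<in> carrier (Zp p)"
  show "x \<oplus>\<^bsub>Zp p\<^esub> y \<oplus>\<^bsub>Zp p\<^esub> z = x \<oplus>\<^bsub>Zp p\<^esub> (y \<oplus>\<^bsub>Zp p\<^esub> z)"
    "x \<otimes>\<^bsub>Zp p\<^esub> y \<otimes>\<^bsub>Zp p\<^esub> z = x \<otimes>\<^bsub>Zp p\<^esub> (y \<otimes>\<^bsub>Zp p\<^esub> z)"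
    "(x \<oplus>\<^bsub>Zp p\<^esub> y) \<otimes>\<^bsub>Zp p\<^esub> z = x \<otimes>\<^bsub>Zp p\<^esub> z \<oplus>\<^bsub>Zp p\<^esub> y \<otimes>\<^bsub>Zp p\<^esub> z"
    by (simp_all add: Zp_simps mod_simps algebra_simps)
qed

sublocale Zp: cring "Zp p" by (rule Zp_cring)

lemma Zp_uminus: "x \<in> carrier (Zp p) \<Longrightarrow> \<ominus>\<^bsub>Zp p\<^esub> x = (\<lambda>n. (- x n) mod q ^ n)"
  by (rule Zp.minus_equality[OF _ _ Zp_uminus_mem]) (simp_all add: Zp_simps mod_add_left_eq)

lemma Zp_minus:
  "x \<in> carrier (Zp p) \<Longrightarrow> y \<in> carrier (Zp p) \<Longrightarrow> x \<ominus>\<^bsub>Zp p\<^esub> y = (\<lambda>n. (x n - y n) mod q ^ n)"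
  by (simp add: a_minus_def Zp_uminus Zp_simps mod_add_right_eq)

lemma Zp_nat: "[(k::nat)] \<cdot>\<^bsub>Zp p\<^esub> \<one>\<^bsub>Zp p\<^esub> = (\<lambda>n. int k mod q ^ n)"
proof (induction k)
  case 0 show ?case by (simp add: Zp_simps)
next
  case (Suc k)
  have "[Suc k] \<cdot>\<^bsub>Zp p\<^esub> \<one>\<^bsub>Zp p\<^esub> = [k] \<cdot>\<^bsub>Zp p\<^esub> \<one>\<^bsub>Zp p\<^esub> \<oplus>\<^bsub>Zp p\<^esub> \<one>\<^bsub>Zp p\<^esub>"
    by (rule Zp.add.nat_pow_Suc)
  thus ?case unfolding Suc by (simp add: Zp_simps mod_simps add.commute)
qed

lemma pow_ideal_iff:
  assumes x: "x \<in> carrier (Zp p)"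
  shows "x \<in> pow_ideal p n \<longleftrightarrow> x n = 0"
proof
  assume "x \<in> pow_ideal p n"
  then obtain y where "x = y \<otimes>\<^bsub>Zp p\<^esub> (\<lambda>m. int (p ^ n) mod q ^ m)"
    by (auto simp: pow_ideal_def cgenideal_def Zp_nat)
  thus "x n = 0" by (simp add: Zp_simps)
next
  assume 0: "x n = 0"
  \<comment> \<open>To know the quotient by \<open>p\<^sup>n\<close> modulo
    \<open>p\<^sup>m\<close>, one has to know \<open>x\<close> modulo p^(m+n); hence the shift of
    the index.\<close>
  define y where "y m = x (m + n) div q ^ n" for m
  have yn: "x (m + n) = q ^ n * y m" for m
    using Zp_mod[OF x, of n "m + n"] 0 by (simp add: y_def mod_0_imp_dvd)
  have "y \<in> carrier (Zp p)"
    unfolding Zp_iff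
  proof (intro allI conjI)
    fix m
    have "0 \<le> x (m + n)" "x (m + n) < q ^ (m + n)" using x by (auto simp: Zp_iff)
    thus "0 \<le> y m" "y m < q ^ m" unfolding yn using q_pow_pos[of n]
      by (simp_all add: power_add zero_le_mult_iff mult.commute[of "q ^ m"])
    have "q ^ n * (y (Suc m) mod q ^ m) = x (Suc m + n) mod q ^ (m + n)"
      unfolding yn by (simp add: power_add mult.commute[of "q ^ m"])
    also have "\<dots> = q ^ n * y m" using Zp_mod[OF x, of "m + n" "Suc m + n"] yn[of m] by simp
    finally show "y (Suc m) mod q ^ m = y m" using q_gt_2 by simp
  qed
  moreover have "x = y \<otimes>\<^bsub>Zp p\<^esub> (\<lambda>m. int (p ^ n) mod q ^ m)"
  proof
    fix m
    have "x m = (q ^ n * y m) mod q ^ m" using Zp_mod[OF x, of m "m + n"] yn[of m] by simp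
    thus "x m = (y \<otimes>\<^bsub>Zp p\<^esub> (\<lambda>m. int (p ^ n) mod q ^ m)) m"
      by (simp add: Zp_simps mod_mult_right_eq mult.commute)
  qed
  ultimately show "x \<in> pow_ideal p n" by (auto simp: pow_ideal_def cgenideal_def Zp_nat)
qed

lemma SL2_carrier_iff:
  "(a, b, c, d) \<in> carrier (SL2 p) \<longleftrightarrow>
     a \<in> carrier (Zp p) \<and> b \<in> carrier (Zp p) \<and> c \<in> carrier (Zp p) \<and> d \<in> carrier (Zp p) \<and>
     (\<forall>n. [a n * d n - b n * c n = 1] (mod q ^ n))"
proof -
  have "a \<otimes>\<^bsub>Zp p\<^esub> d \<ominus>\<^bsub>Zp p\<^esub> b \<otimes>\<^bsub>Zp p\<^esub> c = (\<lambda>n. (a n * d n - b n * c n) mod q ^ n)"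
    if "a \<in> carrier (Zp p)" "b \<in> carrier (Zp p)" "c \<in> carrier (Zp p)" "d \<in> carrier (Zp p)"
    using that by (simp add: Zp_minus) (simp add: Zp_simps(1) mod_simps)
  thus ?thesis by (auto simp: SL2_def cong_def Zp_simps(3) fun_eq_iff)
qed

lemma SL2_group: "group (SL2 p)"
proof (rule groupI)
  have m: "mult (SL2 p) = mat2_mult p" by (simp add: SL2_def)
  fix x y assume "x \<in> carrier (SL2 p)" "y \<in> carrier (SL2 p)"
  moreover obtain a b c d a' b' c' d' where xy: "x = (a, b, c, d)" "y = (a', b', c', d')"
    by (metis surj_pair)
  ultimately have R: "a \<in> carrier (Zp p)" "b \<in> carrier (Zp p)" "c \<in> carrier (Zp p)"
    "d \<in> carrier (Zp p)" "a' \<in> carrier (Zp p)" "b' \<in> carrier (Zp p)" "c' \<in> carrier (Zp p)"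
    "d' \<in> carrier (Zp p)"
    and det: "\<And>n. [a n * d n - b n * c n = 1] (mod q ^ n)"
      "\<And>n. [a' n * d' n - b' n * c' n = 1] (mod q ^ n)"
    by (auto simp: SL2_carrier_iff)
  have "[(a n * a' n + b n * c' n) * (c n * b' n + d n * d' n)
      - (a n * b' n + b n * d' n) * (c n * a' n + d n * c' n) = 1] (mod q ^ n)" for n
    using cong_mult[OF det(1)[of n] det(2)[of n]] by (simp add: algebra_simps)
  moreover have "[X mod Q * (Y mod Q) - Z mod Q * (W mod Q) = X * Y - Z * W] (mod Q)"
    for X Y Z W Q :: int by (intro cong_diff cong_mult) simp_all
  ultimately have "[(a n * a' n + b n * c' n) mod q ^ n * ((c n * b' n + d n * d' n) mod q ^ n)
      - (a n * b' n + b n * d' n) mod q ^ n * ((c n * a' n + d n * c' n) mod q ^ n) = 1] (mod q ^ n)"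
    for n using cong_trans by blast
  thus "x \<otimes>\<^bsub>SL2 p\<^esub> y \<in> carrier (SL2 p)"
    unfolding m xy using R
    by (simp add: SL2_carrier_iff mat2_mult_def) (simp add: Zp_simps mod_simps)
next
  show "\<one>\<^bsub>SL2 p\<^esub> \<in> carrier (SL2 p)"
    by (simp add: SL2_def Zp_minus) (simp add: Zp_simps)
next
  fix x y z assume "x \<in> carrier (SL2 p)" "y \<in> carrier (SL2 p)" "z \<in> carrier (SL2 p)"
  thus "x \<otimes>\<^bsub>SL2 p\<^esub> y \<otimes>\<^bsub>SL2 p\<^esub> z = x \<otimes>\<^bsub>SL2 p\<^esub> (y \<otimes>\<^bsub>SL2 p\<^esub> z)"
    by (cases x, cases y, cases z)
      (auto simp: SL2_def mat2_mult_def Zp.l_distr Zp.r_distr Zp.m_assoc Zp.a_ac)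
next
  fix x assume x: "x \<in> carrier (SL2 p)"
  thus "\<one>\<^bsub>SL2 p\<^esub> \<otimes>\<^bsub>SL2 p\<^esub> x = x"
    by (cases x) (auto simp: SL2_def mat2_mult_def)
  obtain a b c d where x_eq: "x = (a, b, c, d)" by (metis surj_pair)
  hence R: "a \<in> carrier (Zp p)" "b \<in> carrier (Zp p)" "c \<in> carrier (Zp p)" "d \<in> carrier (Zp p)"
    and det: "a \<otimes>\<^bsub>Zp p\<^esub> d \<ominus>\<^bsub>Zp p\<^esub> b \<otimes>\<^bsub>Zp p\<^esub> c = \<one>\<^bsub>Zp p\<^esub>"
    using x by (auto simp: SL2_def)
  let ?y = "(d, \<ominus>\<^bsub>Zp p\<^esub> b, \<ominus>\<^bsub>Zp p\<^esub> c, a)"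
  have "?y \<in> carrier (SL2 p)"
    using R det by (simp add: SL2_def Zp.l_minus Zp.r_minus Zp.m_comm)
  moreover have "?y \<otimes>\<^bsub>SL2 p\<^esub> x = \<one>\<^bsub>SL2 p\<^esub>"
    using R det unfolding x_eq
    by (simp add: SL2_def mat2_mult_def Zp.minus_eq Zp.l_minus Zp.r_minus Zp.m_comm Zp.a_comm
        Zp.r_neg Zp.l_neg)
  ultimately show "\<exists>y\<in>carrier (SL2 p). y \<otimes>\<^bsub>SL2 p\<^esub> x = \<one>\<^bsub>SL2 p\<^esub>" by blast
qed

lemma Kbar_group: "group (Kbar p)"
proof -
  have "group sign_group"
    by (rule groupI) (auto simp: sign_group_def)
  thus ?thesis unfolding Kbar_def by (intro DirProd_group SL2_group)
qed

sublocale K: group "Kbar p" by (rule Kbar_group)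

section \<open>Residues of matrix entries and cosets of \<open>K0bar\<close>\<close>

definition entA :: "nat \<Rightarrow> cov \<Rightarrow> int" where "entA n = (\<lambda>((a, b, c, d), e). a n)"
definition entB :: "nat \<Rightarrow> cov \<Rightarrow> int" where "entB n = (\<lambda>((a, b, c, d), e). b n)"
definition entC :: "nat \<Rightarrow> cov \<Rightarrow> int" where "entC n = (\<lambda>((a, b, c, d), e). c n)"
definition entD :: "nat \<Rightarrow> cov \<Rightarrow> int" where "entD n = (\<lambda>((a, b, c, d), e). d n)"

lemmas ent_defs = entA_def entB_def entC_def entD_def

lemma ent_mult:
  "[entA n (k \<otimes>\<^bsub>Kbar p\<^esub> k') = entA n k * entA n k' + entB n k * entC n k'] (mod q ^ n)"
  "[entB n (k \<otimes>\<^bsub>Kbar p\<^esub> k') = entA n k * entB n k' + entB n k * entD n k'] (mod q ^ n)"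
  "[entC n (k \<otimes>\<^bsub>Kbar p\<^esub> k') = entC n k * entA n k' + entD n k * entC n k'] (mod q ^ n)"
  "[entD n (k \<otimes>\<^bsub>Kbar p\<^esub> k') = entC n k * entB n k' + entD n k * entD n k'] (mod q ^ n)"
  by (auto simp: ent_defs Kbar_def DirProd_def SL2_def mat2_mult_def Zp_simps cong_def mod_simps
      split: prod.splits)

lemma snd_mult: "snd (k \<otimes>\<^bsub>Kbar p\<^esub> k') = snd k * snd k'"
  by (simp add: Kbar_def DirProd_def sign_group_def split: prod.splits)

lemma snd_square: "k \<in> carrier (Kbar p) \<Longrightarrow> snd k * snd k = 1"
  by (auto simp: Kbar_def DirProd_def sign_group_def)

lemma snd_one: "snd \<one>\<^bsub>Kbar p\<^esub> = 1"
  by (simp add: Kbar_def DirProd_def sign_group_def)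

lemma ent_det:
  "k \<in> carrier (Kbar p) \<Longrightarrow> [entA n k * entD n k - entB n k * entC n k = 1] (mod q ^ n)"
  by (auto simp: Kbar_def DirProd_def SL2_carrier_iff ent_defs split: prod.splits)

lemma ent_level:
  assumes "k \<in> carrier (Kbar p)" "m \<le> n"
  shows "[entC n k = entC m k] (mod q ^ m)" "[entD n k = entD m k] (mod q ^ m)"
proof -
  obtain a b c d e where k: "k = ((a, b, c, d), e)" by (metis surj_pair)
  hence "c \<in> carrier (Zp p)" "d \<in> carrier (Zp p)"
    using assms(1) by (auto simp: Kbar_def DirProd_def SL2_carrier_iff)
  thus "[entC n k = entC m k] (mod q ^ m)" "[entD n k = entD m k] (mod q ^ m)"
    using assms(2) by (simp_all add: k ent_defs cong_def Zp_mod Zp_mod_self)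
qed

lemma K0bar_iff: "k \<in> K0bar p n \<longleftrightarrow> k \<in> carrier (Kbar p) \<and> [entC n k = 0] (mod q ^ n)"
proof -
  obtain a b c d e where k: "k = ((a, b, c, d), e)" by (metis surj_pair)
  have "c \<in> pow_ideal p n \<longleftrightarrow> [c n = 0] (mod q ^ n)" if "c \<in> carrier (Zp p)"
    using pow_ideal_iff[OF that] Zp_mod_self[OF that, of n] by (simp add: cong_def)
  thus ?thesis
    by (auto simp: k K0bar_def K0_def Kbar_def DirProd_def SL2_carrier_iff ent_defs)
qed

definition mat :: "int \<Rightarrow> int \<Rightarrow> int \<Rightarrow> int \<Rightarrow> cov" where
  "mat a b c d = ((\<lambda>n. a mod q ^ n, \<lambda>n. b mod q ^ n, \<lambda>n. c mod q ^ n, \<lambda>n. d mod q ^ n), 1)"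

lemma mat_mem:
  assumes "a * d - b * c = 1"
  shows "mat a b c d \<in> carrier (Kbar p)"
proof -
  have "[a mod q ^ n * (d mod q ^ n) - b mod q ^ n * (c mod q ^ n) = 1] (mod q ^ n)" for n
    unfolding assms[symmetric] by (intro cong_diff cong_mult) simp_all
  moreover have "(\<lambda>n. x mod q ^ n) \<in> carrier (Zp p)" for x by (rule Zp_memI) simp
  ultimately show ?thesis
    by (auto simp: mat_def Kbar_def DirProd_def SL2_carrier_iff sign_group_def)
qed

lemma mat_ent:
  "[entA n (mat a b c d) = a] (mod q ^ n)" "[entB n (mat a b c d) = b] (mod q ^ n)"
  "[entC n (mat a b c d) = c] (mod q ^ n)" "[entD n (mat a b c d) = d] (mod q ^ n)"
  by (simp_all add: mat_def ent_defs)

lemma snd_mat [simp]: "snd (mat a b c d) = 1"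
  by (simp add: mat_def)

lemma mat_one: "mat 1 0 0 1 = \<one>\<^bsub>Kbar p\<^esub>"
  by (simp add: mat_def Kbar_def DirProd_def SL2_def sign_group_def Zp_simps)

lemma cong_q: "n \<ge> 1 \<Longrightarrow> [x = y] (mod q ^ n) \<Longrightarrow> [x = y] (mod q)"
  by (rule cong_dvd_modulus[of _ _ "q ^ n"]) (simp_all add: dvd_power)

lemma q_inverse:
  assumes "\<not> q dvd u"
  obtains v where "[u * v = 1] (mod q ^ n)"
proof -
  have "coprime u (q ^ n)"
    using prime_imp_coprime[OF q_prime assms] by (simp add: coprime_commute)
  thus ?thesis using that cong_solve_coprime_int by blast
qed

text \<open>The lower left entry is divisible by \<open>p\<close>, so the determinant relation
  reduces to \<open>a d = 1\<close> modulo \<open>p\<close>. The level \<open>m\<close> at which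
  entries are read is independent of the level \<open>n\<close> of the subgroup.\<close>

lemma entD_unit:
  assumes "k \<in> K0bar p n" "n \<ge> 1" "m \<ge> 1"
  shows "\<not> q dvd entD m k" "[entA m k * entD m k = 1] (mod q)"
proof -
  have k: "k \<in> carrier (Kbar p)" and c: "[entC n k = 0] (mod q ^ n)" using assms by (auto simp: K0bar_iff)
  have "[entC m k = entC 1 k] (mod q)" using ent_level(1)[OF k, of 1 m] assms(3) by simp
  moreover have "[entC 1 k = entC n k] (mod q)" using ent_level(1)[OF k, of 1 n] assms(2) by (simp add: cong_sym)
  ultimately have "[entC m k = 0] (mod q)" using cong_q[OF assms(2) c] cong_trans by blast
  hence "[entB m k * entC m k = entB m k * 0] (mod q)" by (intro cong_mult cong_refl)
  moreover have "[entA m k * entD m k - entB m k * entC m k = 1] (mod q)"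
    using cong_q[OF assms(3) ent_det[OF k]] .
  ultimately have "[(entA m k * entD m k - entB m k * entC m k) + entB m k * entC m k = 1 + entB m k * 0] (mod q)"
    by (intro cong_add)
  thus *: "[entA m k * entD m k = 1] (mod q)" by simp
  show "\<not> q dvd entD m k"
  proof
    assume "q dvd entD m k"
    hence "q dvd entA m k * entD m k" by simp
    hence "q dvd 1" using cong_dvd_iff[OF *] by simp
    thus False using q_prime not_prime_unit by blast
  qed
qed

text \<open>For \<open>h\<close> the quotient of \<open>k\<close> by \<open>k'\<close>, the bottom
  row of \<open>h\<close> times \<open>k'\<close> is \<open>u\<close> times the bottom row of
  \<open>k'\<close>. Multiplying by the adjugate of \<open>k'\<close>, which has determinant 1,
  shows that the bottom row of \<open>h\<close> is \<open>(0, u)\<close>. Cosets are thus points of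
  the projective line over Z/p^n, and the character is read off from \<open>u\<close>.\<close>

lemma coset_of_proportional_rows:
  assumes n: "n \<ge> 1" and k: "k \<in> carrier (Kbar p)" and k': "k' \<in> carrier (Kbar p)"
    and C: "[entC n k = u * entC n k'] (mod q ^ n)" and D: "[entD n k = u * entD n k'] (mod q ^ n)"
  shows "k \<otimes>\<^bsub>Kbar p\<^esub> inv\<^bsub>Kbar p\<^esub> k' \<in> K0bar p n"
    and "[entD n (k \<otimes>\<^bsub>Kbar p\<^esub> inv\<^bsub>Kbar p\<^esub> k') = u] (mod q ^ n)"
proof -
  define h where "h = k \<otimes>\<^bsub>Kbar p\<^esub> inv\<^bsub>Kbar p\<^esub> k'"
  have h: "h \<in> carrier (Kbar p)" "k = h \<otimes>\<^bsub>Kbar p\<^esub> k'"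
    using k k' by (simp_all add: h_def K.m_assoc)
  let ?a = "entA n k'" and ?b = "entB n k'" and ?c = "entC n k'" and ?d = "entD n k'"
  let ?x = "entC n h" and ?y = "entD n h"
  have 1: "[?x * ?a + ?y * ?c = u * ?c] (mod q ^ n)"
    using ent_mult(3)[of n h k'] C unfolding h(2)[symmetric] by (metis cong_sym cong_trans)
  have 2: "[?x * ?b + ?y * ?d = u * ?d] (mod q ^ n)"
    using ent_mult(4)[of n h k'] D unfolding h(2)[symmetric] by (metis cong_sym cong_trans)
  have det: "[?a * ?d - ?b * ?c = 1] (mod q ^ n)" by (rule ent_det[OF k'])
  have "[(?x * ?a + ?y * ?c) * ?d - (?x * ?b + ?y * ?d) * ?c = (u * ?c) * ?d - (u * ?d) * ?c] (mod q ^ n)"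
    by (intro cong_diff cong_mult 1 2 cong_refl)
  hence "[?x * (?a * ?d - ?b * ?c) = 0] (mod q ^ n)" by (simp add: algebra_simps)
  moreover have "[?x * (?a * ?d - ?b * ?c) = ?x * 1] (mod q ^ n)" by (intro cong_mult det cong_refl)
  ultimately have "[?x = 0] (mod q ^ n)" by (metis cong_sym cong_trans mult.right_neutral)
  thus "k \<otimes>\<^bsub>Kbar p\<^esub> inv\<^bsub>Kbar p\<^esub> k' \<in> K0bar p n" using h unfolding h_def[symmetric] by (simp add: K0bar_iff)
  have "[(?x * ?b + ?y * ?d) * ?a - (?x * ?a + ?y * ?c) * ?b = (u * ?d) * ?a - (u * ?c) * ?b] (mod q ^ n)"
    by (intro cong_diff cong_mult 1 2 cong_refl)
  hence "[?y * (?a * ?d - ?b * ?c) = u * (?a * ?d - ?b * ?c)] (mod q ^ n)" by (simp add: algebra_simps)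
  moreover have "[?y * (?a * ?d - ?b * ?c) = ?y * 1] (mod q ^ n)"
    "[u * (?a * ?d - ?b * ?c) = u * 1] (mod q ^ n)" by (intro cong_mult det cong_refl)+
  ultimately have "[?y = u] (mod q ^ n)" by (metis cong_sym cong_trans mult.right_neutral)
  thus "[entD n (k \<otimes>\<^bsub>Kbar p\<^esub> inv\<^bsub>Kbar p\<^esub> k') = u] (mod q ^ n)" by (simp add: h_def)
qed

lemma K0bar_subgroup:
  assumes n: "n \<ge> 1"
  shows "subgroup (K0bar p n) (Kbar p)"
proof (rule K.subgroupI)
  show "K0bar p n \<subseteq> carrier (Kbar p)" by (auto simp: K0bar_iff)
  have "\<one>\<^bsub>Kbar p\<^esub> \<in> K0bar p n"
    using mat_ent(3)[of n 1 0 0 1] by (simp add: K0bar_iff mat_one)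
  thus "K0bar p n \<noteq> {}" by blast
next
  fix h assume h: "h \<in> K0bar p n"
  hence hc: "h \<in> carrier (Kbar p)" by (simp add: K0bar_iff)
  obtain u where u: "[entD n h * u = 1] (mod q ^ n)"
    using q_inverse entD_unit(1)[OF h n n] by blast
  have "[entC n (mat 1 0 0 1) = u * entC n h] (mod q ^ n)"
  proof -
    have "[u * entC n h = u * 0] (mod q ^ n)" using h by (intro cong_mult) (auto simp: K0bar_iff)
    thus ?thesis using mat_ent(3)[of n 1 0 0 1] by (simp add: cong_def)
  qed
  moreover have "[entD n (mat 1 0 0 1) = u * entD n h] (mod q ^ n)"
    using mat_ent(4)[of n 1 0 0 1] u by (simp add: cong_def mult.commute)
  ultimately show "inv\<^bsub>Kbar p\<^esub> h \<in> K0bar p n"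
    using coset_of_proportional_rows(1)[OF n K.one_closed hc, of u] hc by (simp add: mat_one)
next
  fix h h' assume h: "h \<in> K0bar p n" "h' \<in> K0bar p n"
  have "[entC n h * entA n h' + entD n h * entC n h' = 0 * entA n h' + entD n h * 0] (mod q ^ n)"
    using h by (intro cong_add cong_mult) (auto simp: K0bar_iff)
  thus "h \<otimes>\<^bsub>Kbar p\<^esub> h' \<in> K0bar p n"
    using ent_mult(3)[of n h h'] h by (auto simp: K0bar_iff cong_def)
qed

lemma K0bar_entD_mult:
  assumes "h \<in> K0bar p n" "n \<ge> 1"
  shows "[entD 1 (h \<otimes>\<^bsub>Kbar p\<^esub> h') = entD 1 h * entD 1 h'] (mod q)"
proof -
  have h: "h \<in> carrier (Kbar p)" "[entC n h = 0] (mod q ^ n)" using assms by (auto simp: K0bar_iff)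
  have "[entC 1 h = 0] (mod q)"
    using ent_level(1)[OF h(1), of 1 n] cong_q[OF _ h(2)] assms(2) by (simp add: cong_def)
  hence "[entC 1 h * entB 1 h' + entD 1 h * entD 1 h' = 0 * entB 1 h' + entD 1 h * entD 1 h'] (mod q)"
    by (intro cong_add cong_mult cong_refl)
  thus ?thesis using ent_mult(4)[of 1 h h'] by (simp add: cong_def)
qed

end

section \<open>Cosets and the induced representations\<close>

text \<open>\<open>et\<close> is \<open>eta\<close> viewed on integers modulo \<open>p\<close>.
  Multiplicativity and square 1 are demanded on units only, so that the constant 1 and the Legendre
  symbol, which differ at multiples of \<open>p\<close>, are both instances.\<close>

locale quadratic_character = odd_prime +
  fixes eta :: "padic \<Rightarrow> complex" and et :: "int \<Rightarrow> complex"
  assumes eta_eq: "\<And>d. eta d = et (d 1)"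
    and et_cong: "\<And>x y. [x = y] (mod q) \<Longrightarrow> et x = et y"
    and et_mult: "\<And>x y. \<not> q dvd x \<Longrightarrow> \<not> q dvd y \<Longrightarrow> et (x * y) = et x * et y"
    and et_square: "\<And>x. \<not> q dvd x \<Longrightarrow> et x * et x = 1"
begin

lemma q_not_dvd_1: "\<not> q dvd 1"
  using q_prime not_prime_unit by blast

lemma cong_q_dvd: "n \<ge> 1 \<Longrightarrow> [x = y] (mod q ^ n) \<Longrightarrow> q dvd x \<longleftrightarrow> q dvd y"
  using cong_q cong_dvd_iff by blast

lemma et_one: "et 1 = 1"
  using et_mult[of 1 1] et_square[of 1] q_not_dvd_1 by simp

lemma et_inverse:
  assumes "[x * y = 1] (mod q)"
  shows "et x = et y"
proof -
  have "\<not> q dvd x * y" using cong_dvd_iff[OF assms] q_not_dvd_1 by simp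
  hence xy: "\<not> q dvd x" "\<not> q dvd y" by auto
  have "et x * et y = 1" using et_cong[OF assms] et_mult[OF xy] et_one by simp
  thus ?thesis using et_square[OF xy(2)] by (metis mult.assoc mult.commute mult.left_neutral)
qed

lemma eta_bar_eq: "eta_bar eta k = of_int (snd k) * et (entD 1 k)"
  by (auto simp: eta_bar_def eta_eq ent_defs split: prod.splits)

lemma eta_bar_coset:
  assumes n: "n \<ge> 1" and k: "k \<in> carrier (Kbar p)" and k': "k' \<in> carrier (Kbar p)"
    and C: "[entC n k = u * entC n k'] (mod q ^ n)" and D: "[entD n k = u * entD n k'] (mod q ^ n)"
  shows "eta_bar eta (k \<otimes>\<^bsub>Kbar p\<^esub> inv\<^bsub>Kbar p\<^esub> k') = of_int (snd k * snd k') * et u"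
proof -
  let ?h = "k \<otimes>\<^bsub>Kbar p\<^esub> inv\<^bsub>Kbar p\<^esub> k'"
  have h: "?h \<in> carrier (Kbar p)" "k = ?h \<otimes>\<^bsub>Kbar p\<^esub> k'" using k k' by (simp_all add: K.m_assoc)
  have "snd k = snd ?h * snd k'" using snd_mult h(2) by metis
  hence s: "snd ?h = snd k * snd k'" using snd_square[OF k'] by simp
  have "[entD 1 ?h = entD n ?h] (mod q)"
    using ent_level(2)[OF h(1) n] by (simp add: cong_sym)
  also have "[entD n ?h = u] (mod q)" using cong_q[OF n coset_of_proportional_rows(2)[OF assms]] .
  finally show ?thesis by (simp add: eta_bar_eq s et_cong)
qed

text \<open>The condition defining \<open>Ind\<close> without local constancy. For n \<ge> 1 the
  latter is automatic (\<open>Ind_iff\<close>), since the value of an equivariant function depends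
  only on the bottom row modulo \<open>p\<^sup>n\<close> and on the sign.\<close>

definition equivariant :: "nat \<Rightarrow> (cov \<Rightarrow> complex) \<Rightarrow> bool" where
  "equivariant n f \<longleftrightarrow> (\<forall>k. k \<notin> carrier (Kbar p) \<longrightarrow> f k = 0) \<and>
     (\<forall>h\<in>K0bar p n. \<forall>k\<in>carrier (Kbar p). f (h \<otimes>\<^bsub>Kbar p\<^esub> k) = eta_bar eta h * f k)"

text \<open>The rule by which equivariant functions are evaluated below. The right factor
  \<open>g\<close> is carried along so that one row computation serves inside convolution
  operators.\<close>

lemma eval_proportional_rows:
  assumes f: "equivariant n f"
    and n: "n \<ge> 1" and k: "k \<in> carrier (Kbar p)" and k': "k' \<in> carrier (Kbar p)"
    and C: "[entC n k = u * entC n k'] (mod q ^ n)" and D: "[entD n k = u * entD n k'] (mod q ^ n)"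
    and g: "g \<in> carrier (Kbar p)"
  shows "f (k \<otimes>\<^bsub>Kbar p\<^esub> g) = of_int (snd k * snd k') * et u * f (k' \<otimes>\<^bsub>Kbar p\<^esub> g)"
proof -
  let ?h = "k \<otimes>\<^bsub>Kbar p\<^esub> inv\<^bsub>Kbar p\<^esub> k'"
  have "k \<otimes>\<^bsub>Kbar p\<^esub> g = ?h \<otimes>\<^bsub>Kbar p\<^esub> (k' \<otimes>\<^bsub>Kbar p\<^esub> g)"
  proof -
    have "?h \<otimes>\<^bsub>Kbar p\<^esub> (k' \<otimes>\<^bsub>Kbar p\<^esub> g) = (?h \<otimes>\<^bsub>Kbar p\<^esub> k') \<otimes>\<^bsub>Kbar p\<^esub> g"
      using k k' g by (simp only: K.m_assoc K.inv_closed K.m_closed)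
    also have "?h \<otimes>\<^bsub>Kbar p\<^esub> k' = k" using k k' by (simp add: K.m_assoc)
    finally show ?thesis by simp
  qed
  thus ?thesis using f coset_of_proportional_rows(1)[OF n k k' C D] eta_bar_coset[OF n k k' C D] k' g
    by (simp add: equivariant_def)
qed

lemma eval_proportional_rows_one:
  assumes "equivariant n f" "n \<ge> 1" "k \<in> carrier (Kbar p)" "k' \<in> carrier (Kbar p)"
    "[entC n k = u * entC n k'] (mod q ^ n)" "[entD n k = u * entD n k'] (mod q ^ n)"
  shows "f k = of_int (snd k * snd k') * et u * f k'"
  using eval_proportional_rows[OF assms, of "\<one>\<^bsub>Kbar p\<^esub>"] assms(3,4) by simp

lemma cov_cong_ent:
  assumes "k \<in> carrier (Kbar p)" "k' \<in> carrier (Kbar p)" "cov_cong p n k k'"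
  shows "entC n k' = entC n k" "entD n k' = entD n k" "snd k' = snd k"
proof -
  obtain a b c d e where k: "k = ((a, b, c, d), e)" by (metis surj_pair)
  obtain a' b' c' d' e' where k': "k' = ((a', b', c', d'), e')" by (metis surj_pair)
  have *: "x n = y n"
    if "x \<in> carrier (Zp p)" "y \<in> carrier (Zp p)" "x \<ominus>\<^bsub>Zp p\<^esub> y \<in> pow_ideal p n" for x y
  proof -
    have "(x \<ominus>\<^bsub>Zp p\<^esub> y) n = 0" using pow_ideal_iff that by simp
    hence "[x n = y n] (mod q ^ n)" using that by (simp add: Zp_minus cong_iff_dvd_diff mod_0_imp_dvd)
    thus ?thesis using that by (simp add: cong_def Zp_mod_self)
  qed
  show "entC n k' = entC n k" "entD n k' = entD n k" "snd k' = snd k"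
    using assms *[of c c'] *[of d d'] by (auto simp: k k' cov_cong_def ent_defs Kbar_def DirProd_def SL2_carrier_iff)
qed

lemma Ind_iff:
  assumes n: "n \<ge> 1"
  shows "f \<in> Ind p eta n \<longleftrightarrow> equivariant n f"
proof
  assume f: "equivariant n f"
  have "locally_constant p f"
    unfolding locally_constant_def
  proof (intro ballI exI impI)
    fix k k' assume k: "k \<in> carrier (Kbar p)" "k' \<in> carrier (Kbar p)" "cov_cong p n k k'"
    have "f k' = of_int (snd k' * snd k) * et 1 * f k"
      by (rule eval_proportional_rows_one[OF f n k(2,1)]) (simp_all add: cov_cong_ent[OF k])
    thus "f k' = f k" using snd_square[OF k(1)] by (simp add: cov_cong_ent[OF k] et_one)
  qed
  thus "f \<in> Ind p eta n" using f by (simp add: Ind_def equivariant_def)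
qed (simp add: Ind_def equivariant_def)

section \<open>Representatives: the projective line over Z/p^n\<close>

definition lo :: "int \<Rightarrow> cov" where "lo c = mat 1 0 c 1"
definition wu :: "int \<Rightarrow> cov" where "wu d = mat 0 (-1) 1 d"

text \<open>The bottom rows are \<open>(c, 1)\<close> for all \<open>c\<close>, and
  \<open>(1, d)\<close> with \<open>d\<close> divisible by \<open>p\<close>. Writing
  \<open>d = q * j\<close> modulo \<open>q ^ n\<close> leaves \<open>q ^ (n - 1)\<close> values of
  \<open>j\<close>.\<close>

definition reps :: "nat \<Rightarrow> cov set" where
  "reps n = lo ` {0..<q ^ n} \<union> (\<lambda>j. wu (q * j)) ` {0..<q ^ (n - 1)}"

lemma lo_mem [simp]: "lo c \<in> carrier (Kbar p)" and wu_mem [simp]: "wu d \<in> carrier (Kbar p)"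
  by (simp_all add: lo_def wu_def mat_mem)

lemma snd_lo [simp]: "snd (lo c) = 1" and snd_wu [simp]: "snd (wu d) = 1"
  by (simp_all add: lo_def wu_def)

lemma lo_0: "lo 0 = \<one>\<^bsub>Kbar p\<^esub>"
  by (simp add: lo_def mat_one)

lemma lo_ent: "[entA n (lo c) = 1] (mod q ^ n)" "[entB n (lo c) = 0] (mod q ^ n)"
    "[entC n (lo c) = c] (mod q ^ n)" "[entD n (lo c) = 1] (mod q ^ n)"
  and wu_ent: "[entA n (wu d) = 0] (mod q ^ n)" "[entB n (wu d) = - 1] (mod q ^ n)"
    "[entC n (wu d) = 1] (mod q ^ n)" "[entD n (wu d) = d] (mod q ^ n)"
  unfolding lo_def wu_def by (rule mat_ent)+

lemma coset_lo:
  assumes n: "n \<ge> 1" and k: "k \<in> carrier (Kbar p)" and u: "\<not> q dvd entD n k"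
  obtains c where "[entC n k = entD n k * entC n (lo c)] (mod q ^ n)"
    "[entD n k = entD n k * entD n (lo c)] (mod q ^ n)" "c \<in> {0..<q ^ n}"
proof -
  obtain v where v: "[entD n k * v = 1] (mod q ^ n)" using q_inverse[OF u] .
  define c where "c = (entC n k * v) mod q ^ n"
  have "[entC n (lo c) = entC n k * v] (mod q ^ n)"
    using lo_ent(3)[of n c] by (simp add: c_def)
  hence "[entD n k * entC n (lo c) = entD n k * (entC n k * v)] (mod q ^ n)" by (intro cong_mult cong_refl)
  also have "entD n k * (entC n k * v) = entC n k * (entD n k * v)" by simp
  also have "[\<dots> = entC n k * 1] (mod q ^ n)" by (intro cong_mult cong_refl v)
  finally have "[entC n k = entD n k * entC n (lo c)] (mod q ^ n)" by (simp add: cong_sym)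
  moreover have "[entD n k * 1 = entD n k * entD n (lo c)] (mod q ^ n)"
    using lo_ent(4) by (intro cong_mult cong_refl) (rule cong_sym)
  moreover have "c \<in> {0..<q ^ n}" using q_pow_pos[of n] by (simp add: c_def)
  ultimately show ?thesis using that by simp
qed

lemma coset_wu:
  assumes n: "n \<ge> 1" and k: "k \<in> carrier (Kbar p)" and u: "\<not> q dvd entC n k"
  obtains d where "[entC n k = entC n k * entC n (wu d)] (mod q ^ n)"
    "[entD n k = entC n k * entD n (wu d)] (mod q ^ n)" "d \<in> {0..<q ^ n}"
proof -
  obtain v where v: "[entC n k * v = 1] (mod q ^ n)" using q_inverse[OF u] .
  define d where "d = (entD n k * v) mod q ^ n"
  have "[entD n (wu d) = entD n k * v] (mod q ^ n)"
    using wu_ent(4)[of n d] by (simp add: d_def)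
  hence "[entC n k * entD n (wu d) = entC n k * (entD n k * v)] (mod q ^ n)" by (intro cong_mult cong_refl)
  also have "entC n k * (entD n k * v) = entD n k * (entC n k * v)" by simp
  also have "[\<dots> = entD n k * 1] (mod q ^ n)" by (intro cong_mult cong_refl v)
  finally have "[entD n k = entC n k * entD n (wu d)] (mod q ^ n)" by (simp add: cong_sym)
  moreover have "[entC n k * 1 = entC n k * entC n (wu d)] (mod q ^ n)"
    using wu_ent(3) by (intro cong_mult cong_refl) (rule cong_sym)
  moreover have "d \<in> {0..<q ^ n}" using q_pow_pos[of n] by (simp add: d_def)
  ultimately show ?thesis using that by simp
qed

lemma row_primitive:
  assumes "k \<in> carrier (Kbar p)" "n \<ge> 1" "q dvd entD n k"
  shows "\<not> q dvd entC n k"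
proof
  assume "q dvd entC n k"
  hence "q dvd entA n k * entD n k - entB n k * entC n k" using assms(3) by simp
  thus False using cong_dvd_iff[OF cong_q[OF assms(2) ent_det[OF assms(1)]]] q_not_dvd_1 by simp
qed

lemma reps_exist:
  assumes n: "n \<ge> 1" and k: "k \<in> carrier (Kbar p)"
  shows "\<exists>h\<in>K0bar p n. \<exists>r\<in>reps n. k = h \<otimes>\<^bsub>Kbar p\<^esub> r"
proof -
  have *: ?thesis if "r \<in> reps n" "r \<in> carrier (Kbar p)" "k \<otimes>\<^bsub>Kbar p\<^esub> inv\<^bsub>Kbar p\<^esub> r \<in> K0bar p n" for r
  proof -
    have "k = (k \<otimes>\<^bsub>Kbar p\<^esub> inv\<^bsub>Kbar p\<^esub> r) \<otimes>\<^bsub>Kbar p\<^esub> r" using that k by (simp add: K.m_assoc)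
    thus ?thesis using that by blast
  qed
  show ?thesis
  proof (cases "q dvd entD n k")
    case False
    obtain c where c: "[entC n k = entD n k * entC n (lo c)] (mod q ^ n)"
      "[entD n k = entD n k * entD n (lo c)] (mod q ^ n)" "c \<in> {0..<q ^ n}"
      using coset_lo[OF n k False] .
    show ?thesis using c(3) by (intro *[OF _ _ coset_of_proportional_rows(1)[OF n k lo_mem c(1,2)]]) (auto simp: reps_def)
  next
    case True
    have u: "\<not> q dvd entC n k" using row_primitive[OF k n True] .
    obtain d where d: "[entC n k = entC n k * entC n (wu d)] (mod q ^ n)"
      "[entD n k = entC n k * entD n (wu d)] (mod q ^ n)" "d \<in> {0..<q ^ n}"
      using coset_wu[OF n k u] .
    have "q dvd entC n k * entD n (wu d)" using True cong_dvd_iff[OF cong_q[OF n d(2)]] by simp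
    hence "q dvd entD n (wu d)" using u q_prime prime_dvd_mult_iff by blast
    hence "q dvd d" using cong_dvd_iff[OF cong_q[OF n wu_ent(4)]] by blast
    then obtain j where j: "d = q * j" by (rule dvdE)
    have "q ^ n = q * q ^ (n - 1)" using n by (cases n) auto
    hence "j \<in> {0..<q ^ (n - 1)}" using d(3) q_gt_2 by (simp add: j zero_le_mult_iff)
    thus ?thesis by (intro *[OF _ _ coset_of_proportional_rows(1)[OF n k wu_mem d(1,2)]]) (auto simp: reps_def j)
  qed
qed

lemma coset_row:
  assumes "h \<in> K0bar p n"
  shows "[entC n (h \<otimes>\<^bsub>Kbar p\<^esub> k) = entD n h * entC n k] (mod q ^ n)"
    "[entD n (h \<otimes>\<^bsub>Kbar p\<^esub> k) = entD n h * entD n k] (mod q ^ n)"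
proof -
  have "[entC n h * x + entD n h * y = 0 * x + entD n h * y] (mod q ^ n)" for x y
    using assms by (intro cong_add cong_mult cong_refl) (simp add: K0bar_iff)
  thus "[entC n (h \<otimes>\<^bsub>Kbar p\<^esub> k) = entD n h * entC n k] (mod q ^ n)"
    "[entD n (h \<otimes>\<^bsub>Kbar p\<^esub> k) = entD n h * entD n k] (mod q ^ n)"
    using ent_mult(3,4)[of n h k] by (auto simp: cong_def)
qed

lemma cong_eq_less: "[x = y] (mod N) \<Longrightarrow> x \<in> {0..<N} \<Longrightarrow> y \<in> {0..<N} \<Longrightarrow> x = (y::int)"
  by (simp add: cong_def)

text \<open>Rows of different kinds are separated by divisibility of the second entry by
  \<open>p\<close>. For rows of the same kind, the entry that equals 1 in both forces the scaling
  unit to be 1.\<close>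

lemma reps_unique:
  assumes n: "n \<ge> 1" and h: "h \<in> K0bar p n" and r: "r \<in> reps n" "r' \<in> reps n"
    and eq: "r = h \<otimes>\<^bsub>Kbar p\<^esub> r'"
  shows "r = r'"
proof -
  let ?u = "entD n h"
  have C: "[entC n r = ?u * entC n r'] (mod q ^ n)" and D: "[entD n r = ?u * entD n r'] (mod q ^ n)"
    using coset_row[OF h, of r'] eq by auto
  have u: "\<not> q dvd ?u" using entD_unit(1)[OF h n n] .
  have Clo: "[?u * entC n (lo c) = ?u * c] (mod q ^ n)" and Dlo: "[?u * entD n (lo c) = ?u * 1] (mod q ^ n)"
    and Cwu: "[?u * entC n (wu c) = ?u * 1] (mod q ^ n)" and Dwu: "[?u * entD n (wu c) = ?u * c] (mod q ^ n)" for c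
    using lo_ent wu_ent by (intro cong_mult cong_refl; blast)+
  consider c c' where "r = lo c" "r' = lo c'" "c \<in> {0..<q ^ n}" "c' \<in> {0..<q ^ n}"
    | c j where "r = lo c" "r' = wu (q * j)" | c j where "r = wu (q * j)" "r' = lo c"
    | j j' where "r = wu (q * j)" "r' = wu (q * j')" "j \<in> {0..<q ^ (n - 1)}" "j' \<in> {0..<q ^ (n - 1)}"
    using r unfolding reps_def by blast
  thus ?thesis
  proof cases
    case (1 c c')
    have "[1 = ?u] (mod q ^ n)" using D Dlo[of c'] lo_ent(4)[of n c] by (simp add: 1 cong_def)
    hence "[1 * c' = ?u * c'] (mod q ^ n)" by (intro cong_mult cong_refl)
    hence "[c = c'] (mod q ^ n)" using C Clo[of c'] lo_ent(3)[of n c] by (simp add: 1 cong_def)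
    thus ?thesis using 1 cong_eq_less by blast
  next
    case (2 c j)
    have "[1 = ?u * (q * j)] (mod q ^ n)" using D Dwu[of "q * j"] lo_ent(4)[of n c] by (simp add: 2 cong_def)
    hence "q dvd 1 \<longleftrightarrow> q dvd ?u * (q * j)" by (rule cong_q_dvd[OF n])
    hence "q dvd 1" by simp
    thus ?thesis using q_not_dvd_1 by blast
  next
    case (3 c j)
    have "[q * j = ?u] (mod q ^ n)" using D Dlo[of c] wu_ent(4)[of n "q * j"] by (simp add: 3 cong_def)
    hence "q dvd q * j \<longleftrightarrow> q dvd ?u" by (rule cong_q_dvd[OF n])
    hence "q dvd ?u" by simp
    thus ?thesis using u by blast
  next
    case (4 j j')
    have "[1 = ?u] (mod q ^ n)" using C Cwu[of "q * j'"] wu_ent(3)[of n "q * j"] by (simp add: 4 cong_def)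
    hence "[1 * (q * j') = ?u * (q * j')] (mod q ^ n)" by (intro cong_mult cong_refl)
    hence "[q * j = q * j'] (mod q ^ n)"
      using D Dwu[of "q * j'"] wu_ent(4)[of n "q * j"] by (simp add: 4 cong_def)
    moreover have "q ^ n = q * q ^ (n - 1)" using n by (cases n) auto
    ultimately have "[j = j'] (mod q ^ (n - 1))" using q_gt_2 by (simp add: cong_def)
    thus ?thesis using 4 cong_eq_less by blast
  qed
qed

lemma finite_reps: "finite (reps n)"
  by (simp add: reps_def)

lemma card_reps:
  assumes n: "n \<ge> 1"
  shows "card (reps n) = p ^ (n - 1) * (p + 1)"
proof -
  have "inj_on lo {0..<q ^ n}"
  proof (rule inj_onI)
    fix x y assume xy: "x \<in> {0..<q ^ n}" "y \<in> {0..<q ^ n}" "lo x = lo y"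
    hence "[x = y] (mod q ^ n)" using lo_ent(3)[of n x] lo_ent(3)[of n y] by (simp add: cong_def)
    thus "x = y" using xy cong_eq_less by blast
  qed
  moreover have "inj_on (\<lambda>j. wu (q * j)) {0..<q ^ (n - 1)}"
  proof (rule inj_onI)
    fix x y assume xy: "x \<in> {0..<q ^ (n - 1)}" "y \<in> {0..<q ^ (n - 1)}" "wu (q * x) = wu (q * y)"
    hence "[q * x = q * y] (mod q ^ n)" using wu_ent(4)[of n "q * x"] wu_ent(4)[of n "q * y"] by (simp add: cong_def)
    moreover have "q ^ n = q * q ^ (n - 1)" using n by (cases n) auto
    ultimately have "[x = y] (mod q ^ (n - 1))" using q_gt_2 by (simp add: cong_def)
    thus "x = y" using xy cong_eq_less by blast
  qed
  moreover have "lo ` {0..<q ^ n} \<inter> (\<lambda>j. wu (q * j)) ` {0..<q ^ (n - 1)} = {}"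
  proof -
    have "lo c \<noteq> wu (q * j)" for c j
    proof
      assume "lo c = wu (q * j)"
      hence "[1 = q * j] (mod q ^ n)" using lo_ent(4)[of n c] wu_ent(4)[of n "q * j"] by (simp add: cong_def)
      hence "q dvd 1 \<longleftrightarrow> q dvd q * j" by (rule cong_q_dvd[OF n])
      hence "q dvd 1" by simp
      thus False using q_not_dvd_1 by blast
    qed
    thus ?thesis by blast
  qed
  ultimately have "card (reps n) = nat (q ^ n) + nat (q ^ (n - 1))"
    unfolding reps_def by (subst card_Un_disjoint) (simp_all add: card_image)
  also have "\<dots> = p ^ n + p ^ (n - 1)" by (simp add: nat_power_eq)
  also have "\<dots> = p ^ (n - 1) * (p + 1)" using n by (cases n) auto
  finally show ?thesis .
qed

lemma induced_rep_K0bar: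
  assumes n: "n \<ge> 1"
  shows "induced_rep (Kbar p) (K0bar p n) (eta_bar eta) (reps n)"
proof (intro induced_rep.intro induced_rep_axioms.intro)
  show "group (Kbar p)" by (rule Kbar_group)
  show "subgroup (K0bar p n) (Kbar p)" using K0bar_subgroup[OF n] .
  fix h assume h: "h \<in> K0bar p n"
  have hu: "\<not> q dvd entD 1 h" using entD_unit(1)[OF h n, of 1] by simp
  have hc: "h \<in> carrier (Kbar p)" using h by (simp add: K0bar_iff)
  show "eta_bar eta (h \<otimes>\<^bsub>Kbar p\<^esub> h') = eta_bar eta h * eta_bar eta h'" if h': "h' \<in> K0bar p n" for h'
    using et_cong[OF K0bar_entD_mult[OF h n, of h']] et_mult[OF hu entD_unit(1)[OF h' n, of 1]]
    by (simp add: eta_bar_eq snd_mult)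
  show "eta_bar eta h \<noteq> 0"
    using et_square[OF hu] snd_square[OF hc] by (auto simp: eta_bar_eq)
next
  have "eta_bar eta h \<in> {1, -1}" if h: "h \<in> K0bar p n" for h
  proof -
    have "\<not> q dvd entD 1 h" "h \<in> carrier (Kbar p)" using entD_unit(1)[OF h n, of 1] h by (simp_all add: K0bar_iff)
    hence "et (entD 1 h) * et (entD 1 h) = 1" "(of_int (snd h) :: complex) * of_int (snd h) = 1"
      using et_square snd_square[of h] by (simp_all flip: of_int_mult)
    hence "eta_bar eta h * eta_bar eta h = 1" by (simp add: eta_bar_eq algebra_simps)
    thus ?thesis using square_eq_1_iff by blast
  qed
  hence "eta_bar eta ` K0bar p n \<subseteq> {1, -1}" by blast
  thus "finite (eta_bar eta ` K0bar p n)" using finite_subset by blast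
next
  show "reps n \<subseteq> carrier (Kbar p)" by (auto simp: reps_def)
qed (use finite_reps reps_exist[OF n] reps_unique[OF n] in auto)

end

section \<open>Level one\<close>

text \<open>Multiplication on the left commutes with right translation, so these operators are
  intertwiners for every kernel. Preserving equivariance is a separate matter and restricts the
  kernel.\<close>

definition left_convolution ::
  "('g, 'm) monoid_scheme \<Rightarrow> 'i set \<Rightarrow> ('i \<Rightarrow> complex) \<Rightarrow> ('i \<Rightarrow> 'g) \<Rightarrow> ('g \<Rightarrow> complex) \<Rightarrow> 'g \<Rightarrow> complex"
  where "left_convolution G X c b f =
    (\<lambda>k. if k \<in> carrier G then \<Sum>x\<in>X. c x * f (b x \<otimes>\<^bsub>G\<^esub> k) else 0)"

lemma (in group) left_convolution_intertwiner:
  assumes "\<And>x. x \<in> X \<Longrightarrow> b x \<in> carrier G"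
  shows "intertwiner G (right_translation G) V (left_convolution G X c b)"
proof -
  have "left_convolution G X c b (right_translation G g f) k =
    right_translation G g (left_convolution G X c b f) k" if "g \<in> carrier G" for g f k
    using assms that by (auto simp: left_convolution_def right_translation_def m_assoc intro!: sum.cong)
  moreover have "left_convolution G X c b (fscale z f) k = fscale z (left_convolution G X c b f) k"
    for f z k
    by (auto simp: left_convolution_def fscale_def sum_distrib_left mult.left_commute)
  moreover have "left_convolution G X c b (u + v) k =
    (left_convolution G X c b u + left_convolution G X c b v) k" for u v k
    by (auto simp: left_convolution_def sum.distrib distrib_left)
  ultimately show ?thesis unfolding intertwiner_def fun_eq_iff by blast
qed

context odd_prime
begin

lemma cong_cancel:
  assumes "\<not> q dvd a" "[a * x = a * y] (mod q)"
  shows "[x = y] (mod q)"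
  using assms q_prime by (simp add: cong_iff_dvd_diff prime_dvd_mult_iff flip: right_diff_distrib)

lemma sum_affine:
  fixes F :: "int \<Rightarrow> complex"
  assumes per: "\<And>x y. [x = y] (mod q) \<Longrightarrow> F x = F y" and a: "\<not> q dvd a"
  shows "(\<Sum>x\<in>{0..<q}. F (a * x + b)) = (\<Sum>x\<in>{0..<q}. F x)"
proof -
  let ?\<sigma> = "\<lambda>x. (a * x + b) mod q"
  have inj: "inj_on ?\<sigma> {0..<q}"
  proof (rule inj_onI)
    fix x y assume xy: "x \<in> {0..<q}" "y \<in> {0..<q}" "?\<sigma> x = ?\<sigma> y"
    hence "[a * x + b = a * y + b] (mod q)" by (simp add: cong_def)
    hence "[a * x = a * y] (mod q)" by (simp add: cong_add_rcancel)
    hence "[x = y] (mod q)" by (rule cong_cancel[OF a])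
    thus "x = y" using xy by (simp add: cong_def)
  qed
  have "?\<sigma> ` {0..<q} \<subseteq> {0..<q}" using q_gt_2 by auto
  hence im: "?\<sigma> ` {0..<q} = {0..<q}" using inj by (intro endo_inj_surj) auto
  have "(\<Sum>x\<in>{0..<q}. F (a * x + b)) = (\<Sum>x\<in>{0..<q}. F (?\<sigma> x))"
    by (intro sum.cong per) (simp_all add: cong_def)
  also have "\<dots> = (\<Sum>x\<in>?\<sigma> ` {0..<q}. F x)" by (simp add: sum.reindex[OF inj])
  finally show ?thesis unfolding im .
qed

end

context quadratic_character
begin

lemma rtrans_eq: "rtrans p = right_translation (Kbar p)"
  by (simp add: rtrans_def right_translation_def fun_eq_iff)

lemma I_eq_Ind:
  assumes "n \<ge> 1"
  shows "induced_rep.I (Kbar p) (K0bar p n) (eta_bar eta) = Ind p eta n"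
  using induced_rep.I_def[OF induced_rep_K0bar[OF assms]] Ind_iff[OF assms]
  by (auto simp: equivariant_def)

lemma equivariant_left:
  "equivariant n f \<Longrightarrow> h \<in> K0bar p n \<Longrightarrow> k \<in> carrier (Kbar p) \<Longrightarrow>
    f (h \<otimes>\<^bsub>Kbar p\<^esub> k) = eta_bar eta h * f k"
  by (simp add: equivariant_def)

lemma equivariant_outside: "equivariant n f \<Longrightarrow> k \<notin> carrier (Kbar p) \<Longrightarrow> f k = 0"
  unfolding equivariant_def by blast

lemma equivariant_K0bar:
  assumes "equivariant n f" "h \<in> K0bar p n"
  shows "f h = eta_bar eta h * f \<one>\<^bsub>Kbar p\<^esub>"
proof -
  have "h \<in> carrier (Kbar p)" using assms by (simp add: K0bar_iff)
  thus ?thesis using equivariant_left[OF assms K.one_closed] by simp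
qed

definition up :: "int \<Rightarrow> cov" where "up x = mat 1 x 0 1"

lemma up_K0bar: "up x \<in> K0bar p n"
  unfolding up_def K0bar_iff by (simp add: mat_mem mat_ent)

lemma eta_bar_up: "eta_bar eta (up x) = 1"
proof -
  have "et (entD 1 (up x)) = et 1" using mat_ent(4)[of 1] by (intro et_cong) (simp add: up_def)
  thus ?thesis by (simp add: eta_bar_eq up_def et_one)
qed

lemma of_typeD:
  assumes "of_type (right_translation (Kbar p)) H \<chi> f" "h \<in> H" "k \<in> carrier (Kbar p)"
  shows "f (k \<otimes>\<^bsub>Kbar p\<^esub> h) = \<chi> h * f k"
proof -
  have "right_translation (Kbar p) h f k = fscale (\<chi> h) f k" using assms by (simp add: of_type_def)
  thus ?thesis using assms by (simp add: right_translation_def fscale_def)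
qed

text \<open>The element \<open>up x\<close> lies in \<open>K0bar\<close> at every level with
  character value 1, and \<open>wu 0\<close> times \<open>up x\<close> has bottom row
  \<open>(1, x)\<close>, that of \<open>wu x\<close>.\<close>

lemma type_wu:
  assumes n: "n \<ge> 1" and f: "equivariant n f"
    and t: "of_type (right_translation (Kbar p)) (K0bar p m) (eta_bar eta) f"
  shows "f (wu x) = f (wu 0)"
proof -
  have upc: "up x \<in> carrier (Kbar p)" using up_K0bar[of x 1] by (simp add: K0bar_iff)
  have "[entC n (wu 0) * entA n (up x) + entD n (wu 0) * entC n (up x) = 1 * 1 + 0 * 0] (mod q ^ n)"
    unfolding up_def by (intro cong_add cong_mult wu_ent mat_ent)
  hence C: "[entC n (wu x) = 1 * entC n (wu 0 \<otimes>\<^bsub>Kbar p\<^esub> up x)] (mod q ^ n)"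
    using ent_mult(3)[of n "wu 0" "up x"] wu_ent(3)[of n x] by (simp add: cong_def)
  have "[entC n (wu 0) * entB n (up x) + entD n (wu 0) * entD n (up x) = 1 * x + 0 * 1] (mod q ^ n)"
    unfolding up_def by (intro cong_add cong_mult wu_ent mat_ent)
  hence D: "[entD n (wu x) = 1 * entD n (wu 0 \<otimes>\<^bsub>Kbar p\<^esub> up x)] (mod q ^ n)"
    using ent_mult(4)[of n "wu 0" "up x"] wu_ent(4)[of n x] by (simp add: cong_def)
  have "f (wu x) = f (wu 0 \<otimes>\<^bsub>Kbar p\<^esub> up x)"
    using eval_proportional_rows_one[OF f n wu_mem _ C D] upc by (simp add: snd_mult et_one) (simp add: up_def)
  also have "\<dots> = f (wu 0)" using of_typeD[OF t up_K0bar wu_mem] eta_bar_up by simp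
  finally show ?thesis .
qed

text \<open>
  The standard intertwining operator of level one: \<open>wu x\<close> runs over representatives of the cosets of
  the open Bruhat cell.
\<close>

definition M :: "(cov \<Rightarrow> complex) \<Rightarrow> cov \<Rightarrow> complex" where
  "M = left_convolution (Kbar p) {0..<q} (\<lambda>_. 1) wu"

lemma M_apply: "k \<in> carrier (Kbar p) \<Longrightarrow> M f k = (\<Sum>x\<in>{0..<q}. f (wu x \<otimes>\<^bsub>Kbar p\<^esub> k))"
  by (simp add: M_def left_convolution_def)

lemma wu_periodic:
  assumes f: "equivariant 1 f" and k: "k \<in> carrier (Kbar p)" and xy: "[x = y] (mod q)"
  shows "f (wu x \<otimes>\<^bsub>Kbar p\<^esub> k) = f (wu y \<otimes>\<^bsub>Kbar p\<^esub> k)"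
proof -
  have *: "[entC 1 (wu x) = 1 * entC 1 (wu y)] (mod q ^ 1)" "[entD 1 (wu x) = 1 * entD 1 (wu y)] (mod q ^ 1)"
    using wu_ent(3)[of 1 x] wu_ent(3)[of 1 y] wu_ent(4)[of 1 x] wu_ent(4)[of 1 y] xy
    by (simp_all add: cong_def)
  show ?thesis using eval_proportional_rows[OF f order_refl wu_mem wu_mem * k] by (simp add: et_one)
qed

text \<open>Modulo \<open>p\<close>, \<open>wu x\<close> times \<open>h\<close> has bottom row
  \<open>(a, b + d x)\<close>, which is \<open>a\<close> times \<open>(1, d^2 x + b d)\<close>
  because \<open>a d = 1\<close>; the substitution in \<open>x\<close> permutes the residues. The
  resulting factor \<open>et a\<close> equals \<open>et d\<close> because the character is
  quadratic.\<close>

lemma M_equivariant: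
  assumes f: "equivariant 1 f"
  shows "equivariant 1 (M f)"
  unfolding equivariant_def
proof (intro conjI allI impI ballI)
  fix k assume "k \<notin> carrier (Kbar p)"
  thus "M f k = 0" by (simp add: M_def left_convolution_def)
next
  fix h k assume h: "h \<in> K0bar p 1" and k: "k \<in> carrier (Kbar p)"
  have hc: "h \<in> carrier (Kbar p)" and C0: "[entC 1 h = 0] (mod q)" using h by (simp_all add: K0bar_iff)
  let ?a = "entA 1 h" and ?b = "entB 1 h" and ?d = "entD 1 h"
  have ad: "[?a * ?d = 1] (mod q)" using entD_unit(2)[OF h, of 1] by simp
  have d: "\<not> q dvd ?d * ?d" using entD_unit(1)[OF h, of 1] q_prime by (simp add: prime_dvd_mult_iff)
  have step: "f (wu x \<otimes>\<^bsub>Kbar p\<^esub> (h \<otimes>\<^bsub>Kbar p\<^esub> k)) =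
      eta_bar eta h * f (wu (?d * ?d * x + ?b * ?d) \<otimes>\<^bsub>Kbar p\<^esub> k)" for x
  proof -
    let ?x = "?d * ?d * x + ?b * ?d"
    have "[entC 1 (wu x) * ?a + entD 1 (wu x) * entC 1 h = 1 * ?a + x * 0] (mod q)"
      using wu_ent(3)[of 1 x] wu_ent(4)[of 1 x] C0 by (intro cong_add cong_mult) auto
    moreover have "[?a * entC 1 (wu ?x) = ?a * 1] (mod q)"
      using wu_ent(3)[of 1] by (intro cong_mult) auto
    ultimately have C: "[entC 1 (wu x \<otimes>\<^bsub>Kbar p\<^esub> h) = ?a * entC 1 (wu ?x)] (mod q ^ 1)"
      using ent_mult(3)[of 1 "wu x" h] by (simp add: cong_def)
    have "[entC 1 (wu x) * ?b + entD 1 (wu x) * ?d = 1 * ?b + x * ?d] (mod q)"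
      using wu_ent(3)[of 1 x] wu_ent(4)[of 1 x] by (intro cong_add cong_mult) auto
    moreover have "[?a * entD 1 (wu ?x) = ?a * ?x] (mod q)"
      using wu_ent(4)[of 1] by (intro cong_mult) auto
    moreover have "[(?a * ?d) * (?d * x + ?b) = 1 * (?d * x + ?b)] (mod q)"
      by (intro cong_mult ad cong_refl)
    ultimately have D: "[entD 1 (wu x \<otimes>\<^bsub>Kbar p\<^esub> h) = ?a * entD 1 (wu ?x)] (mod q ^ 1)"
      using ent_mult(4)[of 1 "wu x" h] by (simp add: cong_def algebra_simps)
    have "f ((wu x \<otimes>\<^bsub>Kbar p\<^esub> h) \<otimes>\<^bsub>Kbar p\<^esub> k) =
        of_int (snd (wu x \<otimes>\<^bsub>Kbar p\<^esub> h) * snd (wu ?x)) * et ?a * f (wu ?x \<otimes>\<^bsub>Kbar p\<^esub> k)"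
      using hc by (intro eval_proportional_rows[OF f order_refl _ wu_mem C D k]) simp
    thus ?thesis using et_inverse[OF ad] hc k by (simp add: eta_bar_eq snd_mult K.m_assoc)
  qed
  have "M f (h \<otimes>\<^bsub>Kbar p\<^esub> k) = (\<Sum>x\<in>{0..<q}. eta_bar eta h * f (wu (?d * ?d * x + ?b * ?d) \<otimes>\<^bsub>Kbar p\<^esub> k))"
    using hc k by (simp add: M_apply step)
  also have "\<dots> = eta_bar eta h * (\<Sum>x\<in>{0..<q}. f (wu (?d * ?d * x + ?b * ?d) \<otimes>\<^bsub>Kbar p\<^esub> k))"
    by (simp add: sum_distrib_left)
  also have "(\<Sum>x\<in>{0..<q}. f (wu (?d * ?d * x + ?b * ?d) \<otimes>\<^bsub>Kbar p\<^esub> k)) = M f k"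
    using sum_affine[of "\<lambda>x. f (wu x \<otimes>\<^bsub>Kbar p\<^esub> k)", OF wu_periodic[OF f k] d, of "?b * ?d"] k
    by (simp add: M_apply)
  finally show "M f (h \<otimes>\<^bsub>Kbar p\<^esub> k) = eta_bar eta h * M f k" .
qed

text \<open>\<open>wu y\<close> times \<open>wu x\<close> has bottom row
  \<open>(y, x y - 1)\<close>. For \<open>y = 0\<close> this is minus the row of the identity, once
  for each of the \<open>p\<close> values of \<open>x\<close>. For a unit \<open>y\<close> it is
  \<open>y\<close> times \<open>(1, x - 1/y)\<close>, and summing over \<open>x\<close> gives
  \<open>et y\<close> times \<open>M f\<close>.\<close>

lemma M_square:
  assumes f: "equivariant 1 f" and k: "k \<in> carrier (Kbar p)"
  shows "M (M f) k = (\<Sum>y\<in>{1..<q}. et y) * M f k + of_int q * et (- 1) * f k"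
proof -
  let ?g = "\<lambda>x y. f (wu y \<otimes>\<^bsub>Kbar p\<^esub> (wu x \<otimes>\<^bsub>Kbar p\<^esub> k))"
  have C: "[entC 1 (wu y \<otimes>\<^bsub>Kbar p\<^esub> wu x) = y] (mod q)"
    and D: "[entD 1 (wu y \<otimes>\<^bsub>Kbar p\<^esub> wu x) = x * y - 1] (mod q)" for x y
  proof -
    have "[entC 1 (wu y) * entA 1 (wu x) + entD 1 (wu y) * entC 1 (wu x) = 1 * 0 + y * 1] (mod q ^ 1)"
      by (intro cong_add cong_mult wu_ent)
    thus "[entC 1 (wu y \<otimes>\<^bsub>Kbar p\<^esub> wu x) = y] (mod q)"
      using ent_mult(3)[of 1 "wu y" "wu x"] by (simp add: cong_def)
    have "[entC 1 (wu y) * entB 1 (wu x) + entD 1 (wu y) * entD 1 (wu x) = 1 * (- 1) + y * x] (mod q ^ 1)"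
      by (intro cong_add cong_mult wu_ent)
    thus "[entD 1 (wu y \<otimes>\<^bsub>Kbar p\<^esub> wu x) = x * y - 1] (mod q)"
      using ent_mult(4)[of 1 "wu y" "wu x"] by (simp add: cong_def mult.commute)
  qed
  have y0: "?g x 0 = et (- 1) * f k" for x
  proof -
    have "f ((wu 0 \<otimes>\<^bsub>Kbar p\<^esub> wu x) \<otimes>\<^bsub>Kbar p\<^esub> k) =
      of_int (snd (wu 0 \<otimes>\<^bsub>Kbar p\<^esub> wu x) * snd (lo 0)) * et (- 1) * f (lo 0 \<otimes>\<^bsub>Kbar p\<^esub> k)"
    proof (rule eval_proportional_rows[OF f order_refl _ lo_mem _ _ k])
      have "[- 1 * entC 1 (lo 0) = - 1 * 0] (mod q ^ 1)" "[- 1 * entD 1 (lo 0) = - 1 * 1] (mod q ^ 1)"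
        by (intro cong_mult lo_ent cong_refl)+
      thus "[entC 1 (wu 0 \<otimes>\<^bsub>Kbar p\<^esub> wu x) = - 1 * entC 1 (lo 0)] (mod q ^ 1)"
        "[entD 1 (wu 0 \<otimes>\<^bsub>Kbar p\<^esub> wu x) = - 1 * entD 1 (lo 0)] (mod q ^ 1)"
        using C[of 0 x] D[of 0 x] by (simp_all add: cong_def)
    qed simp
    thus ?thesis using k by (simp add: snd_mult snd_one K.m_assoc lo_0)
  qed
  have y1: "(\<Sum>x\<in>{0..<q}. ?g x y) = et y * M f k" if y: "y \<in> {1..<q}" for y
  proof -
    have yu: "\<not> q dvd y" using y by (auto dest: zdvd_imp_le)
    obtain v where v: "[y * v = 1] (mod q)" using q_inverse[OF yu, of 1] by auto
    have "?g x y = et y * f (wu (1 * x + - v) \<otimes>\<^bsub>Kbar p\<^esub> k)" for x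
    proof -
      have "f ((wu y \<otimes>\<^bsub>Kbar p\<^esub> wu x) \<otimes>\<^bsub>Kbar p\<^esub> k) =
        of_int (snd (wu y \<otimes>\<^bsub>Kbar p\<^esub> wu x) * snd (wu (1 * x + - v))) * et y * f (wu (1 * x + - v) \<otimes>\<^bsub>Kbar p\<^esub> k)"
      proof (rule eval_proportional_rows[OF f order_refl _ wu_mem _ _ k])
        have "[y * entC 1 (wu (1 * x + - v)) = y * 1] (mod q ^ 1)"
          "[y * entD 1 (wu (1 * x + - v)) = y * (1 * x + - v)] (mod q ^ 1)"
          by (intro cong_mult wu_ent cong_refl)+
        moreover have "[y * (1 * x + - v) = x * y - 1] (mod q ^ 1)"
          using cong_diff[OF cong_refl[of "x * y"] v] by (simp add: algebra_simps)
        ultimately show "[entC 1 (wu y \<otimes>\<^bsub>Kbar p\<^esub> wu x) = y * entC 1 (wu (1 * x + - v))] (mod q ^ 1)"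
          "[entD 1 (wu y \<otimes>\<^bsub>Kbar p\<^esub> wu x) = y * entD 1 (wu (1 * x + - v))] (mod q ^ 1)"
          using C[of y x] D[of y x] by (simp_all add: cong_def)
      qed simp
      thus ?thesis using k by (simp add: snd_mult K.m_assoc)
    qed
    hence "(\<Sum>x\<in>{0..<q}. ?g x y) = et y * (\<Sum>x\<in>{0..<q}. f (wu (1 * x + - v) \<otimes>\<^bsub>Kbar p\<^esub> k))"
      by (simp only: sum_distrib_left)
    also have "(\<Sum>x\<in>{0..<q}. f (wu (1 * x + - v) \<otimes>\<^bsub>Kbar p\<^esub> k)) = M f k"
      using sum_affine[of "\<lambda>x. f (wu x \<otimes>\<^bsub>Kbar p\<^esub> k)", OF wu_periodic[OF f k] q_not_dvd_1, of "- v"] k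
      by (simp only: M_apply)
    finally show ?thesis .
  qed
  have "M (M f) k = (\<Sum>x\<in>{0..<q}. \<Sum>y\<in>{0..<q}. ?g x y)" using k by (simp add: M_apply)
  also have "\<dots> = (\<Sum>y\<in>{0..<q}. \<Sum>x\<in>{0..<q}. ?g x y)" by (rule sum.swap)
  also have "{0..<q} = insert 0 {1..<q}" using q_gt_2 by auto
  also have "(\<Sum>y\<in>insert 0 {1..<q}. \<Sum>x\<in>insert 0 {1..<q}. ?g x y)
      = (\<Sum>x\<in>{0..<q}. ?g x 0) + (\<Sum>y\<in>{1..<q}. \<Sum>x\<in>{0..<q}. ?g x y)"
    unfolding \<open>{0..<q} = insert 0 {1..<q}\<close> by (subst sum.insert) auto
  also have "\<dots> = of_int q * et (- 1) * f k + (\<Sum>y\<in>{1..<q}. et y) * M f k"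
    by (simp add: y0 y1 sum_distrib_right)
  finally show ?thesis by simp
qed

lemma level_1_split:
  assumes l: "l + m = (\<Sum>y\<in>{1..<q}. et y)" "l * m = - (of_int q * et (- 1))" "l \<noteq> m"
  shows "split_rep (Kbar p) (K0bar p 1) (eta_bar eta) (reps 1) (Ind p eta 1) M l m
    (induced_rep.\<delta> (K0bar p 1) (eta_bar eta))"
proof -
  interpret induced_rep "Kbar p" "K0bar p 1" "eta_bar eta" "reps 1"
    by (rule induced_rep_K0bar) simp
  have I: "I = Ind p eta 1" by (rule I_eq_Ind) simp
  have eqv: "f \<in> Ind p eta 1 \<longleftrightarrow> equivariant 1 f" for f by (rule Ind_iff) simp
  have "l * m \<noteq> 0"
  proof -
    have "\<not> q dvd - 1" using q_not_dvd_1 by simp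
    hence "et (- 1) * et (- 1) = 1" by (rule et_square)
    hence "et (- 1) \<noteq> 0" by auto
    thus ?thesis unfolding l(2) using q_gt_2 by simp
  qed
  hence lm0: "l \<noteq> 0" "m \<noteq> 0" by auto
  show ?thesis
  proof (intro split_rep.intro split_rep_axioms.intro)
    show "induced_rep (Kbar p) (K0bar p 1) (eta_bar eta) (reps 1)" by unfold_locales
    show "subrep (Kbar p) \<rho> I (Ind p eta 1)" using subrep_I unfolding I .
    show "intertwiner (Kbar p) \<rho> (Ind p eta 1) M"
      unfolding M_def by (rule K.left_convolution_intertwiner) simp
    show "M f \<in> Ind p eta 1" if "f \<in> Ind p eta 1" for f
      using M_equivariant that unfolding eqv .
    show "M (M f) = fscale (l + m) (M f) - fscale (l * m) f" if "f \<in> Ind p eta 1" for f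
    proof
      fix k
      have f: "equivariant 1 f" using that unfolding eqv .
      show "M (M f) k = (fscale (l + m) (M f) - fscale (l * m) f) k"
      proof (cases "k \<in> carrier (Kbar p)")
        case True
        show ?thesis unfolding M_square[OF f True] l by (simp add: fscale_def)
      next
        case False
        hence "f k = 0" by (rule equivariant_outside[OF f])
        thus ?thesis using False by (simp add: M_def left_convolution_def fscale_def)
      qed
    qed
    show "\<delta> \<in> Ind p eta 1" using \<delta>_I unfolding I .
    \<comment> \<open>\<open>M\<close> evaluates at the elements \<open>wu x\<close>, which lie
      outside the support of \<open>\<delta>\<close>.\<close>
    show "M \<delta> \<one>\<^bsub>Kbar p\<^esub> = 0"
    proof -
      have *: "wu x \<notin> K0bar p 1" for x
        using wu_ent(3)[of 1 x] q_not_dvd_1 by (auto simp: K0bar_iff cong_def dvd_eq_mod_eq_0)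
      have "\<delta> (wu x) = 0" for x by (simp only: \<delta>_def * if_False)
      thus ?thesis by (simp add: M_apply del: One_nat_def)
    qed
    show "U = Ind p eta 1" if "subrep (Kbar p) \<rho> (Ind p eta 1) U" "\<delta> \<in> U" for U
      using \<delta>_generates that unfolding I .
    fix f \<nu> assume f': "f \<in> Ind p eta 1" and t: "of_type \<rho> (K0bar p 1) (eta_bar eta) f"
      and ev: "M f = fscale \<nu> f" and f1: "f \<one>\<^bsub>Kbar p\<^esub> = 0"
    have f: "equivariant 1 f" using f' unfolding eqv .
    \<comment> \<open>A vector of this type is constant on the elements \<open>wu x\<close>, so the
      eigenvalue equation at the identity becomes \<open>q * f (wu 0) = 0\<close>. At level one the
      cosets of the identity and of the \<open>wu x\<close> cover the group.\<close>
    have "M f \<one>\<^bsub>Kbar p\<^esub> = (\<Sum>x\<in>{0..<q}. f (wu x))" by (simp add: M_apply)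
    also have "\<dots> = (\<Sum>x\<in>{0..<q}. f (wu 0))" by (rule sum.cong[OF refl type_wu[OF order_refl f t]])
    finally have "M f \<one>\<^bsub>Kbar p\<^esub> = of_int q * f (wu 0)" by simp
    hence "f (wu 0) = 0" using ev f1 q_gt_2 by (simp add: fscale_def)
    hence wu0: "f (wu x) = 0" for x using type_wu[OF order_refl f t, of x] by simp
    show "f = 0"
    proof
      fix k
      consider "k \<notin> carrier (Kbar p)" | "k \<in> K0bar p 1" | "k \<in> carrier (Kbar p)" "\<not> q dvd entC 1 k"
        by (auto simp: K0bar_iff cong_0_iff simp del: One_nat_def)
      thus "f k = 0 k"
      proof cases
        case 1 thus ?thesis using equivariant_outside[OF f] by simp
      next
        case 2 thus ?thesis using equivariant_K0bar[OF f] f1 by simp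
      next
        case 3
        obtain d where d: "[entC 1 k = entC 1 k * entC 1 (wu d)] (mod q ^ 1)"
          "[entD 1 k = entC 1 k * entD 1 (wu d)] (mod q ^ 1)"
          using coset_wu[OF order_refl 3] by blast
        show ?thesis using eval_proportional_rows_one[OF f order_refl 3(1) wu_mem d] wu0 by simp
      qed
    qed
  next
    show "of_type \<rho> (K0bar p 1) (eta_bar eta) \<delta>" by (rule of_type_\<delta>)
    show "\<delta> \<one>\<^bsub>Kbar p\<^esub> \<noteq> 0" unfolding \<delta>_one by simp
  qed (use l(3) lm0 in auto)
qed

end

section \<open>The Legendre symbol\<close>

context odd_prime
begin

definition leg :: "int \<Rightarrow> complex" where "leg x = of_int (Legendre x q)"

lemma Legendre_cong: "[x = y] (mod q) \<Longrightarrow> Legendre x q = Legendre y q"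
  by (simp add: Legendre_def QuadRes_def cong_def)

lemma leg_cong: "[x = y] (mod q) \<Longrightarrow> leg x = leg y"
  by (simp add: leg_def Legendre_cong)

lemma leg_zero: "q dvd x \<Longrightarrow> leg x = 0"
  by (simp add: leg_def Legendre_def cong_0_iff)

lemma leg_square: "\<not> q dvd x \<Longrightarrow> leg x * leg x = 1"
  by (simp add: leg_def Legendre_def cong_0_iff)

lemma leg_cases: "leg x \<in> {0, 1, -1}"
  by (simp add: leg_def Legendre_def)

lemma leg_root: "leg x = 1 \<Longrightarrow> \<exists>a. [a * a = x] (mod q)"
  by (auto simp: leg_def Legendre_def QuadRes_def power2_eq_square split: if_splits)

text \<open>Euler's criterion gives multiplicativity modulo \<open>p\<close>. Both sides lie in {0,
  1, -1}, so they differ by at most 2, which is less than \<open>p\<close>.\<close>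

lemma leg_mult: "leg (x * y) = leg x * leg y"
proof -
  have p2: "2 < p" using q_gt_2 by simp
  let ?e = "(p - 1) div 2"
  have "[Legendre (x * y) q = (x * y) ^ ?e] (mod q)" by (rule euler_criterion[OF p_prime p2])
  moreover have "[Legendre x q * Legendre y q = x ^ ?e * y ^ ?e] (mod q)"
    by (intro cong_mult euler_criterion[OF p_prime p2])
  ultimately have "[Legendre (x * y) q = Legendre x q * Legendre y q] (mod q)"
    by (simp add: power_mult_distrib cong_def)
  hence "q dvd Legendre (x * y) q - Legendre x q * Legendre y q" by (simp add: cong_iff_dvd_diff)
  moreover have "Legendre z q \<in> {0, 1, -1}" for z by (simp add: Legendre_def)
  hence "\<bar>Legendre (x * y) q - Legendre x q * Legendre y q\<bar> \<le> 2" by (smt (verit) insertE singletonD mult_cancel_right1 mult_minus_left mult_zero_left)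
  ultimately have "Legendre (x * y) q - Legendre x q * Legendre y q = 0"
    using q_gt_2 dvd_imp_le_int[of "Legendre (x * y) q - Legendre x q * Legendre y q" q] by force
  thus ?thesis by (simp add: leg_def flip: of_int_mult)
qed

lemma leg_of_square: "\<not> q dvd a \<Longrightarrow> leg (a * a) = 1"
  by (simp add: leg_mult leg_square)

text \<open>If every unit were a square, squaring would be onto and hence injective on nonzero
  residues, but 1 and \<open>q - 1\<close> have the same square.\<close>

lemma nonresidue: obtains g where "\<not> q dvd g" "leg g = - 1"
proof -
  have "\<exists>g\<in>{1..<q}. leg g \<noteq> 1"
  proof (rule ccontr)
    assume "\<not> ?thesis"
    hence one: "leg g = 1" if "g \<in> {1..<q}" for g using that by blast
    let ?s = "\<lambda>x. (x * x) mod q"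
    have unit: "\<not> q dvd x \<longleftrightarrow> x \<noteq> 0" if "x \<in> {0..<q}" for x using that by (auto dest: zdvd_imp_le)
    have "{1..<q} \<subseteq> ?s ` {1..<q}"
    proof
      fix g assume g: "g \<in> {1..<q}"
      then obtain a where a: "[a * a = g] (mod q)" using leg_root one by blast
      have "\<not> q dvd g" using g unit[of g] by auto
      hence "\<not> q dvd a" using cong_dvd_iff[OF a] by auto
      hence "a mod q \<noteq> 0" by (simp add: dvd_eq_mod_eq_0)
      moreover have "0 \<le> a mod q" "a mod q < q" using q_gt_2 by (intro pos_mod_sign pos_mod_bound; linarith)+
      ultimately have "a mod q \<in> {1..<q}" unfolding atLeastLessThan_iff by linarith
      moreover have "?s (a mod q) = g" using a g by (simp add: cong_def mod_mult_eq)
      ultimately show "g \<in> ?s ` {1..<q}" by blast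
    qed
    hence inj: "inj_on ?s {1..<q}" by (intro finite_surj_inj) auto
    have "?s 1 = ?s (q - 1)"
    proof -
      have "(q - 1) * (q - 1) = 1 + q * (q - 2)" by (simp add: algebra_simps)
      thus ?thesis by simp
    qed
    hence "1 = q - 1" by (rule inj_onD[OF inj]) (use q_gt_2 in auto)
    thus False using q_gt_2 by simp
  qed
  then obtain g where g: "g \<in> {1..<q}" "leg g \<noteq> 1" by blast
  have "\<not> q dvd g" using g(1) by (auto dest: zdvd_imp_le)
  thus ?thesis using that leg_cases[of g] g(2) leg_square[of g] by auto
qed

text \<open>Dilation by a nonresidue permutes the residues and changes the sign of every
  term.\<close>

lemma leg_sum: "(\<Sum>x\<in>{0..<q}. leg x) = 0"
proof -
  obtain g where g: "\<not> q dvd g" "leg g = - 1" by (rule nonresidue)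
  have "(\<Sum>x\<in>{0..<q}. leg x) = (\<Sum>x\<in>{0..<q}. leg (g * x + 0))"
    by (rule sum_affine[OF leg_cong g(1), symmetric])
  also have "\<dots> = - (\<Sum>x\<in>{0..<q}. leg x)" by (simp add: leg_mult g(2) sum_negf)
  finally show ?thesis by simp
qed

lemma leg_sum_reflect: "(\<Sum>x\<in>{0..<q}. leg (z - x)) = 0"
proof -
  have "\<not> q dvd - 1" using q_gt_2 by simp
  hence "(\<Sum>x\<in>{0..<q}. leg (- 1 * x + z)) = (\<Sum>x\<in>{0..<q}. leg x)"
    by (intro sum_affine[OF leg_cong])
  thus ?thesis by (simp add: leg_sum)
qed

lemma leg_sum_shift: "(\<Sum>z\<in>{0..<q}. leg (z - x)) = 0"
proof -
  have "\<not> q dvd 1" using q_gt_2 by simp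
  hence "(\<Sum>z\<in>{0..<q}. leg (1 * z + - x)) = (\<Sum>z\<in>{0..<q}. leg z)"
    by (intro sum_affine[OF leg_cong])
  thus ?thesis by (simp add: leg_sum)
qed

lemma split_0: "{0..<q} = insert 0 {1..<q}"
  using q_gt_2 by auto

lemma leg_sum_nonzero: "(\<Sum>x\<in>{1..<q}. leg x) = 0"
  using leg_sum leg_zero[of 0] unfolding split_0 by simp

text \<open>
  Dilating \<open>z\<close> by a unit does not change this sum, so it is constant for \<open>z\<close> prime to \<open>p\<close>, and the
  constant is found by summing over all \<open>z\<close>.
\<close>

lemma leg_convolution:
  "(\<Sum>x\<in>{0..<q}. leg x * leg (z - x)) = leg (- 1) * ((if q dvd z then of_int q else 0) - 1)"
proof -
  define S where "S z = (\<Sum>x\<in>{0..<q}. leg x * leg (z - x))" for z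
  have S_cong: "S z = S z'" if "[z = z'] (mod q)" for z z'
    unfolding S_def using that by (intro sum.cong arg_cong2[of _ _ _ _ "(*)"] leg_cong) (auto intro: cong_diff)
  have S_unit: "S (a * z) = S z" if a: "\<not> q dvd a" for a z
  proof -
    have "S (a * z) = (\<Sum>x\<in>{0..<q}. leg (a * x + 0) * leg (a * z - (a * x + 0)))"
      unfolding S_def
      by (rule sum_affine[symmetric, OF _ a]) (intro arg_cong2[of _ _ _ _ "(*)"] leg_cong; auto intro: cong_diff)
    also have "\<dots> = (\<Sum>x\<in>{0..<q}. leg a * leg a * (leg x * leg (z - x)))"
      by (intro sum.cong) (simp_all add: leg_mult flip: right_diff_distrib)
    also have "\<dots> = S z" by (simp add: leg_square[OF a] S_def)
    finally show ?thesis .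
  qed
  have S0: "S 0 = leg (- 1) * (of_int q - 1)"
  proof -
    have "leg (0 - x) = leg (- 1) * leg x" for x using leg_mult[of "- 1" x] by simp
    hence "S 0 = (\<Sum>x\<in>{0..<q}. leg (- 1) * (leg x * leg x))"
      unfolding S_def by (simp only: mult.left_commute)
    also have "\<dots> = leg (- 1) * (\<Sum>x\<in>{0..<q}. leg x * leg x)" by (simp add: sum_distrib_left)
    also have "(\<Sum>x\<in>{0..<q}. leg x * leg x) = (\<Sum>x\<in>{1..<q}. leg x * leg x)"
      using leg_zero[of 0] unfolding split_0 by simp
    also have "\<dots> = (\<Sum>x\<in>{1..<q}. 1)"
      by (intro sum.cong refl leg_square) (auto dest: zdvd_imp_le)
    also have "\<dots> = of_int q - 1" using q_gt_2 by (simp add: of_nat_diff)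
    finally show ?thesis .
  qed
  have S1: "S a = S 1" if "\<not> q dvd a" for a using S_unit[OF that, of 1] by simp
  have "(\<Sum>z\<in>{0..<q}. S z) = (\<Sum>x\<in>{0..<q}. leg x * (\<Sum>z\<in>{0..<q}. leg (z - x)))"
    unfolding S_def sum_distrib_left by (rule sum.swap)
  also have "\<dots> = 0" by (simp add: leg_sum_shift)
  finally have "(\<Sum>z\<in>{0..<q}. S z) = 0" .
  moreover have "(\<Sum>z\<in>{0..<q}. S z) = S 0 + (\<Sum>z\<in>{1..<q}. S z)"
    unfolding split_0 by simp
  moreover have "(\<Sum>z\<in>{1..<q}. S z) = (\<Sum>z\<in>{1..<q}. S 1)"
    by (intro sum.cong refl S1) (auto dest: zdvd_imp_le)
  ultimately have "(of_int q - 1) * (leg (- 1) + S 1) = 0"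
    using q_gt_2 by (simp add: S0 of_nat_diff algebra_simps)
  hence "S 1 = - leg (- 1)" using q_gt_2 by (auto simp: add_eq_0_iff)
  moreover have "S z = S 0" if "q dvd z" using that by (intro S_cong) (simp add: cong_0_iff)
  ultimately show ?thesis using S1[of z] S0 unfolding S_def[symmetric] by (auto simp: algebra_simps)
qed

end

section \<open>Level n\<close>

locale higher_level = quadratic_character +
  fixes n :: nat
  assumes n_gt_1: "n > 1"
begin

lemma n_ge_1: "n \<ge> 1" "n - 1 \<ge> 1"
  using n_gt_1 by auto

lemma q_pow_n: "q ^ n = q ^ (n - 1) * q"
  using n_gt_1 by (cases n) auto

lemma lo_mult: "lo c \<otimes>\<^bsub>Kbar p\<^esub> lo c' = lo (c + c')"
proof -
  have "[c mod N * (1 mod N) + 1 mod N * (c' mod N) = c * 1 + 1 * c'] (mod N)" for N :: int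
    by (intro cong_add cong_mult) simp_all
  thus ?thesis
    by (simp add: lo_def mat_def Kbar_def DirProd_def SL2_def mat2_mult_def Zp_simps sign_group_def
        mod_simps cong_def)
qed

text \<open>
  The cosets of level \<open>n\<close> of the elements \<open>nx x\<close>, for \<open>x\<close> modulo \<open>p\<close>, make up the coset of
  level \<open>n - 1\<close> of the identity.
\<close>

definition nx :: "int \<Rightarrow> cov" where "nx x = lo (q ^ (n - 1) * x)"

lemma nx_mem [simp]: "nx x \<in> carrier (Kbar p)" and snd_nx [simp]: "snd (nx x) = 1"
  by (simp_all add: nx_def)

lemma nx_mult: "nx x \<otimes>\<^bsub>Kbar p\<^esub> nx y = nx (x + y)"
  by (simp add: nx_def lo_mult distrib_left)

lemma nx_0: "nx 0 = \<one>\<^bsub>Kbar p\<^esub>"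
  by (simp add: nx_def lo_0)

lemma cong_scale: "[x = y] (mod q) \<Longrightarrow> [q ^ (n - 1) * x = q ^ (n - 1) * y] (mod q ^ n)"
  unfolding q_pow_n by (simp add: cong_def)

text \<open>This is 2(n - 1) \<ge> n; it removes the second-order terms in the fibre
  coordinate.\<close>

lemma cong_square_zero: "[q ^ (n - 1) * (q ^ (n - 1) * x) = 0] (mod q ^ n)"
proof -
  have "q ^ n dvd q ^ (n - 1) * q ^ (n - 1)"
    using n_gt_1 by (simp add: le_imp_power_dvd flip: power_add)
  hence "q ^ n dvd q ^ (n - 1) * q ^ (n - 1) * x" by (rule dvd_mult2)
  thus ?thesis by (simp add: cong_0_iff mult.assoc)
qed

lemma lo_cong:
  assumes f: "equivariant n f" and k: "k \<in> carrier (Kbar p)" and c: "[c = c'] (mod q ^ n)"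
  shows "f (lo c \<otimes>\<^bsub>Kbar p\<^esub> k) = f (lo c' \<otimes>\<^bsub>Kbar p\<^esub> k)"
proof -
  have "[entC n (lo c) = 1 * entC n (lo c')] (mod q ^ n)" "[entD n (lo c) = 1 * entD n (lo c')] (mod q ^ n)"
    using lo_ent(3)[of n c] lo_ent(3)[of n c'] lo_ent(4)[of n c] lo_ent(4)[of n c'] c
    by (simp_all add: cong_def)
  from eval_proportional_rows[OF f n_ge_1(1) lo_mem lo_mem this k] show ?thesis by (simp add: et_one)
qed

lemma nx_cong:
  assumes "equivariant n f" "k \<in> carrier (Kbar p)" "[x = y] (mod q)"
  shows "f (nx x \<otimes>\<^bsub>Kbar p\<^esub> k) = f (nx y \<otimes>\<^bsub>Kbar p\<^esub> k)"
  unfolding nx_def by (rule lo_cong[OF assms(1,2) cong_scale[OF assms(3)]])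

lemma nx_K0bar: "nx x \<in> K0bar p (n - 1)"
proof -
  have "[entC (n - 1) (nx x) = q ^ (n - 1) * x] (mod q ^ (n - 1))" unfolding nx_def by (rule lo_ent)
  thus ?thesis by (simp add: K0bar_iff cong_def)
qed

lemma eta_bar_lo: "eta_bar eta (lo x) = 1"
proof -
  have "et (entD 1 (lo x)) = et 1" using lo_ent(4)[of 1 x] by (intro et_cong) simp
  thus ?thesis by (simp add: eta_bar_eq et_one)
qed

lemma K0bar_mono: "K0bar p n \<subseteq> K0bar p (n - 1)"
proof
  fix k assume "k \<in> K0bar p n"
  hence k: "k \<in> carrier (Kbar p)" "[entC n k = 0] (mod q ^ n)" by (auto simp: K0bar_iff)
  have "[entC n k = 0] (mod q ^ (n - 1))"
    using k(2) by (rule cong_dvd_modulus) (simp add: q_pow_n)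
  moreover have "[entC n k = entC (n - 1) k] (mod q ^ (n - 1))" by (rule ent_level[OF k(1)]) simp
  ultimately show "k \<in> K0bar p (n - 1)" using k(1) by (simp add: K0bar_iff cong_def)
qed

text \<open>The bottom row of \<open>nx x\<close> times \<open>h\<close> is p^(n-1) (a x + y)
  followed by d + p^(n-1) x b. Dividing by the second entry, whose inverse is \<open>a\<close>
  modulo \<open>p\<close>, gives the fibre coordinate a^2 x + a y. So \<open>K0bar p (n - 1)\<close>
  acts on the fibre by affine maps, and \<open>K0bar p n\<close>, where \<open>y = 0\<close>, by
  squares of units.\<close>

lemma nx_K0bar_mult:
  assumes f: "equivariant n f" and h: "h \<in> K0bar p (n - 1)" and k: "k \<in> carrier (Kbar p)"
    and y: "[entC n h = q ^ (n - 1) * y] (mod q ^ n)"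
  shows "f (nx x \<otimes>\<^bsub>Kbar p\<^esub> (h \<otimes>\<^bsub>Kbar p\<^esub> k)) =
    eta_bar eta h * f (nx (entA n h * entA n h * x + entA n h * y) \<otimes>\<^bsub>Kbar p\<^esub> k)"
proof -
  let ?a = "entA n h" and ?b = "entB n h" and ?d = "entD n h" and ?q = "q ^ (n - 1)"
  let ?x = "?a * ?a * x + ?a * y" and ?u = "?q * x * ?b + ?d"
  have hc: "h \<in> carrier (Kbar p)" using h by (simp add: K0bar_iff)
  have ad: "[?a * ?d = 1] (mod q)" using entD_unit(2)[OF h] n_ge_1 by simp
  have "[entC n (nx x) * ?a + entD n (nx x) * entC n h = ?q * x * ?a + 1 * (?q * y)] (mod q ^ n)"
    unfolding nx_def by (intro cong_add cong_mult lo_ent cong_refl y)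
  hence 1: "[entC n (nx x \<otimes>\<^bsub>Kbar p\<^esub> h) = ?q * (?a * x + y)] (mod q ^ n)"
    using ent_mult(3)[of n "nx x" h] by (simp add: cong_def algebra_simps)
  have "[?u * entC n (nx ?x) = ?u * (?q * ?x)] (mod q ^ n)"
    unfolding nx_def by (intro cong_mult cong_refl lo_ent)
  moreover have "?u * (?q * ?x) = ?q * (?q * (x * ?b * ?x)) + ?q * ((?a * ?d) * (?a * x + y))"
    by (simp add: algebra_simps)
  moreover have "[?q * (?q * (x * ?b * ?x)) + ?q * ((?a * ?d) * (?a * x + y)) =
      0 + ?q * (1 * (?a * x + y))] (mod q ^ n)"
    by (intro cong_add cong_square_zero cong_scale cong_mult ad cong_refl)
  ultimately have C: "[entC n (nx x \<otimes>\<^bsub>Kbar p\<^esub> h) = ?u * entC n (nx ?x)] (mod q ^ n)"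
    using 1 by (simp add: cong_def)
  have "[entC n (nx x) * ?b + entD n (nx x) * ?d = ?q * x * ?b + 1 * ?d] (mod q ^ n)"
    "[?u * entD n (nx ?x) = ?u * 1] (mod q ^ n)"
    unfolding nx_def by (intro cong_add cong_mult lo_ent cong_refl)+
  hence D: "[entD n (nx x \<otimes>\<^bsub>Kbar p\<^esub> h) = ?u * entD n (nx ?x)] (mod q ^ n)"
    using ent_mult(4)[of n "nx x" h] by (simp add: cong_def)
  have "f ((nx x \<otimes>\<^bsub>Kbar p\<^esub> h) \<otimes>\<^bsub>Kbar p\<^esub> k) =
    of_int (snd (nx x \<otimes>\<^bsub>Kbar p\<^esub> h) * snd (nx ?x)) * et ?u * f (nx ?x \<otimes>\<^bsub>Kbar p\<^esub> k)"
    using hc by (intro eval_proportional_rows[OF f n_ge_1(1) _ nx_mem C D k]) simp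
  moreover have "et ?u = et (entD 1 h)"
  proof (rule et_cong)
    have "[?q = 0] (mod q)" using n_gt_1 by (simp add: cong_0_iff dvd_power)
    hence "[?q * x * ?b + ?d = 0 * x * ?b + ?d] (mod q)" by (intro cong_add cong_mult cong_refl)
    moreover have "[?d = entD 1 h] (mod q)" using ent_level(2)[OF hc n_ge_1(1)] by simp
    ultimately show "[?u = entD 1 h] (mod q)" by (simp add: cong_def)
  qed
  ultimately show ?thesis using hc k by (simp add: eta_bar_eq snd_mult K.m_assoc)
qed

section \<open>Operators given by kernels on the fibre\<close>

definition Cv :: "(int \<Rightarrow> complex) \<Rightarrow> (cov \<Rightarrow> complex) \<Rightarrow> cov \<Rightarrow> complex" where
  "Cv c = left_convolution (Kbar p) {0..<q} c nx"

lemma Cv_apply: "k \<in> carrier (Kbar p) \<Longrightarrow> Cv c f k = (\<Sum>x\<in>{0..<q}. c x * f (nx x \<otimes>\<^bsub>Kbar p\<^esub> k))"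
  by (simp add: Cv_def left_convolution_def)

lemma Cv_outside: "k \<notin> carrier (Kbar p) \<Longrightarrow> Cv c f k = 0"
  by (simp add: Cv_def left_convolution_def)

lemma Cv_intertwiner: "intertwiner (Kbar p) (right_translation (Kbar p)) V (Cv c)"
  unfolding Cv_def by (rule K.left_convolution_intertwiner) simp

lemma entA_unit:
  assumes "h \<in> K0bar p (n - 1)"
  shows "\<not> q dvd entA n h"
proof
  assume "q dvd entA n h"
  hence "q dvd entA n h * entD n h" by simp
  thus False using cong_dvd_iff[OF entD_unit(2)[OF assms n_ge_1(2) n_ge_1(1)]] q_not_dvd_1 by simp
qed

text \<open>Invariance of the kernel under unit squares absorbs the factor a^2 by which
  \<open>h\<close> moves the fibre coordinate.\<close>

lemma Cv_equivariant:
  assumes f: "equivariant n f"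
    and c: "\<And>x y. [x = y] (mod q) \<Longrightarrow> c x = c y" "\<And>a x. \<not> q dvd a \<Longrightarrow> c (a * a * x) = c x"
  shows "equivariant n (Cv c f)"
  unfolding equivariant_def
proof (intro conjI allI impI ballI)
  show "Cv c f k = 0" if "k \<notin> carrier (Kbar p)" for k using that by (rule Cv_outside)
  fix h k assume h: "h \<in> K0bar p n" and k: "k \<in> carrier (Kbar p)"
  have h': "h \<in> K0bar p (n - 1)" using h K0bar_mono by blast
  have hc: "h \<in> carrier (Kbar p)" and y: "[entC n h = q ^ (n - 1) * 0] (mod q ^ n)"
    using h by (simp_all add: K0bar_iff)
  let ?a = "entA n h"
  have a: "\<not> q dvd ?a * ?a" using entA_unit[OF h'] q_prime by (simp add: prime_dvd_mult_iff)
  have "Cv c f (h \<otimes>\<^bsub>Kbar p\<^esub> k) = (\<Sum>x\<in>{0..<q}. c x * (eta_bar eta h * f (nx (?a * ?a * x + 0) \<otimes>\<^bsub>Kbar p\<^esub> k)))"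
    using hc k nx_K0bar_mult[OF f h' k y] by (simp add: Cv_apply)
  also have "\<dots> = (\<Sum>x\<in>{0..<q}. eta_bar eta h * (c (?a * ?a * x + 0) * f (nx (?a * ?a * x + 0) \<otimes>\<^bsub>Kbar p\<^esub> k)))"
    using c(2)[OF entA_unit[OF h']] by (simp add: mult.left_commute)
  also have "\<dots> = eta_bar eta h * (\<Sum>x\<in>{0..<q}. c (?a * ?a * x + 0) * f (nx (?a * ?a * x + 0) \<otimes>\<^bsub>Kbar p\<^esub> k))"
    by (simp only: sum_distrib_left)
  also have "(\<Sum>x\<in>{0..<q}. c (?a * ?a * x + 0) * f (nx (?a * ?a * x + 0) \<otimes>\<^bsub>Kbar p\<^esub> k)) = Cv c f k"
    unfolding Cv_apply[OF k]
    by (rule sum_affine[of "\<lambda>x. c x * f (nx x \<otimes>\<^bsub>Kbar p\<^esub> k)", OF _ a])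
      (simp only: c(1) nx_cong[OF f k])
  finally show "Cv c f (h \<otimes>\<^bsub>Kbar p\<^esub> k) = eta_bar eta h * Cv c f k" .
qed

text \<open>\<open>nx\<close> turns addition into multiplication, so composing two operators
  convolves their kernels on Z/p.\<close>

lemma Cv_Cv:
  assumes f: "equivariant n f" and c': "\<And>x y. [x = y] (mod q) \<Longrightarrow> c' x = c' y"
  shows "Cv c (Cv c' f) = Cv (\<lambda>z. \<Sum>x\<in>{0..<q}. c x * c' (z - x)) f"
proof
  fix k show "Cv c (Cv c' f) k = Cv (\<lambda>z. \<Sum>x\<in>{0..<q}. c x * c' (z - x)) f k"
  proof (cases "k \<in> carrier (Kbar p)")
    case k: True
    have inner: "Cv c' f (nx x \<otimes>\<^bsub>Kbar p\<^esub> k) = (\<Sum>z\<in>{0..<q}. c' (z - x) * f (nx z \<otimes>\<^bsub>Kbar p\<^esub> k))" for x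
    proof -
      let ?F = "\<lambda>z. c' (z - x) * f (nx z \<otimes>\<^bsub>Kbar p\<^esub> k)"
      have "Cv c' f (nx x \<otimes>\<^bsub>Kbar p\<^esub> k) = (\<Sum>y\<in>{0..<q}. ?F (1 * y + x))"
        using k by (simp add: Cv_apply nx_mult flip: K.m_assoc)
      also have "\<dots> = (\<Sum>z\<in>{0..<q}. ?F z)"
      proof (rule sum_affine[OF _ q_not_dvd_1])
        fix y z assume yz: "[y = z] (mod q)"
        show "?F y = ?F z" using c'[OF cong_diff[OF yz cong_refl]] nx_cong[OF f k yz] by simp
      qed
      finally show ?thesis .
    qed
    have "Cv c (Cv c' f) k = (\<Sum>x\<in>{0..<q}. \<Sum>z\<in>{0..<q}. c x * (c' (z - x) * f (nx z \<otimes>\<^bsub>Kbar p\<^esub> k)))"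
      using k by (simp add: Cv_apply[of k c "Cv c' f"] inner sum_distrib_left)
    also have "\<dots> = (\<Sum>z\<in>{0..<q}. \<Sum>x\<in>{0..<q}. c x * (c' (z - x) * f (nx z \<otimes>\<^bsub>Kbar p\<^esub> k)))"
      by (rule sum.swap)
    also have "\<dots> = Cv (\<lambda>z. \<Sum>x\<in>{0..<q}. c x * c' (z - x)) f k"
      using k by (simp add: Cv_apply sum_distrib_right mult.assoc)
    finally show ?thesis .
  qed (simp add: Cv_outside)
qed

text \<open>\<open>A\<close> is \<open>p\<close> times the projection of I(n) onto I(n-1), as
  \<open>A_lower\<close> and \<open>A_on_lower\<close> show.\<close>

definition A :: "(cov \<Rightarrow> complex) \<Rightarrow> cov \<Rightarrow> complex" where "A = Cv (\<lambda>_. 1)"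
definition B :: "(cov \<Rightarrow> complex) \<Rightarrow> cov \<Rightarrow> complex" where "B = Cv leg"

lemma A_B: "equivariant n f \<Longrightarrow> A (B f) = 0"
  unfolding A_def B_def
  by (simp add: Cv_Cv leg_cong leg_sum_reflect) (simp add: Cv_def left_convolution_def fun_eq_iff)

lemma B_A: "equivariant n f \<Longrightarrow> B (A f) = 0"
  unfolding A_def B_def
  by (simp add: Cv_Cv leg_sum) (simp add: Cv_def left_convolution_def fun_eq_iff)

lemma A_A: "equivariant n f \<Longrightarrow> A (A f) = fscale (of_int q) (A f)"
  unfolding A_def
  by (simp add: Cv_Cv) (simp add: Cv_def left_convolution_def fun_eq_iff fscale_def sum_distrib_left)

lemma Cv_delta:
  fixes f :: "cov \<Rightarrow> complex"
  assumes "k \<in> carrier (Kbar p)"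
  shows "(\<Sum>x\<in>{0..<q}. (if q dvd x then z else 0) * f (nx x \<otimes>\<^bsub>Kbar p\<^esub> k)) = z * f k"
proof -
  have "(\<Sum>x\<in>{1..<q}. (if q dvd x then z else 0) * f (nx x \<otimes>\<^bsub>Kbar p\<^esub> k)) = 0"
    by (intro sum.neutral ballI) (auto dest: zdvd_imp_le)
  thus ?thesis unfolding split_0 using assms by (simp add: nx_0)
qed

text \<open>By \<open>leg_convolution\<close> the kernel is (-1|p) times the difference of
  \<open>p\<close> times the point mass at 0, which gives \<open>p\<close> times the identity, and
  the constant 1, which gives \<open>A\<close>.\<close>

lemma B_B:
  assumes f: "equivariant n f"
  shows "B (B f) = fscale (of_int q * leg (- 1)) f - fscale (leg (- 1)) (A f)"
proof
  fix k show "B (B f) k = (fscale (of_int q * leg (- 1)) f - fscale (leg (- 1)) (A f)) k"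
  proof (cases "k \<in> carrier (Kbar p)")
    case k: True
    have "B (B f) k = Cv (\<lambda>z. leg (- 1) * ((if q dvd z then of_int q else 0) - 1)) f k"
      unfolding B_def by (simp only: Cv_Cv[OF f leg_cong] leg_convolution)
    also have "\<dots> = leg (- 1) * ((\<Sum>x\<in>{0..<q}. (if q dvd x then of_int q else 0) * f (nx x \<otimes>\<^bsub>Kbar p\<^esub> k))
        - (\<Sum>x\<in>{0..<q}. 1 * f (nx x \<otimes>\<^bsub>Kbar p\<^esub> k)))"
      unfolding Cv_apply[OF k] sum_subtractf[symmetric] sum_distrib_left
      by (intro sum.cong refl) (simp only: algebra_simps)
    also have "\<dots> = leg (- 1) * (of_int q * f k - A f k)"
      unfolding Cv_delta[OF k] A_def Cv_apply[OF k] ..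
    finally show ?thesis by (simp add: fscale_def algebra_simps)
  next
    case False
    thus ?thesis using equivariant_outside[OF f False]
      by (simp add: A_def B_def Cv_outside fscale_def)
  qed
qed

lemma A_equivariant: "equivariant n f \<Longrightarrow> equivariant n (A f)"
  unfolding A_def by (rule Cv_equivariant) auto

lemma B_equivariant: "equivariant n f \<Longrightarrow> equivariant n (B f)"
  unfolding B_def by (rule Cv_equivariant) (auto intro: leg_cong simp: leg_mult leg_square)

lemma equivariant_lower: "equivariant (n - 1) f \<Longrightarrow> equivariant n f"
  using K0bar_mono unfolding equivariant_def by blast

text \<open>An unweighted sum over the fibre is unchanged by every affine substitution, including
  the translation by \<open>a y\<close> that elements of the larger group bring in.\<close>

lemma A_lower:
  assumes f: "equivariant n f"
  shows "equivariant (n - 1) (A f)"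
  unfolding equivariant_def
proof (intro conjI allI impI ballI)
  show "A f k = 0" if "k \<notin> carrier (Kbar p)" for k using that unfolding A_def by (rule Cv_outside)
  fix h k assume h: "h \<in> K0bar p (n - 1)" and k: "k \<in> carrier (Kbar p)"
  have hc: "h \<in> carrier (Kbar p)" and C0: "[entC (n - 1) h = 0] (mod q ^ (n - 1))"
    using h by (simp_all add: K0bar_iff)
  have "[entC n h = entC (n - 1) h] (mod q ^ (n - 1))" by (rule ent_level[OF hc]) simp
  hence "q ^ (n - 1) dvd entC n h" using C0 by (simp add: cong_def dvd_eq_mod_eq_0)
  then obtain y where "entC n h = q ^ (n - 1) * y" by (rule dvdE)
  hence y: "[entC n h = q ^ (n - 1) * y] (mod q ^ n)" by simp
  let ?a = "entA n h"
  have a: "\<not> q dvd ?a * ?a" using entA_unit[OF h] q_prime by (simp add: prime_dvd_mult_iff)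
  have "A f (h \<otimes>\<^bsub>Kbar p\<^esub> k) = eta_bar eta h * (\<Sum>x\<in>{0..<q}. f (nx (?a * ?a * x + ?a * y) \<otimes>\<^bsub>Kbar p\<^esub> k))"
    using hc k nx_K0bar_mult[OF f h k y] by (simp add: A_def Cv_apply sum_distrib_left)
  also have "(\<Sum>x\<in>{0..<q}. f (nx (?a * ?a * x + ?a * y) \<otimes>\<^bsub>Kbar p\<^esub> k)) = (\<Sum>x\<in>{0..<q}. f (nx x \<otimes>\<^bsub>Kbar p\<^esub> k))"
    by (rule sum_affine[of "\<lambda>x. f (nx x \<otimes>\<^bsub>Kbar p\<^esub> k)", OF _ a]) (rule nx_cong[OF f k])
  finally show "A f (h \<otimes>\<^bsub>Kbar p\<^esub> k) = eta_bar eta h * A f k" using k by (simp add: A_def Cv_apply)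
qed

lemma A_on_lower:
  assumes f: "equivariant (n - 1) f"
  shows "A f = fscale (of_int q) f"
proof
  fix k show "A f k = fscale (of_int q) f k"
  proof (cases "k \<in> carrier (Kbar p)")
    case True
    have "f (nx x \<otimes>\<^bsub>Kbar p\<^esub> k) = f k" for x
      using equivariant_left[OF f nx_K0bar True] eta_bar_lo by (simp add: nx_def)
    thus ?thesis using True by (simp add: A_def Cv_apply fscale_def)
  next
    case False
    thus ?thesis using equivariant_outside[OF f False] by (simp add: A_def Cv_outside fscale_def)
  qed
qed

end

section \<open>The complement \<open>J\<close> and its vectors of given type\<close>

context higher_level
begin

sublocale In: induced_rep "Kbar p" "K0bar p n" "eta_bar eta" "reps n"
  by (rule induced_rep_K0bar[OF n_ge_1(1)])

lemma In_I: "In.I = Ind p eta n"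
  by (rule I_eq_Ind[OF n_ge_1(1)])

lemma Ind_n_iff: "f \<in> Ind p eta n \<longleftrightarrow> equivariant n f"
  by (rule Ind_iff[OF n_ge_1(1)])

lemma Ind_lower_iff: "f \<in> Ind p eta (n - 1) \<longleftrightarrow> equivariant (n - 1) f"
  by (rule Ind_iff[OF n_ge_1(2)])

definition J :: "(cov \<Rightarrow> complex) set" where "J = {f \<in> Ind p eta n. A f = 0}"

lemma A_intertwiner: "intertwiner (Kbar p) In.\<rho> V A" and B_intertwiner: "intertwiner (Kbar p) In.\<rho> V B"
  unfolding A_def B_def by (rule Cv_intertwiner)+

lemma Ind_subrep: "subrep (Kbar p) In.\<rho> (Ind p eta n) (Ind p eta n)"
  using In.subrep_I unfolding In_I .

lemma J_subrep: "subrep (Kbar p) In.\<rho> (Ind p eta n) J"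
  unfolding J_def
  using subrep_trans[OF Ind_subrep subrep_kernel[OF Ind_subrep A_intertwiner right_translation_linear(3)]] .

lemma J_D: "f \<in> J \<Longrightarrow> equivariant n f" "f \<in> J \<Longrightarrow> A f = 0"
  by (simp_all add: J_def Ind_n_iff)

text \<open>The common source of vanishing: where \<open>f\<close> is constant along a fibre, its
  fibre sum is \<open>p\<close> times its value.\<close>

lemma A_constant:
  assumes A: "A f = 0" and k: "k \<in> carrier (Kbar p)"
    and c: "\<And>x. f (nx x \<otimes>\<^bsub>Kbar p\<^esub> k) = f k"
  shows "f k = 0"
proof -
  have "A f k = of_int q * f k" using k by (simp add: A_def Cv_apply c)
  thus ?thesis using A q_gt_2 by simp
qed

text \<open>The bottom row of \<open>nx x\<close> times \<open>wu d\<close> is 1 followed by d -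
  p^(n-1) x, again that of some \<open>wu\<close>, and a vector of this type is constant on
  those.\<close>

lemma type_wu_zero:
  assumes f: "equivariant n f" and A: "A f = 0" and t: "of_type In.\<rho> (K0bar p m) (eta_bar eta) f"
  shows "f (wu d) = 0"
proof (rule A_constant[OF A wu_mem])
  fix x
  let ?d = "d - q ^ (n - 1) * x"
  have "[entC n (nx x) * entA n (wu d) + entD n (nx x) * entC n (wu d) = q ^ (n - 1) * x * 0 + 1 * 1] (mod q ^ n)"
    unfolding nx_def by (intro cong_add cong_mult lo_ent wu_ent)
  hence C: "[entC n (nx x \<otimes>\<^bsub>Kbar p\<^esub> wu d) = 1 * entC n (wu ?d)] (mod q ^ n)"
    using ent_mult(3)[of n "nx x" "wu d"] wu_ent(3)[of n ?d] by (simp add: cong_def)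
  have "[entC n (nx x) * entB n (wu d) + entD n (nx x) * entD n (wu d) = q ^ (n - 1) * x * (- 1) + 1 * d] (mod q ^ n)"
    unfolding nx_def by (intro cong_add cong_mult lo_ent wu_ent)
  hence D: "[entD n (nx x \<otimes>\<^bsub>Kbar p\<^esub> wu d) = 1 * entD n (wu ?d)] (mod q ^ n)"
    using ent_mult(4)[of n "nx x" "wu d"] wu_ent(4)[of n ?d] by (simp add: cong_def)
  have "f (nx x \<otimes>\<^bsub>Kbar p\<^esub> wu d) = f (wu ?d)"
    using eval_proportional_rows_one[OF f n_ge_1(1) _ wu_mem C D] by (simp add: snd_mult et_one)
  also have "\<dots> = f (wu d)"
    using type_wu[OF n_ge_1(1) f t, of ?d] type_wu[OF n_ge_1(1) f t, of d] by simp
  finally show "f (nx x \<otimes>\<^bsub>Kbar p\<^esub> wu d) = f (wu d)" .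
qed

lemma equivariant_zeroI:
  assumes f: "equivariant n f" and lo: "\<And>c. f (lo c) = 0" and wu: "\<And>d. f (wu d) = 0"
  shows "f = 0"
proof (rule In.I_eqI)
  show "f \<in> In.I" using f unfolding In_I Ind_n_iff .
  show "0 \<in> In.I" by (rule subrepD(4)[OF In.subrep_I])
  show "f r = 0 r" if "r \<in> reps n" for r using that lo wu by (auto simp: reps_def)
qed

text \<open>\<open>nx x\<close> commutes with \<open>lo c\<close>, so moving along the fibre is
  right translation by an element of \<open>K0bar p (n - 1)\<close> with character value 1.\<close>

lemma lower_type_zero:
  assumes fJ: "f \<in> J" and t: "of_type In.\<rho> (K0bar p (n - 1)) (eta_bar eta) f"
  shows "f = 0"
proof (rule equivariant_zeroI[OF J_D(1)[OF fJ]])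
  show "f (wu d) = 0" for d by (rule type_wu_zero[OF J_D[OF fJ] t])
  show "f (lo c) = 0" for c
  proof (rule A_constant[OF J_D(2)[OF fJ] lo_mem])
    fix x
    have "nx x \<otimes>\<^bsub>Kbar p\<^esub> lo c = lo c \<otimes>\<^bsub>Kbar p\<^esub> nx x" by (simp add: nx_def lo_mult add.commute)
    thus "f (nx x \<otimes>\<^bsub>Kbar p\<^esub> lo c) = f (lo c)"
      using of_typeD[OF t nx_K0bar lo_mem] eta_bar_lo by (simp add: nx_def)
  qed
qed

lemma lo_eval_cong: "equivariant n f \<Longrightarrow> [c = c'] (mod q ^ n) \<Longrightarrow> f (lo c) = f (lo c')"
  using lo_cong[of f "\<one>\<^bsub>Kbar p\<^esub>" c c'] by simp

text \<open>Modulo \<open>p\<^sup>n\<close>, right multiplication by a torus element turns the row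
  \<open>(c, 1)\<close> into \<open>(c a, 1/a)\<close>, which represents the coset of c a^2. The
  same character factor arises from the coset and from the type, and cancels.\<close>

lemma lo_type:
  assumes f: "equivariant n f" and t: "of_type In.\<rho> (K0bar p n) (eta_bar eta) f" and a: "\<not> q dvd a"
  shows "f (lo (c * a * a)) = f (lo c)"
proof -
  \<comment> \<open>The inverse \<open>b\<close> is exact only modulo a power of \<open>p\<close>,
    so the diagonal matrix of \<open>a\<close> and \<open>b\<close> need not have determinant 1.
    Inverting modulo \<open>q ^ (n + n)\<close> lets the error be split into two off-diagonal
    entries, each zero modulo \<open>q ^ n\<close>.\<close>
  obtain b where "[a * b = 1] (mod q ^ (n + n))" using q_inverse[OF a] .
  then obtain m where "a * b - 1 = q ^ (n + n) * m" by (auto simp: cong_iff_dvd_diff)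
  hence det: "a * b - (q ^ n * m) * q ^ n = 1" by (simp add: power_add algebra_simps)
  have ab: "[a * b = 1] (mod q ^ n)" using det by (metis cong_iff_dvd_diff diff_eq_eq add_diff_cancel_left' dvd_triv_right)
  define h where "h = mat a (q ^ n * m) (q ^ n) b"
  have hc: "h \<in> carrier (Kbar p)" unfolding h_def by (rule mat_mem[OF det])
  have h: "h \<in> K0bar p n"
    using hc mat_ent(3)[of n a "q ^ n * m" "q ^ n" b] by (simp add: K0bar_iff h_def cong_def)
  have "[entC n (lo c) * entA n h + entD n (lo c) * entC n h = c * a + 1 * q ^ n] (mod q ^ n)"
    unfolding h_def by (intro cong_add cong_mult lo_ent mat_ent)
  moreover have "[b * entC n (lo (c * a * a)) = b * (c * a * a)] (mod q ^ n)"
    by (intro cong_mult lo_ent cong_refl)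
  moreover have "[(a * b) * (c * a) = 1 * (c * a)] (mod q ^ n)" by (intro cong_mult ab cong_refl)
  ultimately have C: "[entC n (lo c \<otimes>\<^bsub>Kbar p\<^esub> h) = b * entC n (lo (c * a * a))] (mod q ^ n)"
    using ent_mult(3)[of n "lo c" h] by (simp add: cong_def algebra_simps)
  have "[entC n (lo c) * entB n h + entD n (lo c) * entD n h = c * (q ^ n * m) + 1 * b] (mod q ^ n)"
    unfolding h_def by (intro cong_add cong_mult lo_ent mat_ent)
  moreover have "[c * (q ^ n * m) + 1 * b = b] (mod q ^ n)"
    by (simp add: cong_iff_dvd_diff)
  moreover have "[b * entD n (lo (c * a * a)) = b * 1] (mod q ^ n)"
    by (intro cong_mult lo_ent cong_refl)
  ultimately have D: "[entD n (lo c \<otimes>\<^bsub>Kbar p\<^esub> h) = b * entD n (lo (c * a * a))] (mod q ^ n)"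
    using ent_mult(4)[of n "lo c" h] by (simp add: cong_def)
  have "snd h = 1" by (simp add: h_def)
  hence "f (lo c \<otimes>\<^bsub>Kbar p\<^esub> h) = et b * f (lo (c * a * a))"
    using eval_proportional_rows_one[OF f n_ge_1(1) _ lo_mem C D] hc by (simp add: snd_mult)
  moreover have "f (lo c \<otimes>\<^bsub>Kbar p\<^esub> h) = et b * f (lo c)"
  proof -
    have "[entD 1 h = b] (mod q)" using mat_ent(4)[of 1 a "q ^ n * m" "q ^ n" b] by (simp add: h_def)
    hence "eta_bar eta h = et b" using \<open>snd h = 1\<close> et_cong by (simp add: eta_bar_eq)
    thus ?thesis using of_typeD[OF t h lo_mem] by simp
  qed
  moreover have "et b \<noteq> 0"
  proof -
    have "q dvd b \<Longrightarrow> q dvd 1" using cong_q_dvd[OF n_ge_1(1) ab] by simp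
    hence "et b * et b = 1" using q_not_dvd_1 et_square by blast
    thus ?thesis by auto
  qed
  ultimately show ?thesis by simp
qed

text \<open>With s = n - 1 - i, multiplying \<open>c\<close> by the square of 1 + p^s y adds 2 u y
  p^(n-1) modulo \<open>p\<^sup>n\<close>, because the quadratic term has exponent i + 2 s \<ge> n.
  As \<open>p\<close> is odd, y can be taken to be x/(2u) modulo \<open>p\<close>; the change is
  then p^(n-1) x, and \<open>lo_type\<close> makes \<open>f\<close> constant on the fibre through
  \<open>lo c\<close>.\<close>

lemma lo_shallow_zero:
  assumes f: "equivariant n f" and A: "A f = 0" and t: "of_type In.\<rho> (K0bar p n) (eta_bar eta) f"
    and c: "c = q ^ i * u" "\<not> q dvd u" "i < n - 1"
  shows "f (lo c) = 0"
proof (rule A_constant[OF A lo_mem])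
  fix x
  have "\<not> q dvd 2 * u"
    using c(2) q_prime q_gt_2 by (auto simp: prime_dvd_mult_iff dest: zdvd_imp_le)
  then obtain v where v: "[2 * u * v = 1] (mod q)" using q_inverse[of "2 * u" 1] by auto
  define s where "s = n - 1 - i"
  define y where "y = v * x"
  define a where "a = 1 + q ^ s * y"
  have s: "s \<ge> 1" "i + s = n - 1" "n \<le> i + (s + s)" using c(3) by (auto simp: s_def)
  have a: "\<not> q dvd a"
  proof
    assume "q dvd a"
    moreover have "q dvd q ^ s * y" using s(1) by (simp add: dvd_power)
    ultimately have "q dvd 1" unfolding a_def by (simp add: dvd_add_left_iff)
    thus False using q_not_dvd_1 by simp
  qed
  have "c * a * a = c + q ^ (i + s) * (2 * u * y) + q ^ (i + (s + s)) * (u * y * y)"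
    by (simp add: c(1) a_def power_add algebra_simps)
  moreover have "[c + q ^ (n - 1) * (2 * u * y) + q ^ (i + (s + s)) * (u * y * y)
      = c + q ^ (n - 1) * x + 0] (mod q ^ n)"
  proof (intro cong_add cong_refl cong_scale)
    have "[(2 * u * v) * x = 1 * x] (mod q)" by (intro cong_mult v cong_refl)
    thus "[2 * u * y = x] (mod q)" by (simp add: y_def mult.assoc)
    have "q ^ n dvd q ^ (i + (s + s)) * (u * y * y)" using s(3) by (intro dvd_mult2 le_imp_power_dvd)
    thus "[q ^ (i + (s + s)) * (u * y * y) = 0] (mod q ^ n)" by (simp add: cong_0_iff)
  qed
  ultimately have "[q ^ (n - 1) * x + c = c * a * a] (mod q ^ n)"
    using s(2) by (simp add: cong_sym add.commute)
  thus "f (nx x \<otimes>\<^bsub>Kbar p\<^esub> lo c) = f (lo c)"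
    using lo_eval_cong[OF f, of "q ^ (n - 1) * x + c" "c * a * a"] lo_type[OF f t a] by (simp add: nx_def lo_mult)
qed

lemma eigen_type_zero:
  assumes fJ: "f \<in> J" and t: "of_type In.\<rho> (K0bar p n) (eta_bar eta) f"
    and ev: "B f = fscale \<nu> f" and f1: "f \<one>\<^bsub>Kbar p\<^esub> = 0"
  shows "f = 0"
proof -
  have f: "equivariant n f" and A: "A f = 0" using J_D fJ by auto
  define h where "h x = f (nx x)" for x
  have h_cong: "h x = h y" if "[x = y] (mod q)" for x y
    using nx_cong[OF f K.one_closed that] by (simp add: h_def)
  have h_square: "h (x * a * a) = h x" if "\<not> q dvd a" for x a
    using lo_type[OF f t that, of "q ^ (n - 1) * x"] by (simp add: h_def nx_def mult.assoc)
  have h0: "h x = 0" if "q dvd x" for x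
  proof -
    have "h x = h 0" using that by (intro h_cong) (simp add: cong_0_iff)
    thus ?thesis using f1 by (simp add: h_def nx_0)
  qed
  have sumA: "(\<Sum>y\<in>{0..<q}. h y) = 0"
    using A Cv_apply[OF K.one_closed, of "\<lambda>_. 1" f] by (simp add: A_def h_def)
  have sumB: "(\<Sum>y\<in>{0..<q}. leg y * h y) = 0"
  proof -
    have "B f \<one>\<^bsub>Kbar p\<^esub> = 0" using ev f1 by (simp add: fscale_def)
    thus ?thesis using Cv_apply[OF K.one_closed, of leg f] by (simp add: B_def h_def)
  qed
  have hx: "h x = 0" for x
  proof (cases "q dvd x")
    case False
    \<comment> \<open>The weight is 2 when \<open>y\<close> lies in the square class of
      \<open>x\<close> and 0 for the other units. Summing it against \<open>h\<close> over nonzero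
      \<open>y\<close> gives (p - 1) \<open>h x\<close> on the one hand, and a combination of the
      vanishing sums \<open>sumA\<close> and \<open>sumB\<close> on the other.\<close>
    have same: "(1 + leg x * leg y) * h y = (1 + leg x * leg y) * h x" if y: "\<not> q dvd y" for y
    proof (cases "leg x = leg y")
      case True
      obtain v where v: "[x * v = 1] (mod q)" using q_inverse[OF False, of 1] by auto
      have "leg x * leg v = 1" using leg_cong[OF v] leg_mult leg_of_square[of 1] q_not_dvd_1 by simp
      hence "leg (y * v) = 1" using True by (simp add: leg_mult)
      then obtain a where a: "[a * a = y * v] (mod q)" using leg_root by blast
      have "[a * a * x = y * v * x] (mod q)" by (intro cong_mult a cong_refl)
      moreover have "[y * (x * v) = y * 1] (mod q)" by (intro cong_mult v cong_refl)
      ultimately have e: "[x * a * a = y] (mod q)" by (simp add: cong_def algebra_simps)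
      hence "\<not> q dvd a" using y cong_dvd_iff[OF e] by auto
      thus ?thesis using h_square h_cong[OF e] by simp
    next
      case neq: False
      have "leg x \<noteq> 0" "leg y \<noteq> 0" using leg_square[OF False] leg_square[OF y] by auto
      hence "leg y = - leg x" using neq leg_cases[of x] leg_cases[of y] by auto
      hence "1 + leg x * leg y = 0" using leg_square[OF False] by simp
      thus ?thesis by simp
    qed
    have "(\<Sum>y\<in>{1..<q}. (1 + leg x * leg y) * h y) = (\<Sum>y\<in>{1..<q}. (1 + leg x * leg y) * h x)"
      by (intro sum.cong refl same) (auto dest: zdvd_imp_le)
    also have "\<dots> = (\<Sum>y\<in>{1..<q}. h x) + leg x * (\<Sum>y\<in>{1..<q}. leg y) * h x"
      by (simp add: distrib_right sum.distrib sum_distrib_left sum_distrib_right)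
    also have "\<dots> = (of_int q - 1) * h x" using q_gt_2 by (simp add: leg_sum_nonzero of_nat_diff)
    finally have "(of_int q - 1) * h x = (\<Sum>y\<in>{1..<q}. (1 + leg x * leg y) * h y)" ..
    also have "\<dots> = (\<Sum>y\<in>{1..<q}. h y) + leg x * (\<Sum>y\<in>{1..<q}. leg y * h y)"
      by (simp add: distrib_right sum.distrib sum_distrib_left mult.assoc)
    also have "\<dots> = 0" using sumA sumB h0[of 0] unfolding split_0 by simp
    finally show ?thesis using q_gt_2 by auto
  qed (rule h0)
  show ?thesis
  proof (rule equivariant_zeroI[OF f])
    show "f (wu d) = 0" for d by (rule type_wu_zero[OF f A t])
    show "f (lo c) = 0" for c
    \<comment> \<open>Either \<open>lo c\<close> lies in the fibre of the identity, where
      \<open>hx\<close> applies, or \<open>c\<close> has valuation below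
      \<open>n - 1\<close>.\<close>
    proof (cases "q ^ (n - 1) dvd c")
      case True
      then obtain x where "c = q ^ (n - 1) * x" by (rule dvdE)
      thus ?thesis using hx[of x] by (simp add: h_def nx_def)
    next
      case False
      hence "c \<noteq> 0" by auto
      moreover have "\<not> is_unit q" using q_prime not_prime_unit by blast
      ultimately obtain u where u: "c = q ^ multiplicity q c * u" "\<not> q dvd u"
        using multiplicity_decompose'[of c q] by blast
      have "multiplicity q c < n - 1"
      proof (rule ccontr)
        assume "\<not> ?thesis"
        hence "q ^ (n - 1) dvd q ^ multiplicity q c" by (intro le_imp_power_dvd) simp
        thus False using False u(1) by (metis dvd_mult2)
      qed
      thus ?thesis by (rule lo_shallow_zero[OF f A t u])
    qed
  qed
qed

text \<open>By \<open>A_A\<close>, \<open>A\<close> divided by \<open>p\<close> is idempotent, so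
  this is the projection onto \<open>J\<close> along I(n-1). It is unrelated to the eigenspaces that
  bear the same name in \<open>split_rep\<close>.\<close>

definition E :: "(cov \<Rightarrow> complex) \<Rightarrow> cov \<Rightarrow> complex" where "E f = f - fscale (1 / of_int q) (A f)"

lemma E_intertwiner: "intertwiner (Kbar p) In.\<rho> V E"
  unfolding intertwiner_def
proof (intro conjI ballI allI)
  fix u v :: "cov \<Rightarrow> complex" and c g assume V: "u \<in> V" "v \<in> V"
  show "E (u + v) = E u + E v"
    unfolding E_def intertwinerD(1)[OF A_intertwiner V] by (simp add: fun_space.scale_right_distrib)
next
  fix v :: "cov \<Rightarrow> complex" and c assume "v \<in> V"
  thus "E (fscale c v) = fscale c (E v)"
    unfolding E_def intertwinerD(2)[OF A_intertwiner \<open>v \<in> V\<close>]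
    by (simp only: fun_space.scale_right_diff_distrib fun_space.scale_left_commute)
next
  fix v :: "cov \<Rightarrow> complex" and g assume g: "g \<in> carrier (Kbar p)" "v \<in> V"
  thus "E (In.\<rho> g v) = In.\<rho> g (E v)"
    unfolding E_def by (simp only: intertwinerD(3)[OF A_intertwiner g] right_translation_linear right_translation_diff)
qed

lemma q_inverse_scale: "fscale (1 / of_int q) (fscale (of_int q) f) = f"
  using q_gt_2 by (simp add: fscale_def fun_eq_iff)

lemma E_J: "f \<in> Ind p eta n \<Longrightarrow> E f \<in> J"
proof -
  assume f: "f \<in> Ind p eta n"
  have eq: "equivariant n f" using f unfolding Ind_n_iff .
  have Af: "A f \<in> Ind p eta n" using A_equivariant[OF eq] unfolding Ind_n_iff .
  have sA: "fscale (1 / of_int q) (A f) \<in> Ind p eta n" using Af by (rule subrepD(7)[OF Ind_subrep])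
  have "A (E f) = A f - fscale (1 / of_int q) (A (A f))"
    unfolding E_def intertwiner_diff[OF Ind_subrep A_intertwiner f sA]
      intertwinerD(2)[OF A_intertwiner[of "Ind p eta n"] Af] ..
  also have "\<dots> = 0" unfolding A_A[OF eq] q_inverse_scale by simp
  finally show ?thesis unfolding J_def E_def using subrepD(6)[OF Ind_subrep f sA] by simp
qed

lemma E_on_J: "f \<in> J \<Longrightarrow> E f = f"
  using J_D(2)[of f] by (simp add: E_def fun_space.scale_zero_right)

text \<open>For 0 < x < p the element \<open>nx x\<close> lies outside \<open>K0bar p n\<close>, the
  support of \<open>\<delta>\<close>, so only the term at 0 survives.\<close>

lemma Cv_\<delta>_one: "Cv c In.\<delta> \<one>\<^bsub>Kbar p\<^esub> = c 0"
proof -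
  have "nx x \<notin> K0bar p n" if x: "x \<in> {1..<q}" for x
  proof
    assume "nx x \<in> K0bar p n"
    hence "[entC n (nx x) = 0] (mod q ^ n)" by (simp add: K0bar_iff)
    hence "q ^ (n - 1) * q dvd q ^ (n - 1) * x"
      using lo_ent(3)[of n "q ^ (n - 1) * x"] unfolding nx_def q_pow_n[symmetric]
      by (simp add: cong_def dvd_eq_mod_eq_0)
    hence "q dvd x" using q_gt_2 by simp
    thus False using x by (auto dest: zdvd_imp_le)
  qed
  hence "(\<Sum>x\<in>{1..<q}. c x * In.\<delta> (nx x)) = 0" by (intro sum.neutral) (simp add: In.\<delta>_def)
  thus ?thesis unfolding Cv_apply[OF K.one_closed] split_0 by (simp add: nx_0 In.\<delta>_one)
qed

lemma level_n_split:
  assumes l: "l * l = of_int q * leg (- 1)"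
  shows "split_rep (Kbar p) (K0bar p n) (eta_bar eta) (reps n) J B l (- l) (E In.\<delta>)"
proof -
  have "\<not> q dvd - 1" using q_not_dvd_1 by simp
  hence "leg (- 1) * leg (- 1) = 1" by (rule leg_square)
  hence "leg (- 1) \<noteq> 0" by auto
  hence "l * l \<noteq> 0" unfolding l using q_gt_2 by simp
  hence l0: "l \<noteq> 0" by simp
  have \<delta>: "In.\<delta> \<in> Ind p eta n" using In.\<delta>_I unfolding In_I .
  have eq\<delta>: "equivariant n In.\<delta>" using \<delta> unfolding Ind_n_iff .
  show ?thesis
  proof (intro split_rep.intro split_rep_axioms.intro)
    show "induced_rep (Kbar p) (K0bar p n) (eta_bar eta) (reps n)" by unfold_locales
    show "subrep (Kbar p) In.\<rho> In.I J" unfolding In_I by (rule J_subrep)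
    show "intertwiner (Kbar p) In.\<rho> J B" by (rule B_intertwiner)
    show "B f \<in> J" if "f \<in> J" for f
      using A_B[OF J_D(1)[OF that]] B_equivariant[OF J_D(1)[OF that]] by (simp add: J_def Ind_n_iff)
    show "B (B f) = fscale (l + - l) (B f) - fscale (l * - l) f" if "f \<in> J" for f
      unfolding B_B[OF J_D(1)[OF that]] J_D(2)[OF that]
      by (simp add: l fscale_def fun_eq_iff)
    show "E In.\<delta> \<in> J" by (rule E_J[OF \<delta>])
    show "of_type In.\<rho> (K0bar p n) (eta_bar eta) (E In.\<delta>)"
      unfolding of_type_def
    proof
      fix h assume h: "h \<in> K0bar p n"
      hence hc: "h \<in> carrier (Kbar p)" by (simp add: K0bar_iff)
      have "In.\<rho> h (E In.\<delta>) = E (In.\<rho> h In.\<delta>)" using intertwinerD(3)[OF E_intertwiner hc \<delta>] ..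
      also have "In.\<rho> h In.\<delta> = fscale (eta_bar eta h) In.\<delta>" using In.of_type_\<delta> h by (simp add: of_type_def)
      also have "E \<dots> = fscale (eta_bar eta h) (E In.\<delta>)" by (rule intertwinerD(2)[OF E_intertwiner \<delta>])
      finally show "In.\<rho> h (E In.\<delta>) = fscale (eta_bar eta h) (E In.\<delta>)" .
    qed
    \<comment> \<open>The value is 1 - 1/p.\<close>
    show "E In.\<delta> \<one>\<^bsub>Kbar p\<^esub> \<noteq> 0"
      using q_gt_2 Cv_\<delta>_one[of "\<lambda>_. 1"] by (simp add: E_def A_def fscale_def In.\<delta>_one)
    \<comment> \<open>Since \<open>B\<close> annihilates the image of \<open>A\<close>, projecting
      \<open>\<delta>\<close> to \<open>J\<close> does not change its image under \<open>B\<close>;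
      the Legendre symbol vanishes at 0.\<close>
    show "B (E In.\<delta>) \<one>\<^bsub>Kbar p\<^esub> = 0"
    proof -
      have Af: "A In.\<delta> \<in> Ind p eta n" using A_equivariant[OF eq\<delta>] unfolding Ind_n_iff .
      have sA: "fscale (1 / of_int q) (A In.\<delta>) \<in> Ind p eta n" using Af by (rule subrepD(7)[OF Ind_subrep])
      have "B (E In.\<delta>) = B In.\<delta> - fscale (1 / of_int q) (B (A In.\<delta>))"
        unfolding E_def intertwiner_diff[OF Ind_subrep B_intertwiner \<delta> sA]
          intertwinerD(2)[OF B_intertwiner[of "Ind p eta n"] Af] ..
      hence "B (E In.\<delta>) = B In.\<delta>" unfolding B_A[OF eq\<delta>] by (simp add: fun_space.scale_zero_right)
      thus ?thesis unfolding B_def by (simp add: Cv_\<delta>_one leg_zero)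
    qed
    show "U = J" if U: "subrep (Kbar p) In.\<rho> J U" and d: "E In.\<delta> \<in> U" for U
    proof -
      \<comment> \<open>Generation is inherited from I(n): the pullback of \<open>U\<close> along
        the projection contains \<open>\<delta>\<close>.\<close>
      let ?U = "{f \<in> Ind p eta n. E f \<in> U}"
      have "subrep (Kbar p) In.\<rho> (Ind p eta n) ?U"
      proof -
        have "fun_space.subspace ?U"
          using subrepD[OF Ind_subrep] subrepD[OF U] intertwinerD[OF E_intertwiner[of "Ind p eta n"]]
            intertwiner_zero[OF Ind_subrep E_intertwiner]
          by (auto simp: fun_space.subspace_def)
        thus ?thesis
          using subrepD(3)[OF Ind_subrep] subrepD(3)[OF U] intertwinerD(3)[OF E_intertwiner[of "Ind p eta n"]]
          by (auto simp: subrep_def)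
      qed
      hence *: "?U = Ind p eta n" using In.\<delta>_generates \<delta> d unfolding In_I by blast
      have "f \<in> U" if f: "f \<in> J" for f
      proof -
        have "f \<in> ?U" unfolding * using f by (simp add: J_def)
        thus ?thesis using E_on_J[OF f] by simp
      qed
      thus "U = J" by (intro equalityI subsetI) (simp_all add: subrepD(1)[OF U])
    qed
    show "f = 0" if "f \<in> J" "of_type In.\<rho> (K0bar p n) (eta_bar eta) f" "B f = fscale \<nu> f"
      "f \<one>\<^bsub>Kbar p\<^esub> = 0" for f \<nu> using eigen_type_zero that by blast
  qed (use l0 in auto)
qed

end

section \<open>The constituents\<close>

context quadratic_character
begin

lemma dim_Ind:
  assumes "n \<ge> 1"
  shows "fun_space.dim (Ind p eta n) = p ^ (n - 1) * (p + 1)"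
  using induced_rep.dim_I[OF induced_rep_K0bar[OF assms]] card_reps[OF assms]
  by (simp add: I_eq_Ind[OF assms])

end

context higher_level
begin

lemma Ind_lower_subset: "Ind p eta (n - 1) \<subseteq> Ind p eta n"
proof
  fix f assume "f \<in> Ind p eta (n - 1)"
  thus "f \<in> Ind p eta n" unfolding Ind_lower_iff Ind_n_iff by (rule equivariant_lower)
qed

lemma Ind_lower_subrep: "subrep (Kbar p) In.\<rho> (Ind p eta (n - 1)) (Ind p eta (n - 1))"
  using induced_rep.subrep_I[OF induced_rep_K0bar[OF n_ge_1(2)]] unfolding I_eq_Ind[OF n_ge_1(2)] .

lemma lower_J_zero:
  assumes "f \<in> Ind p eta (n - 1)" "f \<in> J"
  shows "f = 0"
proof -
  have "equivariant (n - 1) f" using assms(1) unfolding Ind_lower_iff .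
  hence "fscale (of_int q) f = 0" using A_on_lower[of f] unfolding J_D(2)[OF assms(2)] by simp
  thus ?thesis using q_gt_2 by simp
qed

text \<open>I(n) is the direct sum of I(n-1) and \<open>J\<close>, and the two coset counts differ
  by p^(n-2) (p + 1)(p - 1).\<close>

lemma dim_J: "fun_space.dim J = p ^ (n - 2) * (p ^ 2 - 1)"
proof -
  have sum: "Ind p eta n = {x + y |x y. x \<in> Ind p eta (n - 1) \<and> y \<in> J}"
  proof (intro equalityI subsetI)
    fix f assume f: "f \<in> Ind p eta n"
    have "A f \<in> Ind p eta (n - 1)" using f unfolding Ind_n_iff Ind_lower_iff by (rule A_lower)
    hence "fscale (1 / of_int q) (A f) \<in> Ind p eta (n - 1)" by (rule subrepD(7)[OF Ind_lower_subrep])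
    moreover have "f = fscale (1 / of_int q) (A f) + E f" by (simp add: E_def)
    ultimately show "f \<in> {x + y |x y. x \<in> Ind p eta (n - 1) \<and> y \<in> J}" using E_J[OF f] by blast
  next
    fix f assume "f \<in> {x + y |x y. x \<in> Ind p eta (n - 1) \<and> y \<in> J}"
    then obtain x y where xy: "f = x + y" "x \<in> Ind p eta (n - 1)" "y \<in> J" by blast
    have "x \<in> Ind p eta n" using xy(2) Ind_lower_subset by (rule subsetD[rotated])
    moreover have "y \<in> Ind p eta n" using xy(3) by (simp add: J_def)
    ultimately show "f \<in> Ind p eta n" unfolding xy(1) by (rule subrepD(5)[OF Ind_subrep])
  qed
  have int: "Ind p eta (n - 1) \<inter> J = {0}"
  proof (intro equalityI subsetI)
    fix f assume "f \<in> Ind p eta (n - 1) \<inter> J"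
    thus "f \<in> {0}" using lower_J_zero[of f] by simp
  next
    fix f :: "cov \<Rightarrow> complex" assume "f \<in> {0}"
    thus "f \<in> Ind p eta (n - 1) \<inter> J"
      using subrepD(4)[OF Ind_lower_subrep] subrepD(4)[OF J_subrep] by simp
  qed
  have "fun_space.dim {x + y |x y. x \<in> Ind p eta (n - 1) \<and> y \<in> J} =
      fun_space.dim (Ind p eta (n - 1)) + fun_space.dim J"
  proof (rule dim_direct_sum[OF subrepD(2)[OF Ind_lower_subrep] subrepD(2)[OF J_subrep] int])
    show "finite ((\<lambda>r. In.\<rho> (inv\<^bsub>Kbar p\<^esub> r) In.\<delta>) ` reps n)" using finite_reps by simp
    show "{x + y |x y. x \<in> Ind p eta (n - 1) \<and> y \<in> J} \<subseteq>
        fun_space.span ((\<lambda>r. In.\<rho> (inv\<^bsub>Kbar p\<^esub> r) In.\<delta>) ` reps n)"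
      unfolding sum[symmetric] using In.I_finite_span unfolding In_I .
  qed
  hence dims: "p ^ (n - 1) * (p + 1) = p ^ (n - 1 - 1) * (p + 1) + fun_space.dim J"
    unfolding sum[symmetric] dim_Ind[OF n_ge_1(1)] dim_Ind[OF n_ge_1(2)] .
  obtain m where m: "n = Suc (Suc m)" using that[of "n - 2"] n_gt_1 by simp
  have "p * p - 1 + (p + 1) = p * p + p" using prime_ge_1_nat[OF p_prime] by (cases p) auto
  hence "p ^ m * (p * p - 1) + p ^ m * (p + 1) = p ^ m * (p * p + p)" by (metis distrib_left)
  also have "\<dots> = p ^ (n - 1) * (p + 1)" by (simp add: m algebra_simps)
  also have "\<dots> = fun_space.dim J + p ^ m * (p + 1)" using dims by (simp only: m diff_Suc_1 add.commute)
  finally show ?thesis by (simp add: m power2_eq_square)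
qed

text \<open>An embedding into I(n-1), viewed inside I(n), would be a scalar, so its image would lie
  in both \<open>J\<close> and I(n-1), which meet in 0. The eigenvalues are left general so that
  both eigenspaces are covered through \<open>split_rep_swap\<close>.\<close>

lemma component:
  assumes "split_rep (Kbar p) (K0bar p n) (eta_bar eta) (reps n) J B l m d"
  shows "\<not> occurs_in (Kbar p) In.\<rho> (split_rep.E J B l) (Ind p eta (n - 1))"
    and "\<exists>v\<in>split_rep.E J B l. v \<noteq> 0 \<and> of_type In.\<rho> (K0bar p n) (eta_bar eta) v \<and>
      (\<forall>w\<in>split_rep.E J B l. of_type In.\<rho> (K0bar p n) (eta_bar eta) w \<longrightarrow> (\<exists>c. w = fscale c v))"
    and "\<not> (\<exists>v\<in>split_rep.E J B l. v \<noteq> 0 \<and> of_type In.\<rho> (K0bar p (n - 1)) (eta_bar eta) v)"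
proof -
  interpret S: split_rep "Kbar p" "K0bar p n" "eta_bar eta" "reps n" J B l m d by (rule assms)
  have e: "S.P m d \<in> S.E l" by (rule S.P_E[OF S.d_V])
  show "\<not> occurs_in (Kbar p) In.\<rho> (S.E l) (Ind p eta (n - 1))"
  proof
    assume "occurs_in (Kbar p) In.\<rho> (S.E l) (Ind p eta (n - 1))"
    then obtain U T where U: "subrep (Kbar p) In.\<rho> (Ind p eta (n - 1)) U"
      and T: "bij_betw T (S.E l) U" "intertwiner (Kbar p) In.\<rho> (S.E l) T"
      by (auto simp: occurs_in_def rep_iso_iff)
    have im: "T ` S.E l = U" using T(1) by (simp add: bij_betw_def)
    have UI: "U \<subseteq> Ind p eta (n - 1)" using U by (simp add: subrep_def)
    hence "T ` S.E l \<subseteq> In.I" unfolding im In_I using Ind_lower_subset by (rule subset_trans)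
    then obtain c where c: "\<And>f. f \<in> S.E l \<Longrightarrow> T f = fscale c f"
      using S.E_intertwiner_scalar[OF T(2)] by blast
    have "T (S.P m d) \<in> U" unfolding im[symmetric] using e by (rule imageI)
    hence 1: "T (S.P m d) \<in> Ind p eta (n - 1)" using UI by (rule subsetD[rotated])
    have 2: "T (S.P m d) \<in> J"
      unfolding c[OF e] by (rule subrepD(7)[OF J_subrep subrepD(1)[OF S.E_subrep e]])
    have T0: "T (S.P m d) = T 0"
      using lower_J_zero[OF 1 2] intertwiner_zero[OF S.E_subrep T(2)] by simp
    have "inj_on T (S.E l)" using T(1) by (simp add: bij_betw_def)
    hence "S.P m d = 0" by (rule inj_onD[OF _ T0 e subrepD(4)[OF S.E_subrep]])
    thus False using S.P_d_nonzero by simp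
  qed
  have "w = fscale (w \<one>\<^bsub>Kbar p\<^esub> / S.P m d \<one>\<^bsub>Kbar p\<^esub>) (S.P m d)"
    if "w \<in> S.E l" "of_type In.\<rho> (K0bar p n) (eta_bar eta) w" for w
    using that by (rule S.E_type_unique)
  hence "\<forall>w\<in>S.E l. of_type In.\<rho> (K0bar p n) (eta_bar eta) w \<longrightarrow> (\<exists>c. w = fscale c (S.P m d))"
    by (intro ballI impI exI)
  thus "\<exists>v\<in>S.E l. v \<noteq> 0 \<and> of_type In.\<rho> (K0bar p n) (eta_bar eta) v \<and>
      (\<forall>w\<in>S.E l. of_type In.\<rho> (K0bar p n) (eta_bar eta) w \<longrightarrow> (\<exists>c. w = fscale c v))"
    by (intro bexI[OF _ e] conjI S.P_d_nonzero S.of_type_P_d)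
  show "\<not> (\<exists>v\<in>S.E l. v \<noteq> 0 \<and> of_type In.\<rho> (K0bar p (n - 1)) (eta_bar eta) v)"
  proof
    assume "\<exists>v\<in>S.E l. v \<noteq> 0 \<and> of_type In.\<rho> (K0bar p (n - 1)) (eta_bar eta) v"
    then obtain v where v: "v \<in> S.E l" "v \<noteq> 0" "of_type In.\<rho> (K0bar p (n - 1)) (eta_bar eta) v"
      by blast
    show False using v(2) lower_type_zero[OF subrepD(1)[OF S.E_subrep v(1)] v(3)] by simp
  qed
qed

text \<open>\<open>A\<close> maps \<open>W\<close> into I(n-1). By Schur's lemma it is either
  injective on \<open>W\<close>, which would make \<open>W\<close> occur there, or zero, which puts
  \<open>W\<close> inside \<open>J\<close>.\<close>

lemma new_constituents:
  "{W \<in> constituents (Kbar p) In.\<rho> (Ind p eta n). \<not> occurs_in (Kbar p) In.\<rho> W (Ind p eta (n - 1))}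
    \<subseteq> constituents (Kbar p) In.\<rho> J"
proof
  fix W assume "W \<in> {W \<in> constituents (Kbar p) In.\<rho> (Ind p eta n).
    \<not> occurs_in (Kbar p) In.\<rho> W (Ind p eta (n - 1))}"
  hence W: "subrep (Kbar p) In.\<rho> (Ind p eta n) W" and irr: "irreducible_rep (Kbar p) In.\<rho> W"
    and no: "\<not> occurs_in (Kbar p) In.\<rho> W (Ind p eta (n - 1))" by (simp_all add: constituents_def)
  have "\<not> inj_on A W"
  proof
    assume "inj_on A W"
    hence "rep_iso (Kbar p) In.\<rho> W (A ` W)"
      unfolding rep_iso_iff using A_intertwiner by (intro exI[of _ A]) (simp add: bij_betw_def)
    moreover have "A ` W \<subseteq> Ind p eta (n - 1)"
    proof (rule image_subsetI)
      fix f assume "f \<in> W"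
      hence "equivariant n f" unfolding Ind_n_iff[symmetric] by (rule subrepD(1)[OF W])
      thus "A f \<in> Ind p eta (n - 1)" unfolding Ind_lower_iff by (rule A_lower)
    qed
    hence "subrep (Kbar p) In.\<rho> (Ind p eta (n - 1)) (A ` W)"
      by (rule subrep_weaken[OF subrep_image[OF W A_intertwiner]])
    ultimately show False using no unfolding occurs_in_def by blast
  qed
  hence "\<forall>w\<in>W. A w = 0"
    using schur_injective[OF irr A_intertwiner right_translation_linear(3)] by blast
  hence "W \<subseteq> J" using subrepD(1)[OF W] by (auto simp: J_def)
  thus "W \<in> constituents (Kbar p) In.\<rho> J"
    using subrep_weaken[OF W] irr by (simp add: constituents_def)
qed

lemma level_n:
  "\<exists>\<sigma> \<sigma>'.
    {W \<in> constituents (Kbar p) In.\<rho> (Ind p eta n).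
       \<not> occurs_in (Kbar p) In.\<rho> W (Ind p eta (n - 1))} = {\<sigma>, \<sigma>'} \<and>
    \<not> rep_iso (Kbar p) In.\<rho> \<sigma> \<sigma>' \<and>
    (\<forall>\<tau>\<in>{\<sigma>, \<sigma>'}.
       (\<exists>v\<in>\<tau>. v \<noteq> 0 \<and> of_type In.\<rho> (K0bar p n) (eta_bar eta) v \<and>
          (\<forall>w\<in>\<tau>. of_type In.\<rho> (K0bar p n) (eta_bar eta) w \<longrightarrow> (\<exists>c. w = fscale c v))) \<and>
       \<not> (\<exists>v\<in>\<tau>. v \<noteq> 0 \<and> of_type In.\<rho> (K0bar p (n - 1)) (eta_bar eta) v)) \<and>
    fun_space.dim \<sigma> + fun_space.dim \<sigma>' = p ^ (n - 2) * (p ^ 2 - 1)"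
proof -
  define l where "l = csqrt (of_int q * leg (- 1))"
  have "l * l = of_int q * leg (- 1)" unfolding l_def by (simp flip: power2_eq_square)
  hence split: "split_rep (Kbar p) (K0bar p n) (eta_bar eta) (reps n) J B l (- l) (E In.\<delta>)"
    by (rule level_n_split)
  interpret S: split_rep "Kbar p" "K0bar p n" "eta_bar eta" "reps n" J B l "- l" "E In.\<delta>"
    by (rule split)
  note c1 = component[OF split] and c2 = component[OF S.split_rep_swap]
  have eq: "{W \<in> constituents (Kbar p) In.\<rho> (Ind p eta n).
       \<not> occurs_in (Kbar p) In.\<rho> W (Ind p eta (n - 1))} = {S.E l, S.E (- l)}"
  proof (rule equalityI)
    show "{W \<in> constituents (Kbar p) In.\<rho> (Ind p eta n).
       \<not> occurs_in (Kbar p) In.\<rho> W (Ind p eta (n - 1))} \<subseteq> {S.E l, S.E (- l)}"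
      using new_constituents unfolding S.constituents_V .
    have "W \<in> constituents (Kbar p) In.\<rho> (Ind p eta n)" if "W \<in> {S.E l, S.E (- l)}" for W
      using that subrep_trans[OF J_subrep] unfolding S.constituents_V[symmetric] constituents_def
      by simp
    thus "{S.E l, S.E (- l)} \<subseteq> {W \<in> constituents (Kbar p) In.\<rho> (Ind p eta n).
       \<not> occurs_in (Kbar p) In.\<rho> W (Ind p eta (n - 1))}"
      using c1(1) c2(1) by simp
  qed
  have dims: "fun_space.dim (S.E l) + fun_space.dim (S.E (- l)) = p ^ (n - 2) * (p ^ 2 - 1)"
    using dim_J S.dim_V by simp
  show ?thesis
  proof (rule exI[of _ "S.E l"], rule exI[of _ "S.E (- l)"], intro conjI eq S.E_not_iso dims ballI)
    fix \<tau> assume "\<tau> \<in> {S.E l, S.E (- l)}"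
    then consider "\<tau> = S.E l" | "\<tau> = S.E (- l)" by blast
    thus "\<exists>v\<in>\<tau>. v \<noteq> 0 \<and> of_type In.\<rho> (K0bar p n) (eta_bar eta) v \<and>
          (\<forall>w\<in>\<tau>. of_type In.\<rho> (K0bar p n) (eta_bar eta) w \<longrightarrow> (\<exists>c. w = fscale c v))"
      by cases (simp_all only: c1(2) c2(2))
    from \<open>\<tau> \<in> {S.E l, S.E (- l)}\<close> consider "\<tau> = S.E l" | "\<tau> = S.E (- l)" by blast
    thus "\<not> (\<exists>v\<in>\<tau>. v \<noteq> 0 \<and> of_type In.\<rho> (K0bar p (n - 1)) (eta_bar eta) v)"
      by cases (use c1(3) c2(3) in \<open>simp_all only: not_False_eq_True\<close>)
  qed
qed

end

context quadratic_character
begin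

lemma level_1:
  assumes "l + m = (\<Sum>y\<in>{1..<q}. et y)" "l * m = - (of_int q * et (- 1))" "l \<noteq> m"
  shows "\<exists>\<sigma> \<sigma>'.
    constituents (Kbar p) (right_translation (Kbar p)) (Ind p eta 1) = {\<sigma>, \<sigma>'} \<and>
    \<not> rep_iso (Kbar p) (right_translation (Kbar p)) \<sigma> \<sigma>' \<and>
    fun_space.dim \<sigma> + fun_space.dim \<sigma>' = p + 1"
proof -
  interpret S: split_rep "Kbar p" "K0bar p 1" "eta_bar eta" "reps 1" "Ind p eta 1" M l m
    "induced_rep.\<delta> (K0bar p 1) (eta_bar eta)" by (rule level_1_split[OF assms])
  have "fun_space.dim (S.E l) + fun_space.dim (S.E m) = p + 1"
    using S.dim_V dim_Ind[of 1] by simp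
  thus ?thesis using S.constituents_V S.E_not_iso by blast
qed

text \<open>The assumptions on \<open>l\<close> and \<open>m\<close> describe the eigenvalues of
  level one, where the two characters differ; at higher level they are the square roots of (-1|p) p
  for both.\<close>

lemma classification:
  assumes "l + m = (\<Sum>y\<in>{1..<q}. et y)" "l * m = - (of_int q * et (- 1))" "l \<noteq> m"
  shows "(\<forall>n>1. \<exists>\<sigma> \<sigma>'.
        {W \<in> constituents (Kbar p) (rtrans p) (Ind p eta n).
           \<not> occurs_in (Kbar p) (rtrans p) W (Ind p eta (n - 1))} = {\<sigma>, \<sigma>'} \<and>
        \<not> rep_iso (Kbar p) (rtrans p) \<sigma> \<sigma>' \<and>
        (\<forall>\<tau>\<in>{\<sigma>, \<sigma>'}.
           (\<exists>v\<in>\<tau>. v \<noteq> 0 \<and> of_type (rtrans p) (K0bar p n) (eta_bar eta) v \<and>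
              (\<forall>w\<in>\<tau>. of_type (rtrans p) (K0bar p n) (eta_bar eta) w \<longrightarrow>
                 (\<exists>c. w = fscale c v))) \<and>
           \<not> (\<exists>v\<in>\<tau>. v \<noteq> 0 \<and> of_type (rtrans p) (K0bar p (n - 1)) (eta_bar eta) v)) \<and>
        fun_space.dim \<sigma> + fun_space.dim \<sigma>' = p ^ (n - 2) * (p ^ 2 - 1)) \<and>
     (\<exists>\<sigma> \<sigma>'.
        constituents (Kbar p) (rtrans p) (Ind p eta 1) = {\<sigma>, \<sigma>'} \<and>
        \<not> rep_iso (Kbar p) (rtrans p) \<sigma> \<sigma>' \<and>
        fun_space.dim \<sigma> + fun_space.dim \<sigma>' = p + 1)"
  unfolding rtrans_eq
proof (intro conjI allI impI)
  fix n :: nat assume "n > 1"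
  then interpret higher_level p eta et n by unfold_locales
  show "\<exists>\<sigma> \<sigma>'.
    {W \<in> constituents (Kbar p) In.\<rho> (Ind p eta n).
       \<not> occurs_in (Kbar p) In.\<rho> W (Ind p eta (n - 1))} = {\<sigma>, \<sigma>'} \<and>
    \<not> rep_iso (Kbar p) In.\<rho> \<sigma> \<sigma>' \<and>
    (\<forall>\<tau>\<in>{\<sigma>, \<sigma>'}.
       (\<exists>v\<in>\<tau>. v \<noteq> 0 \<and> of_type In.\<rho> (K0bar p n) (eta_bar eta) v \<and>
          (\<forall>w\<in>\<tau>. of_type In.\<rho> (K0bar p n) (eta_bar eta) w \<longrightarrow> (\<exists>c. w = fscale c v))) \<and>
       \<not> (\<exists>v\<in>\<tau>. v \<noteq> 0 \<and> of_type In.\<rho> (K0bar p (n - 1)) (eta_bar eta) v)) \<and>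
    fun_space.dim \<sigma> + fun_space.dim \<sigma>' = p ^ (n - 2) * (p ^ 2 - 1)" by (rule level_n)
qed (rule level_1[OF assms])

end

theorem corollary3p8:
  fixes p :: nat and eta :: "padic \<Rightarrow> complex"
  assumes "prime p" and "odd p"
    and "eta = (\<lambda>_. 1) \<or> eta = legendre_char p"
  shows
    "(\<forall>n>1. \<exists>\<sigma> \<sigma>'.
        {W \<in> constituents (Kbar p) (rtrans p) (Ind p eta n).
           \<not> occurs_in (Kbar p) (rtrans p) W (Ind p eta (n - 1))} = {\<sigma>, \<sigma>'} \<and>
        \<not> rep_iso (Kbar p) (rtrans p) \<sigma> \<sigma>' \<and>
        (\<forall>\<tau>\<in>{\<sigma>, \<sigma>'}.
           (\<exists>v\<in>\<tau>. v \<noteq> 0 \<and> of_type (rtrans p) (K0bar p n) (eta_bar eta) v \<and>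
              (\<forall>w\<in>\<tau>. of_type (rtrans p) (K0bar p n) (eta_bar eta) w \<longrightarrow>
                 (\<exists>c. w = fscale c v))) \<and>
           \<not> (\<exists>v\<in>\<tau>. v \<noteq> 0 \<and> of_type (rtrans p) (K0bar p (n - 1)) (eta_bar eta) v)) \<and>
        fun_space.dim \<sigma> + fun_space.dim \<sigma>' = p ^ (n - 2) * (p ^ 2 - 1)) \<and>
     (\<exists>\<sigma> \<sigma>'.
        constituents (Kbar p) (rtrans p) (Ind p eta 1) = {\<sigma>, \<sigma>'} \<and>
        \<not> rep_iso (Kbar p) (rtrans p) \<sigma> \<sigma>' \<and>
        fun_space.dim \<sigma> + fun_space.dim \<sigma>' = p + 1)"
  using assms(3)
proof
  interpret odd_prime p using assms by unfold_locales
  assume eta: "eta = (\<lambda>_. 1)"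
  interpret quadratic_character p eta "\<lambda>_. 1" by unfold_locales (simp_all add: eta)
  show ?thesis
  proof (rule classification)
    \<comment> \<open>For the trivial character the quadratic of \<open>M\<close> has roots
      \<open>q\<close> and -1; \<open>q\<close> is the eigenvalue on the function sending a group
      element to its sign.\<close>
    show "of_int q + - 1 = (\<Sum>y\<in>{1..<q}. 1 :: complex)" using q_gt_2 by (simp add: of_nat_diff)
    have "q \<noteq> - 1" using q_gt_2 by simp
    thus "of_int q \<noteq> (- 1 :: complex)" by (metis of_int_eq_iff of_int_minus of_int_1)
  qed simp
next
  interpret odd_prime p using assms by unfold_locales
  assume eta: "eta = legendre_char p"
  interpret quadratic_character p eta leg
    using leg_cong leg_mult leg_square by unfold_locales (simp_all add: eta legendre_char_def leg_def)
  define l where "l = csqrt (of_int q * leg (- 1))"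
  have l: "l * l = of_int q * leg (- 1)" unfolding l_def by (simp flip: power2_eq_square)
  have "\<not> q dvd - 1" using q_not_dvd_1 by simp
  hence "leg (- 1) * leg (- 1) = 1" by (rule leg_square)
  hence "l * l \<noteq> 0" unfolding l using q_gt_2 by auto
  show ?thesis
  proof (rule classification)
    \<comment> \<open>The Legendre symbol sums to zero over the units, so the two eigenvalues of
      \<open>M\<close> are opposite.\<close>
    show "l + - l = (\<Sum>y\<in>{1..<q}. leg y)" by (simp add: leg_sum_nonzero)
    show "l * - l = - (of_int q * leg (- 1))" using l by simp
    show "l \<noteq> - l" using \<open>l * l \<noteq> 0\<close> by (auto simp: eq_neg_iff_add_eq_0)
  qed
qed

end
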